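(* Let $\Sigma$ be a surface equipped with an area form $\omega$. Then there exists $g \in \mathrm{Ham}(\Sigma)$ with zero topological entropy which is not a $C^0$-limit of autonomous diffeomorphisms of $\Sigma$; that is, $g$ does not lie in the $C^0$-closure of the set of autonomous diffeomorphisms of $\Sigma$.
   Context: $\mathrm{Ham}(\Sigma)$ is the group of Hamiltonian diffeomorphisms of $(\Sigma,\omega)$ compactly supported in the interior of $\Sigma$: time-one maps of flows generated by smooth time-dependent functions $H_t:\Sigma\to\mathbb{R}$, $t \in [0,1]$, compactly supported in the interior of $\Sigma$, where the Hamiltonian vector field $X_H$ of a function $H$ is determined by $dH(\cdot)=\omega(X_H,\cdot)$. A diffeomorphism $h\in\mathrm{Diff}(\Sigma)$ is called autonomous if it is a time-$t$ map of the flow of a time-independent (smooth) vector field on $\Sigma$; it is not required to be area-preserving or Hamiltonian. The $C^0$-topology is that of the distance $d_{C^0}(f,h)=\sup_{x\in\Sigma} d(f(x),h(x))$, where $d$ is the distance of an auxiliary Riemannian metric on $\Sigma$. *)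

theory Defs
  imports "HOL-Analysis.Analysis"
begin

section \<open>Smooth maps between subsets of Euclidean spaces\<close>

text \<open>The predicate \<open>Ck_on k S f\<close> is only meant for open \<open>S\<close>.\<close>

primrec Ck_on :: "nat \<Rightarrow> 'a::euclidean_space set \<Rightarrow> ('a \<Rightarrow> 'b::real_normed_vector) \<Rightarrow> bool" where
  "Ck_on 0 S f \<longleftrightarrow> continuous_on S f"
| "Ck_on (Suc k) S f \<longleftrightarrow>
     f differentiable_on S \<and> (\<forall>v. Ck_on k S (\<lambda>x. frechet_derivative f (at x) v))"

text \<open>On an arbitrary set (in particular on relatively open subsets of a half-plane, and on
  products with a compact interval) smoothness means that the map extends locally to a smooth
  map on an open set.\<close>

definition smooth_on :: "'a::euclidean_space set \<Rightarrow> ('a \<Rightarrow> 'b::real_normed_vector) \<Rightarrow> bool" where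
  "smooth_on S f \<longleftrightarrow>
     (\<forall>x\<in>S. \<exists>U g. open U \<and> x \<in> U \<and> (\<forall>k. Ck_on k U g) \<and> (\<forall>y\<in>U \<inter> S. g y = f y))"


section \<open>Smooth surfaces\<close>

text \<open>A surface is a type \<open>'a\<close> (Hausdorff and second countable) together with a smooth atlas \<open>A\<close>
  of charts with values in the closed half-plane. It may have a boundary, and it need neither be
  compact nor connected. A chart consists of its domain and its coordinate map; the values of the
  coordinate map outside the domain are irrelevant.\<close>

type_synonym plane = "real \<times> real"

type_synonym 'a chart = "'a set \<times> ('a \<Rightarrow> plane)"

definition half_plane :: "plane set" where
  "half_plane = {p. 0 \<le> snd p}"

abbreviation chart_dom :: "'a chart \<Rightarrow> 'a set" where
  "chart_dom c \<equiv> fst c"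

abbreviation coord :: "'a chart \<Rightarrow> 'a \<Rightarrow> plane" where
  "coord c \<equiv> snd c"

definition chart_img :: "'a chart \<Rightarrow> plane set" where
  "chart_img c = coord c ` chart_dom c"

definition chart_inv :: "'a chart \<Rightarrow> plane \<Rightarrow> 'a" where
  "chart_inv c = inv_into (chart_dom c) (coord c)"

definition is_chart :: "'a::topological_space chart \<Rightarrow> bool" where
  "is_chart c \<longleftrightarrow>
     open (chart_dom c) \<and> openin (top_of_set half_plane) (chart_img c) \<and>
     homeomorphism (chart_dom c) (chart_img c) (coord c) (chart_inv c)"

definition overlap :: "'a chart \<Rightarrow> 'a chart \<Rightarrow> plane set" where
  "overlap c d = coord c ` (chart_dom c \<inter> chart_dom d)"

definition transition :: "'a chart \<Rightarrow> 'a chart \<Rightarrow> plane \<Rightarrow> plane" where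
  "transition c d = coord d \<circ> chart_inv c"

definition smooth_atlas :: "'a::topological_space chart set \<Rightarrow> bool" where
  "smooth_atlas A \<longleftrightarrow>
     (\<forall>c\<in>A. is_chart c) \<and> (\<Union>c\<in>A. chart_dom c) = UNIV \<and>
     (\<forall>c\<in>A. \<forall>d\<in>A. smooth_on (overlap c d) (transition c d))"

definition manifold_interior :: "'a chart set \<Rightarrow> 'a set" where
  "manifold_interior A = {x. \<exists>c\<in>A. x \<in> chart_dom c \<and> 0 < snd (coord c x)}"

definition smooth_map :: "'a::topological_space chart set \<Rightarrow> ('a \<Rightarrow> 'a) \<Rightarrow> bool" where
  "smooth_map A f \<longleftrightarrow>
     continuous_on UNIV f \<and>
     (\<forall>c\<in>A. \<forall>d\<in>A. smooth_on (coord c ` (chart_dom c \<inter> f -` chart_dom d))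
                             (coord d \<circ> f \<circ> chart_inv c))"

definition diffeomorphism :: "'a::topological_space chart set \<Rightarrow> ('a \<Rightarrow> 'a) \<Rightarrow> bool" where
  "diffeomorphism A f \<longleftrightarrow> bij f \<and> smooth_map A f \<and> smooth_map A (inv f)"


section \<open>Tangent vectors, vector fields and tensor fields\<close>

text \<open>A tangent vector at \<open>x\<close> is given by its components in all charts around \<open>x\<close>, related by the
  derivatives of the transition maps. Components in all other charts are \<open>0\<close>, so that equality of
  tangent vectors is equality of functions.\<close>

type_synonym 'a tangent = "'a chart \<Rightarrow> plane"

definition transition_deriv :: "'a chart \<Rightarrow> 'a chart \<Rightarrow> 'a \<Rightarrow> plane \<Rightarrow> plane" where
  "transition_deriv c d x =
     frechet_derivative (transition c d) (at (coord c x) within overlap c d)"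

definition tangent_space :: "'a chart set \<Rightarrow> 'a \<Rightarrow> 'a tangent set" where
  "tangent_space A x =
     {v. (\<forall>c. \<not> (c \<in> A \<and> x \<in> chart_dom c) \<longrightarrow> v c = 0) \<and>
         (\<forall>c\<in>A. \<forall>d\<in>A. x \<in> chart_dom c \<inter> chart_dom d \<longrightarrow> v d = transition_deriv c d x (v c))}"

text \<open>The tangent vector at \<open>x\<close> whose component in the chart \<open>c\<close> is \<open>p\<close>.\<close>

definition tangent_of :: "'a chart set \<Rightarrow> 'a chart \<Rightarrow> 'a \<Rightarrow> plane \<Rightarrow> 'a tangent" where
  "tangent_of A c x p =
     (\<lambda>d. if d \<in> A \<and> x \<in> chart_dom d then transition_deriv c d x p else 0)"

definition smooth_vector_field :: "'a chart set \<Rightarrow> ('a \<Rightarrow> 'a tangent) \<Rightarrow> bool" where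
  "smooth_vector_field A X \<longleftrightarrow>
     (\<forall>x. X x \<in> tangent_space A x) \<and>
     (\<forall>c\<in>A. smooth_on (chart_img c) (\<lambda>z. X (chart_inv c z) c))"

type_synonym 'a tensor2 = "'a \<Rightarrow> 'a tangent \<Rightarrow> 'a tangent \<Rightarrow> real"

definition smooth_tensor2 :: "'a chart set \<Rightarrow> 'a tensor2 \<Rightarrow> bool" where
  "smooth_tensor2 A B \<longleftrightarrow>
     (\<forall>x. \<forall>u\<in>tangent_space A x. \<forall>v\<in>tangent_space A x. \<forall>w\<in>tangent_space A x. \<forall>a.
        B x (\<lambda>c. a *\<^sub>R u c + v c) w = a * B x u w + B x v w \<and>
        B x w (\<lambda>c. a *\<^sub>R u c + v c) = a * B x w u + B x w v) \<and>
     (\<forall>c\<in>A. \<forall>p q. smooth_on (chart_img c)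
        (\<lambda>z. B (chart_inv c z) (tangent_of A c (chart_inv c z) p) (tangent_of A c (chart_inv c z) q)))"

definition area_form :: "'a chart set \<Rightarrow> 'a tensor2 \<Rightarrow> bool" where
  "area_form A \<omega> \<longleftrightarrow>
     smooth_tensor2 A \<omega> \<and>
     (\<forall>x. \<forall>u\<in>tangent_space A x. \<omega> x u u = 0) \<and>
     (\<forall>x. \<forall>u\<in>tangent_space A x. u \<noteq> (\<lambda>c. 0) \<longrightarrow> (\<exists>v\<in>tangent_space A x. \<omega> x u v \<noteq> 0))"

definition riemannian_metric :: "'a chart set \<Rightarrow> 'a tensor2 \<Rightarrow> bool" where
  "riemannian_metric A \<rho> \<longleftrightarrow>
     smooth_tensor2 A \<rho> \<and>
     (\<forall>x. \<forall>u\<in>tangent_space A x. \<forall>v\<in>tangent_space A x. \<rho> x u v = \<rho> x v u) \<and>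
     (\<forall>x. \<forall>u\<in>tangent_space A x. u \<noteq> (\<lambda>c. 0) \<longrightarrow> 0 < \<rho> x u u)"


section \<open>Flows, Hamiltonian and autonomous diffeomorphisms\<close>

definition integral_curve ::
    "'a::topological_space chart set \<Rightarrow> real set \<Rightarrow> (real \<Rightarrow> 'a \<Rightarrow> 'a tangent) \<Rightarrow> (real \<Rightarrow> 'a) \<Rightarrow> bool" where
  "integral_curve A I X \<gamma> \<longleftrightarrow>
     continuous_on I \<gamma> \<and>
     (\<forall>t\<in>I. \<forall>c\<in>A. \<gamma> t \<in> chart_dom c \<longrightarrow>
        ((coord c \<circ> \<gamma>) has_vector_derivative X t (\<gamma> t) c) (at t within I))"

definition flow_on ::
    "'a::topological_space chart set \<Rightarrow> real set \<Rightarrow> (real \<Rightarrow> 'a \<Rightarrow> 'a tangent) \<Rightarrow> (real \<Rightarrow> 'a \<Rightarrow> 'a) \<Rightarrow> bool" where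
  "flow_on A I X \<phi> \<longleftrightarrow> (\<forall>x. \<phi> 0 x = x \<and> integral_curve A I X (\<lambda>t. \<phi> t x))"

text \<open>The differential of a function at \<open>x\<close>, computed in the chart \<open>c\<close>.\<close>

definition differential :: "'a chart \<Rightarrow> ('a \<Rightarrow> real) \<Rightarrow> 'a \<Rightarrow> 'a tangent \<Rightarrow> real" where
  "differential c f x v =
     frechet_derivative (f \<circ> chart_inv c) (at (coord c x) within chart_img c) (v c)"

definition hamiltonian_vector_field ::
    "'a chart set \<Rightarrow> 'a tensor2 \<Rightarrow> ('a \<Rightarrow> real) \<Rightarrow> ('a \<Rightarrow> 'a tangent) \<Rightarrow> bool" where
  "hamiltonian_vector_field A \<omega> f X \<longleftrightarrow>
     smooth_vector_field A X \<and>
     (\<forall>c\<in>A. \<forall>x\<in>chart_dom c. \<forall>v\<in>tangent_space A x. differential c f x v = \<omega> x (X x) v)"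

definition admissible_hamiltonian ::
    "'a::topological_space chart set \<Rightarrow> (real \<Rightarrow> 'a \<Rightarrow> real) \<Rightarrow> bool" where
  "admissible_hamiltonian A H \<longleftrightarrow>
     (\<forall>c\<in>A. smooth_on ({0..1} \<times> chart_img c) (\<lambda>(t, z). H t (chart_inv c z))) \<and>
     (\<exists>K. compact K \<and> K \<subseteq> manifold_interior A \<and> (\<forall>t\<in>{0..1}. \<forall>x. x \<notin> K \<longrightarrow> H t x = 0))"

definition Ham :: "'a::topological_space chart set \<Rightarrow> 'a tensor2 \<Rightarrow> ('a \<Rightarrow> 'a) set" where
  "Ham A \<omega> =
     {g. \<exists>H X \<phi>. admissible_hamiltonian A H \<and>
           (\<forall>t\<in>{0..1}. hamiltonian_vector_field A \<omega> (H t) (X t)) \<and>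
           flow_on A {0..1} X \<phi> \<and> g = \<phi> 1}"

definition autonomous :: "'a::topological_space chart set \<Rightarrow> ('a \<Rightarrow> 'a) \<Rightarrow> bool" where
  "autonomous A h \<longleftrightarrow>
     diffeomorphism A h \<and>
     (\<exists>X \<phi> t. smooth_vector_field A X \<and> flow_on A UNIV (\<lambda>_. X) \<phi> \<and> h = \<phi> t)"


section \<open>The \<open>C\<^sup>0\<close>-distance\<close>

definition smooth_curve :: "'a::topological_space chart set \<Rightarrow> (real \<Rightarrow> 'a) \<Rightarrow> bool" where
  "smooth_curve A \<gamma> \<longleftrightarrow>
     continuous_on {0..1} \<gamma> \<and>
     (\<forall>c\<in>A. smooth_on {t\<in>{0..1}. \<gamma> t \<in> chart_dom c} (coord c \<circ> \<gamma>))"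

definition velocity :: "'a chart set \<Rightarrow> (real \<Rightarrow> 'a) \<Rightarrow> real \<Rightarrow> 'a tangent" where
  "velocity A \<gamma> t =
     (\<lambda>c. if c \<in> A \<and> \<gamma> t \<in> chart_dom c
          then vector_derivative (coord c \<circ> \<gamma>) (at t within {0..1}) else 0)"

definition curve_length :: "'a chart set \<Rightarrow> 'a tensor2 \<Rightarrow> (real \<Rightarrow> 'a) \<Rightarrow> real" where
  "curve_length A \<rho> \<gamma> =
     integral {0..1} (\<lambda>t. sqrt (\<rho> (\<gamma> t) (velocity A \<gamma> t) (velocity A \<gamma> t)))"

text \<open>The velocity of a smooth curve may vanish, so piecewise smooth curves can be reparametrised
  to smooth ones and need not be considered separately. The distance between points of different
  connected components is \<open>\<infinity>\<close>.\<close>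

definition riemannian_dist ::
    "'a::topological_space chart set \<Rightarrow> 'a tensor2 \<Rightarrow> 'a \<Rightarrow> 'a \<Rightarrow> ereal" where
  "riemannian_dist A \<rho> x y =
     (INF \<gamma>\<in>{\<gamma>. smooth_curve A \<gamma> \<and> \<gamma> 0 = x \<and> \<gamma> 1 = y}. ereal (curve_length A \<rho> \<gamma>))"

definition C0_dist ::
    "'a::topological_space chart set \<Rightarrow> 'a tensor2 \<Rightarrow> ('a \<Rightarrow> 'a) \<Rightarrow> ('a \<Rightarrow> 'a) \<Rightarrow> ereal" where
  "C0_dist A \<rho> f h = (SUP x. riemannian_dist A \<rho> (f x) (h x))"

definition C0_closure ::
    "'a::topological_space chart set \<Rightarrow> 'a tensor2 \<Rightarrow> ('a \<Rightarrow> 'a) set \<Rightarrow> ('a \<Rightarrow> 'a) set" where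
  "C0_closure A \<rho> S = {g. \<forall>\<epsilon>::real. 0 < \<epsilon> \<longrightarrow> (\<exists>h\<in>S. C0_dist A \<rho> g h < ereal \<epsilon>)}"


section \<open>Topological entropy\<close>

text \<open>Entropy of a continuous self-map of a compact set \<open>K\<close> in the sense of Adler, Konheim and
  McAndrew, via open covers of \<open>K\<close>.\<close>

definition open_cover :: "'a::topological_space set \<Rightarrow> 'a set set \<Rightarrow> bool" where
  "open_cover K C \<longleftrightarrow> (\<forall>U\<in>C. openin (top_of_set K) U) \<and> \<Union>C = K"

definition min_subcover_card :: "'a set \<Rightarrow> 'a set set \<Rightarrow> nat" where
  "min_subcover_card K C = (LEAST k. \<exists>D. D \<subseteq> C \<and> finite D \<and> card D = k \<and> K \<subseteq> \<Union>D)"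

definition iterated_cover :: "'a set \<Rightarrow> ('a \<Rightarrow> 'a) \<Rightarrow> 'a set set \<Rightarrow> nat \<Rightarrow> 'a set set" where
  "iterated_cover K f C n =
     {{x\<in>K. \<forall>i<n. (f ^^ i) x \<in> u i} | u. \<forall>i<n. u i \<in> C}"

definition cover_entropy :: "'a set \<Rightarrow> ('a \<Rightarrow> 'a) \<Rightarrow> 'a set set \<Rightarrow> ereal" where
  "cover_entropy K f C =
     limsup (\<lambda>n. ereal (ln (real (min_subcover_card K (iterated_cover K f C n))) / real n))"

definition compact_entropy :: "'a::topological_space set \<Rightarrow> ('a \<Rightarrow> 'a) \<Rightarrow> ereal" where
  "compact_entropy K f = (SUP C\<in>{C. open_cover K C}. cover_entropy K f C)"

text \<open>On a compact space the supremum is attained at \<open>K = UNIV\<close>. For a compactly supported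
  homeomorphism of a non-compact space it is the entropy of the restriction to the support.\<close>

definition topological_entropy :: "('a::topological_space \<Rightarrow> 'a) \<Rightarrow> ereal" where
  "topological_entropy f = (SUP K\<in>{K. compact K \<and> f ` K \<subseteq> K}. compact_entropy K f)"

end

theory Submission
  imports Defs
begin

text \<open>The map \<open>g\<close> is supported in one small disc inside the surface. In suitable coordinates this is the
disc \<open>|z| \<le> 4\<close> of the complex plane with a constant multiple of the standard area form. There \<open>g\<close> first
turns the two discs of radius \<open>1/2\<close> around \<open>2\<close> and \<open>-2\<close> by a quarter and then exchanges them by a half
turn around the origin; both motions are damped to the identity by twists. Hence \<open>g\<^sup>2\<close> is the half turn
\<open>z \<mapsto> 4 - z\<close> near the point \<open>2\<close>, which itself has period two.

Suppose that \<open>h\<close>, the time-\<open>t\<close> map of a flow \<open>\<phi>\<close>, is \<open>C\<^sup>0\<close>-close to \<open>g\<close>. Then \<open>h\<^sup>2\<close> is close to a half turn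
near \<open>2\<close>, and Brouwer's theorem yields a fixed point \<open>q\<close> of \<open>h\<^sup>2\<close> close to \<open>2\<close>, whereas \<open>h q\<close> is close to
\<open>-2\<close>. As \<open>h\<close> commutes with the flow, all points of the flow line from \<open>q\<close> to \<open>h q = \<phi>\<^sub>t q\<close> are fixed by
\<open>h\<^sup>2\<close>. This line crosses the circle \<open>|z - 2| = 1/2\<close>, on which the half turn moves every point by the
distance \<open>1\<close>, so \<open>h\<^sup>2\<close> has no fixed points there: a contradiction (\<open>swap_not_approximable\<close>). Besides
Brouwer's theorem the argument rests on the uniqueness of integral curves on a surface, which makes
\<open>\<phi>\<close> a one-parameter group (\<open>flow_group_law\<close>), and on a comparison of the Riemannian distance with the
coordinates (\<open>riemannian_dist_coordinates\<close>).

The entropy vanishes because \<open>g\<^sup>n\<close> is a composition of three twists whose angles are proportional to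
\<open>n\<close>. Its Lipschitz constant is therefore bounded by a polynomial in \<open>n\<close>, and polynomially many members of
the iterated cover suffice (\<open>topological_entropy_zero_polynomial_growth\<close>).

That \<open>g\<close> is Hamiltonian is shown without any existence theorem for flows, since the isotopy from the
identity to \<open>g\<close> is explicit: all points rotate about the origin, and the points of the two small discs
rotate at the same time about the moving centres. It is generated by a sum of radial functions about
the origin and the two centres. The area coordinates come from integrating the density of the area form
in the vertical direction (\<open>darboux_chart\<close>).\<close>

section \<open>Calculus of smooth maps\<close>

lemma Ck_on_cong_imp:
  assumes "open S" "\<And>x. x \<in> S \<Longrightarrow> f x = g x" "Ck_on k S f"
  shows "Ck_on k S g"
  using assms(2,3)
proof (induction k arbitrary: f g)
  case 0
  then show ?case by (simp cong: continuous_on_cong)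
next
  case (Suc k)
  have D: "(g has_derivative D) (at x)" if "x \<in> S" "(f has_derivative D) (at x)" for x D
    by (rule has_derivative_transform_within_open[OF that(2) assms(1) that(1)]) (rule Suc.prems(1))
  have df: "f differentiable (at x)" if "x \<in> S" for x
    using Suc.prems(2) that assms(1) by (simp add: differentiable_on_def at_within_open_NO_MATCH)
  have eq: "frechet_derivative f (at x) = frechet_derivative g (at x)" if "x \<in> S" for x
    using frechet_derivative_at[OF D[OF that df[OF that, unfolded frechet_derivative_works]]] .
  have "g differentiable_on S"
    unfolding differentiable_on_def
  proof
    fix x assume "x \<in> S"
    then have "(g has_derivative frechet_derivative f (at x)) (at x)"
      using D[OF _ df[unfolded frechet_derivative_works]] by blast
    then show "g differentiable at x within S" using differentiableI differentiable_at_withinI by blast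
  qed
  moreover have "Ck_on k S (\<lambda>x. frechet_derivative g (at x) v)" for v
    by (rule Suc.IH[where f="\<lambda>x. frechet_derivative f (at x) v"]) (use eq Suc.prems in auto)
  ultimately show ?case by simp
qed

text \<open>The derivative in the definition of \<open>Ck_on\<close> is a chosen one. In the following form any derivative at
hand may be used, which turns the closure properties below into inductions on \<open>k\<close>.\<close>

lemma Ck_on_Suc_iff:
  assumes "open S"
  shows "Ck_on (Suc k) S f \<longleftrightarrow> (\<exists>f'. (\<forall>x\<in>S. (f has_derivative f' x) (at x)) \<and> (\<forall>v. Ck_on k S (\<lambda>x. f' x v)))"
proof
  assume "Ck_on (Suc k) S f"
  then have "\<forall>x\<in>S. (f has_derivative frechet_derivative f (at x)) (at x)"
    "\<forall>v. Ck_on k S (\<lambda>x. frechet_derivative f (at x) v)"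
    using assms by (auto simp: differentiable_on_def at_within_open_NO_MATCH frechet_derivative_works[symmetric])
  then show "\<exists>f'. (\<forall>x\<in>S. (f has_derivative f' x) (at x)) \<and> (\<forall>v. Ck_on k S (\<lambda>x. f' x v))"
    by (intro exI[of _ "\<lambda>x. frechet_derivative f (at x)"]) simp
next
  assume "\<exists>f'. (\<forall>x\<in>S. (f has_derivative f' x) (at x)) \<and> (\<forall>v. Ck_on k S (\<lambda>x. f' x v))"
  then obtain f' where f': "\<And>x. x \<in> S \<Longrightarrow> (f has_derivative f' x) (at x)" "\<And>v. Ck_on k S (\<lambda>x. f' x v)"
    by blast
  have "f differentiable_on S"
    unfolding differentiable_on_def using f'(1) differentiableI differentiable_at_withinI by blast
  moreover have "Ck_on k S (\<lambda>x. frechet_derivative f (at x) v)" for v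
    by (rule Ck_on_cong_imp[OF assms _ f'(2)[of v]]) (simp add: frechet_derivative_at[OF f'(1), symmetric])
  ultimately show "Ck_on (Suc k) S f" by simp
qed

lemma Ck_on_has_derivative:
  assumes "open S" "Ck_on (Suc k) S f" "x \<in> S"
  shows "(f has_derivative frechet_derivative f (at x)) (at x)"
proof -
  have "f differentiable (at x)"
    using assms differentiable_on_eq_differentiable_at[OF assms(1)] by auto
  then show ?thesis by (simp add: frechet_derivative_works[symmetric])
qed

lemma Ck_on_subset:
  assumes "open S" "open T" "T \<subseteq> S" "Ck_on k S f"
  shows "Ck_on k T f"
  using assms(4)
proof (induction k arbitrary: f)
  case 0 then show ?case using assms(3) continuous_on_subset by auto
next
  case (Suc k)
  then show ?case using assms(3) by (auto intro: differentiable_on_subset)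
qed

lemma Ck_on_Suc_imp:
  assumes "open S" "Ck_on (Suc k) S f"
  shows "Ck_on k S f"
  using assms(2)
proof (induction k arbitrary: f)
  case 0 then show ?case by (simp add: differentiable_imp_continuous_on)
next
  case (Suc k)
  then show ?case by simp
qed

lemma Ck_on_const [simp]: "open S \<Longrightarrow> Ck_on k S (\<lambda>x. c)"
proof (induction k arbitrary: c)
  case (Suc k)
  then show ?case using Ck_on_Suc_iff[of S k "\<lambda>x. c"] by (auto intro!: exI[of _ "\<lambda>x v. 0"])
qed simp

lemma Ck_on_linear_compose:
  assumes "open S" "bounded_linear L" "Ck_on k S f"
  shows "Ck_on k S (\<lambda>x. L (f x))"
  using assms(3)
proof (induction k arbitrary: f)
  case 0
  then show ?case using assms(2) by (simp add: bounded_linear.continuous_on)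
next
  case (Suc k)
  then obtain f' where "\<forall>x\<in>S. (f has_derivative f' x) (at x)" "\<forall>v. Ck_on k S (\<lambda>x. f' x v)"
    using Ck_on_Suc_iff[OF assms(1)] by blast
  then show ?case unfolding Ck_on_Suc_iff[OF assms(1)]
    using Suc.IH bounded_linear.has_derivative[OF assms(2)] by (intro exI[of _ "\<lambda>x v. L (f' x v)"]) (auto simp: bounded_linear.has_derivative[OF assms(2)])
qed

lemma Ck_on_add:
  assumes "open S" "Ck_on k S f" "Ck_on k S g"
  shows "Ck_on k S (\<lambda>x. f x + g x)"
  using assms(2,3)
proof (induction k arbitrary: f g)
  case 0
  then show ?case by (simp add: continuous_on_add)
next
  case (Suc k)
  obtain f' g' where "\<forall>x\<in>S. (f has_derivative f' x) (at x)" "\<forall>v. Ck_on k S (\<lambda>x. f' x v)"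
    "\<forall>x\<in>S. (g has_derivative g' x) (at x)" "\<forall>v. Ck_on k S (\<lambda>x. g' x v)"
    using Suc.prems Ck_on_Suc_iff[OF assms(1)] by metis
  then show ?case unfolding Ck_on_Suc_iff[OF assms(1)]
    using Suc.IH by (intro exI[of _ "\<lambda>x v. f' x v + g' x v"]) (auto intro: has_derivative_add)
qed

lemma Ck_on_bilinear:
  assumes "open S" "bounded_bilinear B" "Ck_on k S f" "Ck_on k S g"
  shows "Ck_on k S (\<lambda>x. B (f x) (g x))"
  using assms(3,4)
proof (induction k arbitrary: f g)
  case 0
  then show ?case using assms(2) by (simp add: bounded_bilinear.continuous_on)
next
  case (Suc k)
  obtain f' g' where "\<forall>x\<in>S. (f has_derivative f' x) (at x)" "\<forall>v. Ck_on k S (\<lambda>x. f' x v)"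
    "\<forall>x\<in>S. (g has_derivative g' x) (at x)" "\<forall>v. Ck_on k S (\<lambda>x. g' x v)"
    using Suc.prems Ck_on_Suc_iff[OF assms(1)] by metis
  then show ?case unfolding Ck_on_Suc_iff[OF assms(1)]
    using Suc.IH Ck_on_Suc_imp[OF assms(1) Suc.prems(1)] Ck_on_Suc_imp[OF assms(1) Suc.prems(2)]
    by (intro exI[of _ "\<lambda>x v. B (f x) (g' x v) + B (f' x v) (g x)"])
      (auto intro!: bounded_bilinear.FDERIV[OF assms(2)] Ck_on_add[OF assms(1)])
qed

lemmas Ck_on_scaleR = Ck_on_bilinear[OF _ bounded_bilinear_scaleR]
lemmas Ck_on_mult = Ck_on_bilinear[OF _ bounded_bilinear_mult]
lemmas Ck_on_inner = Ck_on_bilinear[OF _ bounded_bilinear_inner]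

lemma Ck_on_sum:
  assumes "open S" "\<And>i. i \<in> I \<Longrightarrow> Ck_on k S (f i)"
  shows "Ck_on k S (\<lambda>x. \<Sum>i\<in>I. f i x)"
  using assms(2) by (induction I rule: infinite_finite_induct) (auto intro!: Ck_on_add assms(1) simp: assms(1))

lemma Ck_on_minus: "open S \<Longrightarrow> Ck_on k S f \<Longrightarrow> Ck_on k S (\<lambda>x. - f x)"
  using Ck_on_linear_compose[of S uminus k f] by (simp add: bounded_linear_minus[OF bounded_linear_ident])

lemma Ck_on_diff: "open S \<Longrightarrow> Ck_on k S f \<Longrightarrow> Ck_on k S g \<Longrightarrow> Ck_on k S (\<lambda>x. f x - g x)"
  using Ck_on_add[of S k f "\<lambda>x. - g x"] Ck_on_minus by auto

lemma Ck_on_linear: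
  assumes "open S" "bounded_linear L"
  shows "Ck_on k S L"
proof (cases k)
  case 0
  then show ?thesis using assms by (simp add: linear_continuous_on)
next
  case (Suc k')
  have "\<forall>x\<in>S. (L has_derivative L) (at x)" "\<forall>v. Ck_on k' S (\<lambda>x. L v)"
    using assms by (auto intro: bounded_linear_imp_has_derivative)
  then show ?thesis unfolding Suc Ck_on_Suc_iff[OF assms(1)] by (intro exI[of _ "\<lambda>x. L"]) blast
qed

lemma Ck_on_ident: "open S \<Longrightarrow> Ck_on k S (\<lambda>x. x)"
  using Ck_on_linear[of S "\<lambda>x. x"] bounded_linear_ident by auto

lemma Ck_on_Pair:
  assumes "open S" "Ck_on k S f" "Ck_on k S g"
  shows "Ck_on k S (\<lambda>x. (f x, g x))"
proof -
  have "bounded_linear (\<lambda>a::'b. (a, 0::'c))" "bounded_linear (\<lambda>b::'c. (0::'b, b))"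
    by (auto intro!: bounded_linear_Pair bounded_linear_ident bounded_linear_zero)
  then have "Ck_on k S (\<lambda>x. (f x, 0) + (0, g x))"
    using assms by (intro Ck_on_add Ck_on_linear_compose[OF assms(1), where L="\<lambda>a. (a, 0)"]
        Ck_on_linear_compose[OF assms(1), where L="\<lambda>b. (0, b)"])
  then show ?thesis by simp
qed

text \<open>The derivative of the composition is \<open>g' (f x) (f' x v)\<close>, in which \<open>x\<close> occurs in two places. Expanding
\<open>f' x v\<close> in a basis separates them into products of functions to which the induction hypothesis applies.\<close>

lemma Ck_on_compose:
  fixes f :: "'a::euclidean_space \<Rightarrow> 'b::euclidean_space" and g :: "'b \<Rightarrow> 'c::real_normed_vector"
  assumes "open S" "open T" "f ` S \<subseteq> T" "Ck_on k S f" "Ck_on k T g"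
  shows "Ck_on k S (\<lambda>x. g (f x))"
  using assms(4,5)
proof (induction k arbitrary: g)
  case 0
  then show ?case using continuous_on_compose2[of T g S f] assms(3) by simp
next
  case (Suc k)
  obtain f' where f': "\<forall>x\<in>S. (f has_derivative f' x) (at x)" "\<forall>v. Ck_on k S (\<lambda>x. f' x v)"
    using Suc.prems Ck_on_Suc_iff[OF assms(1)] by metis
  obtain g' where g': "\<forall>x\<in>T. (g has_derivative g' x) (at x)" "\<forall>v. Ck_on k T (\<lambda>x. g' x v)"
    using Suc.prems Ck_on_Suc_iff[OF assms(2)] by metis
  have d: "((\<lambda>x. g (f x)) has_derivative (\<lambda>v. \<Sum>b\<in>Basis. (f' x v \<bullet> b) *\<^sub>R g' (f x) b)) (at x)" if "x \<in> S" for x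
  proof -
    have fx: "f x \<in> T" using that assms(3) by auto
    have c: "((\<lambda>x. g (f x)) has_derivative (\<lambda>v. g' (f x) (f' x v))) (at x)"
      using diff_chain_at[OF f'(1)[rule_format, OF that] g'(1)[rule_format, OF fx]] by (simp add: o_def)
    have e: "g' (f x) w = (\<Sum>b\<in>Basis. (w \<bullet> b) *\<^sub>R g' (f x) b)" for w
    proof -
      interpret bounded_linear "g' (f x)" using g'(1) fx has_derivative_bounded_linear by blast
      show ?thesis by (subst (1) euclidean_representation[symmetric]) (simp add: sum scale)
    qed
    show ?thesis by (rule has_derivative_eq_rhs[OF c]) (rule ext, rule e)
  qed
  have c: "Ck_on k S (\<lambda>x. \<Sum>b\<in>Basis. (f' x v \<bullet> b) *\<^sub>R g' (f x) b)" for v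
  proof (rule Ck_on_sum[OF assms(1)])
    fix b :: 'b assume "b \<in> Basis"
    have "Ck_on k S (\<lambda>x. g' (f x) b)"
      using Suc.IH[OF Ck_on_Suc_imp[OF assms(1) Suc.prems(1)]] g'(2) by blast
    moreover have "Ck_on k S (\<lambda>x. f' x v \<bullet> b)"
      by (rule Ck_on_inner[OF assms(1)]) (use f' assms(1) in auto)
    ultimately show "Ck_on k S (\<lambda>x. (f' x v \<bullet> b) *\<^sub>R g' (f x) b)"
      by (intro Ck_on_scaleR assms(1))
  qed
  show ?case unfolding Ck_on_Suc_iff[OF assms(1)]
    by (rule exI[of _ "\<lambda>x v. \<Sum>b\<in>Basis. (f' x v \<bullet> b) *\<^sub>R g' (f x) b"]) (use c d in blast)
qed

lemma Ck_on_derivative_sequence: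
  fixes F :: "nat \<Rightarrow> real \<Rightarrow> real"
  assumes "\<And>n x. (F n has_real_derivative F (Suc n) x) (at x)"
  shows "Ck_on k UNIV (F n)"
proof (induction k arbitrary: n)
  case 0
  then show ?case using assms DERIV_isCont continuous_at_imp_continuous_on by (metis Ck_on.simps(1))
next
  case (Suc k)
  have "Ck_on k UNIV (\<lambda>x. F (Suc n) x * v)" for v
    by (intro Ck_on_mult Suc) auto
  then show ?case unfolding Ck_on_Suc_iff[OF open_UNIV]
    using assms[unfolded has_field_derivative_def] by (intro exI[of _ "\<lambda>x v. F (Suc n) x * v"]) simp
qed

lemma Ck_on_cos: "Ck_on k UNIV (cos :: real \<Rightarrow> real)"
  and Ck_on_sin: "Ck_on k UNIV (sin :: real \<Rightarrow> real)"
proof -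
  \<comment> \<open>The \<open>n\<close>-th derivative of the cosine is the cosine shifted by \<open>n\<close> quarter periods.\<close>
  have d: "((\<lambda>x. cos (x + real n * (pi/2))) has_real_derivative cos (x + real (Suc n) * (pi/2))) (at x)" for n x
  proof -
    have "cos (x + real (Suc n) * (pi/2)) = cos ((x + real n * (pi/2)) + pi/2)" by (simp add: algebra_simps add_divide_distrib)
    also have "\<dots> = - sin (x + real n * (pi/2))" by (simp add: cos_add)
    finally show ?thesis by (auto intro!: derivative_eq_intros)
  qed
  have "cos (x + pi/2) = - sin x" for x :: real by (simp add: cos_add)
  then show "Ck_on k UNIV (cos :: real \<Rightarrow> real)" "Ck_on k UNIV (sin :: real \<Rightarrow> real)"
    using Ck_on_derivative_sequence[of "\<lambda>n x. cos (x + real n * (pi/2))" k 0, OF d]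
      Ck_on_minus[OF open_UNIV Ck_on_derivative_sequence[of "\<lambda>n x. cos (x + real n * (pi/2))" k 1, OF d]]
    by simp_all
qed

lemma Ck_on_inverse:
  fixes f :: "'a::euclidean_space \<Rightarrow> real"
  assumes "open S" "\<And>x. x \<in> S \<Longrightarrow> f x \<noteq> 0" "Ck_on k S f"
  shows "Ck_on k S (\<lambda>x. inverse (f x))"
  using assms(3)
proof (induction k)
  case 0
  then show ?case using assms by (simp add: continuous_on_inverse)
next
  case (Suc k)
  obtain f' where f': "\<forall>x\<in>S. (f has_derivative f' x) (at x)" "\<forall>v. Ck_on k S (\<lambda>x. f' x v)"
    using Suc.prems Ck_on_Suc_iff[OF assms(1)] by metis
  have "Ck_on k S (\<lambda>x. - (inverse (f x) * f' x v * inverse (f x)))" for v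
    using f' Suc.IH[OF Ck_on_Suc_imp[OF assms(1) Suc.prems]]
    by (intro Ck_on_minus Ck_on_mult assms(1)) auto
  moreover have "((\<lambda>x. inverse (f x)) has_derivative (\<lambda>v. - (inverse (f x) * f' x v * inverse (f x)))) (at x)" if "x \<in> S" for x
    using that f' assms(2) by (intro Deriv.has_derivative_inverse) auto
  ultimately show ?case unfolding Ck_on_Suc_iff[OF assms(1)]
    by (intro exI[of _ "\<lambda>x v. - (inverse (f x) * f' x v * inverse (f x))"]) blast
qed

lemma Ck_on_local:
  assumes "\<And>x. x \<in> S \<Longrightarrow> \<exists>U. open U \<and> x \<in> U \<and> U \<subseteq> S \<and> Ck_on k U f"
  shows "Ck_on k S f"
  using assms
proof (induction k arbitrary: f)
  case 0
  show ?case unfolding Ck_on.simps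
  proof (rule continuous_at_imp_continuous_on, rule ballI)
    fix x assume "x \<in> S"
    then obtain U where "open U" "x \<in> U" "Ck_on 0 U f" using 0 by blast
    then show "isCont f x" by (simp add: continuous_on_eq_continuous_at)
  qed
next
  case (Suc k)
  have "f differentiable_on S" unfolding differentiable_on_def
  proof
    fix x assume "x \<in> S"
    then obtain U where "open U" "x \<in> U" "Ck_on (Suc k) U f" using Suc by blast
    then show "f differentiable at x within S"
      by (auto simp: differentiable_on_def at_within_open_NO_MATCH intro: differentiable_at_withinI)
  qed
  moreover have "Ck_on k S (\<lambda>x. frechet_derivative f (at x) v)" for v
    by (rule Suc.IH) (use Suc.prems in fastforce)
  ultimately show ?case by simp
qed

lemma smooth_onI:
  assumes "\<And>x. x \<in> S \<Longrightarrow> \<exists>U g. open U \<and> x \<in> U \<and> (\<forall>k. Ck_on k U g) \<and> (\<forall>y\<in>U \<inter> S. g y = f y)"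
  shows "smooth_on S f"
  unfolding smooth_on_def using assms by (rule ballI)

lemma smooth_onE:
  assumes "smooth_on S f" "x \<in> S"
  obtains U g where "open U" "x \<in> U" "\<And>k. Ck_on k U g" "\<And>y. y \<in> U \<Longrightarrow> y \<in> S \<Longrightarrow> g y = f y"
proof -
  have "\<exists>U g. open U \<and> x \<in> U \<and> (\<forall>k. Ck_on k U g) \<and> (\<forall>y\<in>U \<inter> S. g y = f y)"
    using assms unfolding smooth_on_def by (rule bspec)
  then obtain U g where "open U" "x \<in> U" "\<forall>k. Ck_on k U g" "\<forall>y\<in>U \<inter> S. g y = f y"
    by (elim exE conjE)
  then show thesis by (intro that[of U g]) auto
qed

lemma smooth_on_open_iff:
  assumes "open S"
  shows "smooth_on S f \<longleftrightarrow> (\<forall>k. Ck_on k S f)"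
proof
  assume s: "smooth_on S f"
  show "\<forall>k. Ck_on k S f"
  proof (intro allI Ck_on_local)
    fix k x assume "x \<in> S"
    obtain U g where U: "open U" "x \<in> U" "\<And>k. Ck_on k U g" "\<And>y. y \<in> U \<Longrightarrow> y \<in> S \<Longrightarrow> g y = f y"
      using smooth_onE[OF s \<open>x \<in> S\<close>] by metis
    have "Ck_on k (U \<inter> S) f"
      by (rule Ck_on_cong_imp[of _ g]) (use U assms Ck_on_subset[of U "U \<inter> S" k g] in auto)
    then show "\<exists>U. open U \<and> x \<in> U \<and> U \<subseteq> S \<and> Ck_on k U f"
      using U(1,2) \<open>x \<in> S\<close> assms by (intro exI[of _ "U \<inter> S"]) auto
  qed
next
  assume "\<forall>k. Ck_on k S f"
  then show "smooth_on S f"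
    by (intro smooth_onI exI[of _ S] exI[of _ f]) (use assms in auto)
qed

lemma smooth_on_cong_imp:
  assumes "\<And>x. x \<in> S \<Longrightarrow> f x = g x" "smooth_on S f"
  shows "smooth_on S g"
proof (rule smooth_onI)
  fix x assume "x \<in> S"
  obtain U h where "open U" "x \<in> U" "\<And>k. Ck_on k U h" "\<And>y. y \<in> U \<Longrightarrow> y \<in> S \<Longrightarrow> h y = f y"
    using smooth_onE[OF assms(2) \<open>x \<in> S\<close>] by metis
  then show "\<exists>U h. open U \<and> x \<in> U \<and> (\<forall>k. Ck_on k U h) \<and> (\<forall>y\<in>U \<inter> S. h y = g y)"
    using assms(1) by (intro exI[of _ U] exI[of _ h]) auto
qed

lemma smooth_on_subset:
  assumes "T \<subseteq> S" "smooth_on S f"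
  shows "smooth_on T f"
proof (rule smooth_onI)
  fix x assume "x \<in> T"
  then have "x \<in> S" using assms(1) by auto
  obtain U g where "open U" "x \<in> U" "\<And>k. Ck_on k U g" "\<And>y. y \<in> U \<Longrightarrow> y \<in> S \<Longrightarrow> g y = f y"
    using smooth_onE[OF assms(2) \<open>x \<in> S\<close>] by metis
  then show "\<exists>U g. open U \<and> x \<in> U \<and> (\<forall>k. Ck_on k U g) \<and> (\<forall>y\<in>U \<inter> T. g y = f y)"
    using assms(1) by (intro exI[of _ U] exI[of _ g]) auto
qed

lemma smooth_on_local:
  assumes "\<And>x. x \<in> S \<Longrightarrow> \<exists>U. open U \<and> x \<in> U \<and> smooth_on (U \<inter> S) f"
  shows "smooth_on S f"
proof (rule smooth_onI)
  fix x assume "x \<in> S"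
  obtain U where U: "open U" "x \<in> U" "smooth_on (U \<inter> S) f" using assms[OF \<open>x \<in> S\<close>] by blast
  have "x \<in> U \<inter> S" using U \<open>x \<in> S\<close> by auto
  obtain V g where V: "open V" "x \<in> V" "\<And>k. Ck_on k V g" "\<And>y. y \<in> V \<Longrightarrow> y \<in> U \<inter> S \<Longrightarrow> g y = f y"
    using smooth_onE[OF U(3) \<open>x \<in> U \<inter> S\<close>] by metis
  have "\<forall>k. Ck_on k (V \<inter> U) g" using Ck_on_subset[of V "V \<inter> U"] U V by auto
  then show "\<exists>U g. open U \<and> x \<in> U \<and> (\<forall>k. Ck_on k U g) \<and> (\<forall>y\<in>U \<inter> S. g y = f y)"
    using U V by (intro exI[of _ "V \<inter> U"] exI[of _ g]) auto
qed

lemma smooth_on_compose: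
  fixes f :: "'a::euclidean_space \<Rightarrow> 'b::euclidean_space" and g :: "'b \<Rightarrow> 'c::real_normed_vector"
  assumes "smooth_on S f" "smooth_on T g" "f ` S \<subseteq> T"
  shows "smooth_on S (\<lambda>x. g (f x))"
proof (rule smooth_onI)
  fix x assume "x \<in> S"
  obtain U F where U: "open U" "x \<in> U" "\<And>k. Ck_on k U F" "\<And>y. y \<in> U \<Longrightarrow> y \<in> S \<Longrightarrow> F y = f y"
    using smooth_onE[OF assms(1) \<open>x \<in> S\<close>] by metis
  have "f x \<in> T" using \<open>x \<in> S\<close> assms by auto
  obtain V G where V: "open V" "f x \<in> V" "\<And>k. Ck_on k V G" "\<And>y. y \<in> V \<Longrightarrow> y \<in> T \<Longrightarrow> G y = g y"
    using smooth_onE[OF assms(2) \<open>f x \<in> T\<close>] by metis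
  have "continuous_on U F" using U(3)[of 0] by simp
  then have o: "open (U \<inter> F -` V)" using U V continuous_open_preimage by blast
  have Fk: "Ck_on k (U \<inter> F -` V) F" for k by (rule Ck_on_subset[OF U(1) o _ U(3)]) auto
  have "Ck_on k (U \<inter> F -` V) (\<lambda>x. G (F x))" for k
    by (rule Ck_on_compose[OF o V(1) _ Fk V(3)]) auto
  then show "\<exists>U ga. open U \<and> x \<in> U \<and> (\<forall>k. Ck_on k U ga) \<and> (\<forall>y\<in>U \<inter> S. ga y = g (f y))"
    using o U V \<open>x \<in> S\<close> assms(3)
    by (intro exI[of _ "U \<inter> F -` V"] exI[of _ "\<lambda>x. G (F x)"]) (auto simp: image_subset_iff)
qed

text \<open>The local extensions of \<open>f\<close> and \<open>g\<close> live on different neighbourhoods and are combined on their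
intersection.\<close>

lemma smooth_on_lift2:
  fixes S :: "'a::euclidean_space set"
  assumes B: "\<And>(U :: 'a set) k f g. open U \<Longrightarrow> Ck_on k U f \<Longrightarrow> Ck_on k U g \<Longrightarrow> Ck_on k U (\<lambda>x. B (f x) (g x))"
    and "smooth_on S f" "smooth_on S g"
  shows "smooth_on S (\<lambda>x. B (f x) (g x))"
proof (rule smooth_onI)
  fix x assume "x \<in> S"
  obtain U F where U: "open U" "x \<in> U" "\<And>k. Ck_on k U F" "\<And>y. y \<in> U \<Longrightarrow> y \<in> S \<Longrightarrow> F y = f y"
    using smooth_onE[OF assms(2) \<open>x \<in> S\<close>] by metis
  obtain V G where V: "open V" "x \<in> V" "\<And>k. Ck_on k V G" "\<And>y. y \<in> V \<Longrightarrow> y \<in> S \<Longrightarrow> G y = g y"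
    using smooth_onE[OF assms(3) \<open>x \<in> S\<close>] by metis
  have o: "open (U \<inter> V)" using U V by auto
  have "Ck_on k (U \<inter> V) (\<lambda>x. B (F x) (G x))" for k
    using Ck_on_subset[OF U(1) o _ U(3)] Ck_on_subset[OF V(1) o _ V(3)] by (intro B[OF o, of k F G]) auto
  then show "\<exists>U ga. open U \<and> x \<in> U \<and> (\<forall>k. Ck_on k U ga) \<and> (\<forall>y\<in>U \<inter> S. ga y = B (f y) (g y))"
    using o U V by (intro exI[of _ "U \<inter> V"] exI[of _ "\<lambda>x. B (F x) (G x)"]) auto
qed

lemmas smooth_on_Pair = smooth_on_lift2[of Pair, OF Ck_on_Pair]

lemma smooth_on_bilinear:
  assumes "bounded_bilinear B" "smooth_on S f" "smooth_on S g"
  shows "smooth_on S (\<lambda>x. B (f x) (g x))"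
  by (rule smooth_on_lift2[of B, OF Ck_on_bilinear[OF _ assms(1)] assms(2,3)])

lemmas smooth_on_mult = smooth_on_bilinear[OF bounded_bilinear_mult]
lemmas smooth_on_scaleR = smooth_on_bilinear[OF bounded_bilinear_scaleR]

lemma smooth_on_Ck:
  assumes "open U" "S \<subseteq> U" "\<And>k. Ck_on k U f"
  shows "smooth_on S f"
  by (intro smooth_onI exI[of _ U] exI[of _ f]) (use assms in auto)

lemma smooth_on_const: "smooth_on S (\<lambda>x. c)"
  by (rule smooth_on_Ck[of UNIV]) auto

lemma smooth_on_linear: "bounded_linear L \<Longrightarrow> smooth_on S L"
  by (rule smooth_on_Ck[of UNIV]) (auto intro: Ck_on_linear)

lemma smooth_on_inverse:
  fixes f :: "'a::euclidean_space \<Rightarrow> real"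
  assumes "\<And>x. x \<in> S \<Longrightarrow> f x \<noteq> 0" "smooth_on S f"
  shows "smooth_on S (\<lambda>x. inverse (f x))"
proof (rule smooth_on_compose[OF assms(2)])
  show "smooth_on (- {0::real}) inverse"
    by (rule smooth_on_Ck[of "- {0}"]) (auto intro!: Ck_on_inverse Ck_on_ident)
qed (use assms in auto)

lemma smooth_on_imp_continuous_on:
  assumes "smooth_on S f"
  shows "continuous_on S f"
  unfolding continuous_on_eq_continuous_within
proof
  fix x assume "x \<in> S"
  obtain U g where U: "open U" "x \<in> U" "\<And>k. Ck_on k U g" "\<And>y. y \<in> U \<Longrightarrow> y \<in> S \<Longrightarrow> g y = f y"
    using smooth_onE[OF assms \<open>x \<in> S\<close>] by metis
  have "continuous_on U g" using U(3)[of 0] by simp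
  then have "continuous (at x within S) g"
    using U continuous_at_imp_continuous_within continuous_on_eq_continuous_at by blast
  then show "continuous (at x within S) f"
    using U \<open>x \<in> S\<close> by (elim continuous_transform_within_openin[of _ _ _ "U \<inter> S"]) (auto simp: openin_open)
qed

text \<open>The points of a thick set can be approached within the set along all coordinate axes. This makes
derivatives within the set unique. It holds for half-planes and for the time interval, whose boundary
points are not interior, and it is inherited by relatively open subsets.\<close>

definition thick :: "'a::euclidean_space set \<Rightarrow> bool" where
  "thick S \<longleftrightarrow> (\<forall>x\<in>S. \<forall>b\<in>Basis. \<forall>e>0. \<exists>d. 0 < \<bar>d\<bar> \<and> \<bar>d\<bar> < e \<and> x + d *\<^sub>R b \<in> S)"

lemma thick_derivative_unique:
  assumes "thick S" "x \<in> S" "(f has_derivative D) (at x within S)" "(f has_derivative D') (at x within S)"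
  shows "D = D'"
  using frechet_derivative_unique_within[OF assms(3,4)] assms(1,2) unfolding thick_def by blast

lemma frechet_derivative_eq:
  assumes "thick S" "x \<in> S" "(f has_derivative D) (at x within S)"
  shows "frechet_derivative f (at x within S) = D"
  using thick_derivative_unique[OF assms(1,2)] assms(3) frechet_derivative_works differentiableI by blast

lemma thick_openin:
  assumes "thick T" "openin (top_of_set T) S"
  shows "thick S"
  unfolding thick_def
proof (intro ballI allI impI)
  fix x b :: 'a and e :: real
  assume "x \<in> S" "b \<in> Basis" "0 < e"
  obtain U where U: "open U" "S = T \<inter> U" using assms(2) by (auto simp: openin_open)
  then obtain r where r: "r > 0" "ball x r \<subseteq> U" using \<open>x \<in> S\<close> open_contains_ball by blast
  obtain d where d: "0 < \<bar>d\<bar>" "\<bar>d\<bar> < min e r" "x + d *\<^sub>R b \<in> T"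
    using assms(1) \<open>x \<in> S\<close> \<open>b \<in> Basis\<close> U r \<open>0 < e\<close> unfolding thick_def
    by (metis IntD1 min_less_iff_conj)
  moreover have "x + d *\<^sub>R b \<in> ball x r" using d \<open>b \<in> Basis\<close> by (simp add: dist_norm)
  ultimately show "\<exists>d. 0 < \<bar>d\<bar> \<and> \<bar>d\<bar> < e \<and> x + d *\<^sub>R b \<in> S" using U r by (intro exI[of _ d]) auto
qed

lemma thick_half_plane: "thick half_plane"
  unfolding thick_def half_plane_def
proof (intro ballI allI impI)
  fix x b :: plane and e :: real assume a: "x \<in> {p. 0 \<le> snd p}" "b \<in> Basis" "0 < e"
  then have "0 \<le> snd b" by (auto simp: Basis_prod_def)
  then show "\<exists>d. 0 < \<bar>d\<bar> \<and> \<bar>d\<bar> < e \<and> x + d *\<^sub>R b \<in> {p. 0 \<le> snd p}"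
    using a by (intro exI[of _ "e/2"]) auto
qed

lemma thick_interval: "thick {0..1::real}"
  unfolding thick_def
proof (intro ballI allI impI)
  fix x b e :: real assume a: "x \<in> {0..1}" "b \<in> Basis" "0 < e"
  show "\<exists>d. 0 < \<bar>d\<bar> \<and> \<bar>d\<bar> < e \<and> x + d *\<^sub>R b \<in> {0..1}"
  proof (cases "x \<le> 1/2")
    case True then show ?thesis using a by (intro exI[of _ "min (e/2) (1/2)"]) auto
  next
    case False then show ?thesis using a by (intro exI[of _ "- min (e/2) (1/2)"]) auto
  qed
qed

text \<open>By uniqueness, a derivative within a thick set is the derivative of any local smooth extension. This
reduces differentiation at boundary points to open sets.\<close>

lemma smooth_on_local_derivative:
  assumes "thick S" "smooth_on S f" "x \<in> S"
  obtains U G where "open U" "x \<in> U" "\<And>k. Ck_on k U G" "\<And>y. y \<in> U \<inter> S \<Longrightarrow> G y = f y"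
    "\<And>y. y \<in> U \<Longrightarrow> (G has_derivative frechet_derivative G (at y)) (at y)"
    "\<And>y. y \<in> U \<inter> S \<Longrightarrow> (f has_derivative frechet_derivative G (at y)) (at y within S)"
    "\<And>y. y \<in> U \<inter> S \<Longrightarrow> frechet_derivative f (at y within S) = frechet_derivative G (at y)"
proof -
  obtain U G where U: "open U" "x \<in> U" "\<And>k. Ck_on k U G" "\<And>y. y \<in> U \<Longrightarrow> y \<in> S \<Longrightarrow> G y = f y"
    using smooth_onE[OF assms(2,3)] by metis
  have 1: "(G has_derivative frechet_derivative G (at y)) (at y)" if "y \<in> U" for y
    by (rule Ck_on_has_derivative[OF U(1) U(3)[of "Suc 0"] that])
  have 2: "(f has_derivative frechet_derivative G (at y)) (at y within S)" if yU: "y \<in> U \<inter> S" for y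
  proof -
    obtain e where e: "e > 0" "ball y e \<subseteq> U" using openE[OF U(1), of y] yU by blast
    have d: "(G has_derivative frechet_derivative G (at y)) (at y within S)"
      using 1 that has_derivative_at_withinI by blast
    show ?thesis using U(4) e that
      by (intro has_derivative_transform_within[OF d e(1)]) (auto simp: subset_iff dist_commute)
  qed
  then have "frechet_derivative f (at y within S) = frechet_derivative G (at y)" if "y \<in> U \<inter> S" for y
    using frechet_derivative_eq[OF assms(1)] that by blast
  then show thesis by (intro that[of U G]) (use U 1 2 in auto)
qed

lemma smooth_on_has_derivative:
  assumes "thick S" "smooth_on S f" "x \<in> S"
  shows "(f has_derivative frechet_derivative f (at x within S)) (at x within S)"
proof -
  obtain U G where U: "open U" "x \<in> U" "\<And>k. Ck_on k U G" "\<And>y. y \<in> U \<inter> S \<Longrightarrow> G y = f y"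
    "\<And>y. y \<in> U \<Longrightarrow> (G has_derivative frechet_derivative G (at y)) (at y)"
    "\<And>y. y \<in> U \<inter> S \<Longrightarrow> (f has_derivative frechet_derivative G (at y)) (at y within S)"
    "\<And>y. y \<in> U \<inter> S \<Longrightarrow> frechet_derivative f (at y within S) = frechet_derivative G (at y)"
    by (rule smooth_on_local_derivative[OF assms]) (rule that)
  have "f differentiable (at x within S)" using U(6)[of x] U(2) assms(3) differentiableI by blast
  then show ?thesis by (simp add: frechet_derivative_works[symmetric])
qed

lemma smooth_on_derivative:
  assumes "thick S" "smooth_on S f"
  shows "smooth_on S (\<lambda>x. frechet_derivative f (at x within S) v)"
proof (rule smooth_onI)
  fix x assume "x \<in> S"
  obtain U G where U: "open U" "x \<in> U" "\<And>k. Ck_on k U G" "\<And>y. y \<in> U \<inter> S \<Longrightarrow> G y = f y"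
    "\<And>y. y \<in> U \<Longrightarrow> (G has_derivative frechet_derivative G (at y)) (at y)"
    "\<And>y. y \<in> U \<inter> S \<Longrightarrow> (f has_derivative frechet_derivative G (at y)) (at y within S)"
    "\<And>y. y \<in> U \<inter> S \<Longrightarrow> frechet_derivative f (at y within S) = frechet_derivative G (at y)"
    by (rule smooth_on_local_derivative[OF assms \<open>x \<in> S\<close>]) (rule that)
  show "\<exists>U g. open U \<and> x \<in> U \<and> (\<forall>k. Ck_on k U g) \<and> (\<forall>y\<in>U \<inter> S. g y = frechet_derivative f (at y within S) v)"
    using U(1,2,7) U(3)[of "Suc _"] by (intro exI[of _ U] exI[of _ "\<lambda>y. frechet_derivative G (at y) v"]) auto
qed

text \<open>The derivative is bounded on the compact convex set.\<close>

lemma Ck_on_lipschitz: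
  fixes f :: "'a::euclidean_space \<Rightarrow> 'b::real_normed_vector"
  assumes "open U" "Ck_on (Suc 0) U f" "compact K" "convex K" "K \<subseteq> U"
  obtains L where "0 \<le> L" "\<And>x y. x \<in> K \<Longrightarrow> y \<in> K \<Longrightarrow> norm (f x - f y) \<le> L * norm (x - y)"
proof -
  let ?D = "\<lambda>x. frechet_derivative f (at x)"
  have d: "(f has_derivative ?D x) (at x)" if "x \<in> U" for x
    by (rule Ck_on_has_derivative[OF assms(1,2) that])
  have "continuous_on K (\<lambda>x. \<Sum>b\<in>Basis. norm (?D x b))"
    using assms(2,5) by (intro continuous_intros) (auto intro: continuous_on_subset)
  then have "compact ((\<lambda>x. \<Sum>b\<in>Basis. norm (?D x b)) ` K)"
    using assms(3) by (rule compact_continuous_image)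
  then have "bounded ((\<lambda>x. \<Sum>b\<in>Basis. norm (?D x b)) ` K)" by (rule compact_imp_bounded)
  then obtain L where "\<forall>y\<in>(\<lambda>x. \<Sum>b\<in>Basis. norm (?D x b)) ` K. norm y \<le> L"
    unfolding bounded_iff by (rule exE)
  then have L: "\<bar>\<Sum>b\<in>Basis. norm (?D x b)\<bar> \<le> L" if "x \<in> K" for x
    using that by (simp only: ball_simps(9) real_norm_def)
  have on: "onorm (?D x) \<le> max L 0" if "x \<in> K" for x
  proof (rule onorm_bound)
    fix v :: 'a
    interpret bounded_linear "?D x" using d that assms(5) has_derivative_bounded_linear by blast
    have "norm (?D x v) = norm (\<Sum>b\<in>Basis. (v \<bullet> b) *\<^sub>R ?D x b)"
      by (subst (1) euclidean_representation[symmetric]) (simp add: sum scale)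
    also have "\<dots> \<le> (\<Sum>b\<in>Basis. norm v * norm (?D x b))"
      by (intro sum_norm_le) (auto intro!: mult_right_mono Basis_le_norm)
    also have "\<dots> = (\<Sum>b\<in>Basis. norm (?D x b)) * norm v" by (simp add: sum_distrib_left mult.commute)
    also have "\<dots> \<le> max L 0 * norm v" using L[OF that] by (intro mult_right_mono) auto
    finally show "norm (?D x v) \<le> max L 0 * norm v" .
  qed simp
  have "norm (f x - f y) \<le> max L 0 * norm (x - y)" if "x \<in> K" "y \<in> K" for x y
    by (rule differentiable_bound[OF assms(4) _ on that])
      (use d assms(5) has_derivative_at_withinI in blast)
  then show thesis using that[of "max L 0"] by auto
qed

section \<open>Charts, tangent vectors and Hamiltonian vector fields\<close>

lemma chart_facts:
  assumes "is_chart c"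
  shows chart_open_dom: "open (chart_dom c)"
    and chart_openin_img: "openin (top_of_set half_plane) (chart_img c)"
    and coord_in_img: "x \<in> chart_dom c \<Longrightarrow> coord c x \<in> chart_img c"
    and chart_inv_coord: "x \<in> chart_dom c \<Longrightarrow> chart_inv c (coord c x) = x"
    and chart_inv_in_dom: "z \<in> chart_img c \<Longrightarrow> chart_inv c z \<in> chart_dom c"
    and coord_chart_inv: "z \<in> chart_img c \<Longrightarrow> coord c (chart_inv c z) = z"
    and continuous_on_coord: "continuous_on (chart_dom c) (coord c)"
    and continuous_on_chart_inv: "continuous_on (chart_img c) (chart_inv c)"
  using assms unfolding is_chart_def homeomorphism_def chart_img_def by auto

lemma openin_chart_preimage:
  assumes "is_chart c" "open W"
  shows "openin (top_of_set half_plane) {z \<in> chart_img c. chart_inv c z \<in> W}"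
proof -
  have "openin (top_of_set (chart_img c)) (chart_img c \<inter> chart_inv c -` W)"
    using continuous_openin_preimage_gen continuous_on_chart_inv assms by blast
  moreover have "{z \<in> chart_img c. chart_inv c z \<in> W} = chart_img c \<inter> chart_inv c -` W" by auto
  ultimately show ?thesis using openin_trans chart_openin_img[OF assms(1)] by metis
qed

lemma overlap_eq:
  assumes "is_chart c"
  shows "overlap c d = {z \<in> chart_img c. chart_inv c z \<in> chart_dom d}"
proof -
  have "z \<in> overlap c d" if "z \<in> chart_img c" "chart_inv c z \<in> chart_dom d" for z
    unfolding overlap_def using that chart_inv_in_dom[OF assms that(1)] coord_chart_inv[OF assms that(1)]
    by (intro image_eqI[of _ _ "chart_inv c z"]) auto
  then show ?thesis
    using assms by (auto simp: overlap_def coord_in_img chart_inv_coord)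
qed

lemma thick_chart_preimage:
  assumes "is_chart c" "open W"
  shows "thick {z \<in> chart_img c. chart_inv c z \<in> W}"
  using thick_openin[OF thick_half_plane openin_chart_preimage] assms by blast

definition det2 :: "plane \<Rightarrow> plane \<Rightarrow> real" where
  "det2 p q = fst p * snd q - snd p * fst q"

locale smooth_surface =
  fixes A :: "'a::t2_space chart set"
  assumes atlas: "smooth_atlas A"
begin

lemma is_chart_atlas: "c \<in> A \<Longrightarrow> is_chart c"
  using atlas by (simp add: smooth_atlas_def)

lemmas chart_simps = coord_in_img[OF is_chart_atlas] chart_inv_coord[OF is_chart_atlas]
  chart_inv_in_dom[OF is_chart_atlas] coord_chart_inv[OF is_chart_atlas]

lemma ex_chart: obtains c where "c \<in> A" "x \<in> chart_dom c"
  using atlas unfolding smooth_atlas_def by blast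

lemma thick_chart_img: "c \<in> A \<Longrightarrow> thick (chart_img c)"
  using thick_openin[OF thick_half_plane chart_openin_img[OF is_chart_atlas]] .

lemma openin_overlap:
  assumes "c \<in> A" "d \<in> A"
  shows "openin (top_of_set half_plane) (overlap c d)"
  unfolding overlap_eq[OF is_chart_atlas[OF assms(1)]]
  using assms by (intro openin_chart_preimage is_chart_atlas chart_open_dom)

lemma thick_overlap: "c \<in> A \<Longrightarrow> d \<in> A \<Longrightarrow> thick (overlap c d)"
  using thick_openin[OF thick_half_plane openin_overlap] .

lemma transition_coord: "c \<in> A \<Longrightarrow> x \<in> chart_dom c \<Longrightarrow> transition c d (coord c x) = coord d x"
  by (simp add: transition_def chart_simps)

lemma coord_in_overlap: "x \<in> chart_dom c \<Longrightarrow> x \<in> chart_dom d \<Longrightarrow> coord c x \<in> overlap c d"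
  by (auto simp: overlap_def)

lemma smooth_transition: "c \<in> A \<Longrightarrow> d \<in> A \<Longrightarrow> smooth_on (overlap c d) (transition c d)"
  using atlas by (simp add: smooth_atlas_def)

lemma has_derivative_transition:
  assumes "c \<in> A" "d \<in> A" "x \<in> chart_dom c" "x \<in> chart_dom d"
  shows "(transition c d has_derivative transition_deriv c d x) (at (coord c x) within overlap c d)"
  unfolding transition_deriv_def
  using smooth_on_has_derivative[OF thick_overlap smooth_transition coord_in_overlap] assms by blast

lemma transition_deriv_linear:
  assumes "c \<in> A" "d \<in> A" "x \<in> chart_dom c" "x \<in> chart_dom d"
  shows "bounded_linear (transition_deriv c d x)"
  using has_derivative_transition[OF assms] by (rule has_derivative_bounded_linear)

lemma transition_deriv_same:
  assumes "c \<in> A" "x \<in> chart_dom c"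
  shows "transition_deriv c c x p = p"
proof -
  have "(transition c c has_derivative (\<lambda>p. p)) (at (coord c x) within overlap c c)"
    by (rule has_derivative_transform[OF _ _ has_derivative_ident])
      (use assms in \<open>auto simp: coord_in_overlap overlap_def transition_coord\<close>)
  then have "transition_deriv c c x = (\<lambda>p. p)"
    unfolding transition_deriv_def using assms
    by (intro frechet_derivative_eq thick_overlap coord_in_overlap)
  then show ?thesis by simp
qed

text \<open>Here \<open>F\<close> and \<open>G\<close> are two coordinate expressions of one map near \<open>x\<close>, in the charts \<open>c\<close> and \<open>d\<close>. As they
need to agree only near \<open>x\<close>, the lemma covers functions on the surface as well as transition maps to a
third chart, whose overlaps with \<open>c\<close> and \<open>d\<close> differ.\<close>

lemma chain_rule_transition:
  assumes "c \<in> A" "d \<in> A" "x \<in> chart_dom c" "x \<in> chart_dom d" "open W" "x \<in> W"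
    and S: "openin (top_of_set half_plane) S" "coord c x \<in> S" "(F has_derivative F') (at (coord c x) within S)"
    and T: "openin (top_of_set half_plane) T" "coord d x \<in> T" "(G has_derivative G') (at (coord d x) within T)"
    and eq: "\<And>y. y \<in> chart_dom c \<Longrightarrow> y \<in> chart_dom d \<Longrightarrow> y \<in> W \<Longrightarrow> F (coord c y) = G (coord d y)"
  shows "F' = (\<lambda>p. G' (transition_deriv c d x p))"
proof -
  obtain S' T' where ST: "open S'" "S = half_plane \<inter> S'" "open T'" "T = half_plane \<inter> T'"
    using S(1) T(1) by (auto simp: openin_open)
  have "open (chart_dom c \<inter> coord c -` S')" "open (chart_dom d \<inter> coord d -` T')"
    using assms(1,2) ST by (auto intro!: continuous_open_preimage continuous_on_coord chart_open_dom is_chart_atlas)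
  then have oW: "open (W \<inter> chart_dom d \<inter> (chart_dom c \<inter> coord c -` S') \<inter> (chart_dom d \<inter> coord d -` T'))"
    (is "open ?W") using assms by (auto intro!: chart_open_dom is_chart_atlas)
  have xW: "x \<in> ?W" using assms ST by auto
  \<comment> \<open>a common domain of \<open>F\<close> and \<open>G \<circ> transition c d\<close>, small enough for both expressions and for \<open>eq\<close>\<close>
  define R where "R = {z \<in> chart_img c. chart_inv c z \<in> ?W}"
  have th: "thick R" unfolding R_def using thick_chart_preimage[OF is_chart_atlas[OF assms(1)] oW] .
  have xR: "coord c x \<in> R" unfolding R_def using xW assms by (simp add: chart_simps)
  have Rhp: "R \<subseteq> half_plane"
    using chart_openin_img[OF is_chart_atlas[OF assms(1)]] openin_imp_subset unfolding R_def by blast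
  have RS: "R \<subseteq> S"
    unfolding ST using Rhp assms(1) by (auto simp: R_def chart_simps)
  have RO: "R \<subseteq> overlap c d"
    unfolding overlap_eq[OF is_chart_atlas[OF assms(1)]] R_def by auto
  have "transition c d z \<in> T" if "z \<in> R" for z
  proof -
    have y: "chart_inv c z \<in> chart_dom d" "coord d (chart_inv c z) \<in> T'" using that by (auto simp: R_def)
    then have "coord d (chart_inv c z) \<in> half_plane"
      using coord_in_img[OF is_chart_atlas[OF assms(2)]] chart_openin_img[OF is_chart_atlas[OF assms(2)]] openin_imp_subset by blast
    then show ?thesis using y ST by (simp add: transition_def)
  qed
  then have TT: "transition c d ` R \<subseteq> T" by auto
  have "((G \<circ> transition c d) has_derivative (G' \<circ> transition_deriv c d x)) (at (coord c x) within R)"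
  proof (rule diff_chain_within)
    show "(transition c d has_derivative transition_deriv c d x) (at (coord c x) within R)"
      using has_derivative_subset[OF has_derivative_transition RO] assms by blast
    show "(G has_derivative G') (at (transition c d (coord c x)) within transition c d ` R)"
      using has_derivative_subset[OF T(3) TT] assms by (simp add: transition_coord)
  qed
  then have "(F has_derivative (G' \<circ> transition_deriv c d x)) (at (coord c x) within R)"
  proof (rule has_derivative_transform[rotated 2])
    fix z assume z: "z \<in> R"
    then have "z = coord c (chart_inv c z)" "chart_inv c z \<in> chart_dom c" "chart_inv c z \<in> chart_dom d" "chart_inv c z \<in> W"
      using assms(1) by (auto simp: R_def chart_simps)
    then show "F z = (G \<circ> transition c d) z" using eq[of "chart_inv c z"] by (simp add: transition_def)
  qed (rule xR)
  moreover have "(F has_derivative F') (at (coord c x) within R)"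
    using has_derivative_subset[OF S(3) RS] .
  ultimately show ?thesis using thick_derivative_unique[OF th xR] by (metis comp_def)
qed

lemma transition_deriv_trans:
  assumes "b \<in> A" "c \<in> A" "d \<in> A" "x \<in> chart_dom b" "x \<in> chart_dom c" "x \<in> chart_dom d"
  shows "transition_deriv c d x (transition_deriv b c x p) = transition_deriv b d x p"
proof -
  have "transition_deriv b d x = (\<lambda>p. transition_deriv c d x (transition_deriv b c x p))"
  proof (rule chain_rule_transition[OF assms(1,2,4,5) open_UNIV UNIV_I])
    show "(transition b d has_derivative transition_deriv b d x) (at (coord b x) within overlap b d)"
      "(transition c d has_derivative transition_deriv c d x) (at (coord c x) within overlap c d)"
      using has_derivative_transition assms by blast+
  qed (use assms in \<open>auto simp: openin_overlap coord_in_overlap transition_coord\<close>)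
  then show ?thesis by simp
qed

lemma tangent_of_in_tangent_space:
  assumes "c \<in> A" "x \<in> chart_dom c"
  shows "tangent_of A c x p \<in> tangent_space A x"
  unfolding tangent_space_def tangent_of_def using assms by (auto simp: transition_deriv_trans)

lemma tangent_of_component [simp]:
  assumes "c \<in> A" "x \<in> chart_dom c"
  shows "tangent_of A c x p c = p"
  unfolding tangent_of_def using assms by (simp add: transition_deriv_same)

lemma tangent_of_inverse:
  assumes "c \<in> A" "x \<in> chart_dom c" "v \<in> tangent_space A x"
  shows "tangent_of A c x (v c) = v"
proof
  fix d
  have "v d = transition_deriv c d x (v c)" if "d \<in> A" "x \<in> chart_dom d"
    using assms that unfolding tangent_space_def by blast
  moreover have "v d = 0" if "\<not> (d \<in> A \<and> x \<in> chart_dom d)"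
    using assms that unfolding tangent_space_def by blast
  ultimately show "tangent_of A c x (v c) d = v d" unfolding tangent_of_def by presburger
qed

lemma tangent_of_linear:
  assumes "c \<in> A" "x \<in> chart_dom c"
  shows "tangent_of A c x (a *\<^sub>R p + b *\<^sub>R q) = (\<lambda>d. a *\<^sub>R tangent_of A c x p d + b *\<^sub>R tangent_of A c x q d)"
proof
  fix d
  show "tangent_of A c x (a *\<^sub>R p + b *\<^sub>R q) d = a *\<^sub>R tangent_of A c x p d + b *\<^sub>R tangent_of A c x q d"
  proof (cases "d \<in> A \<and> x \<in> chart_dom d")
    case True
    then interpret bounded_linear "transition_deriv c d x" using transition_deriv_linear assms by blast
    show ?thesis using True by (simp add: tangent_of_def add scale)
  qed (auto simp: tangent_of_def)
qed

text \<open>Linearity is postulated for \<open>a u + v\<close> only; the zero vector yields homogeneity.\<close>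

lemma smooth_tensor2_bilinear:
  assumes "smooth_tensor2 A B" "u \<in> tangent_space A x" "v \<in> tangent_space A x" "w \<in> tangent_space A x"
  shows "B x (\<lambda>c. a *\<^sub>R u c + b *\<^sub>R v c) w = a * B x u w + b * B x v w"
    and "B x w (\<lambda>c. a *\<^sub>R u c + b *\<^sub>R v c) = a * B x w u + b * B x w v"
proof -
  obtain c where c: "c \<in> A" "x \<in> chart_dom c" by (rule ex_chart)
  have lin: "B x (\<lambda>c. a *\<^sub>R u c + v c) w = a * B x u w + B x v w"
    "B x w (\<lambda>c. a *\<^sub>R u c + v c) = a * B x w u + B x w v"
    if "u \<in> tangent_space A x" "v \<in> tangent_space A x" "w \<in> tangent_space A x" for u v w a
    using assms(1) that unfolding smooth_tensor2_def by blast+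
  have z: "(\<lambda>c. 0) \<in> tangent_space A x"
    using tangent_of_linear[OF c, of 0 0 0 0] tangent_of_in_tangent_space[OF c, of "0"] by (simp add: zero_prod_def)
  have B0: "B x (\<lambda>c. 0) w = 0" "B x w (\<lambda>c. 0) = 0"
    using lin[OF z z assms(4), of 1] by auto
  have bv: "B x (\<lambda>c. b *\<^sub>R v c) w = b * B x v w" "B x w (\<lambda>c. b *\<^sub>R v c) = b * B x w v"
    using lin[OF assms(3) z assms(4), of b] B0 by auto
  have "(\<lambda>c. b *\<^sub>R v c) \<in> tangent_space A x"
  proof -
    have "(\<lambda>c. b *\<^sub>R v c) = (\<lambda>d. b *\<^sub>R tangent_of A c x (v c) d + 0 *\<^sub>R tangent_of A c x 0 d)"
      using tangent_of_inverse[OF c assms(3)] by simp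
    then show ?thesis
      using tangent_of_linear[OF c, of b "v c" 0 0] tangent_of_in_tangent_space[OF c, of "b *\<^sub>R v c + 0 *\<^sub>R 0"] by metis
  qed
  then show "B x (\<lambda>c. a *\<^sub>R u c + b *\<^sub>R v c) w = a * B x u w + b * B x v w"
    "B x w (\<lambda>c. a *\<^sub>R u c + b *\<^sub>R v c) = a * B x w u + b * B x w v"
    using lin[OF assms(2) _ assms(4), of "\<lambda>c. b *\<^sub>R v c"] bv by auto
qed

definition tensor_coeff :: "'a tensor2 \<Rightarrow> 'a chart \<Rightarrow> plane \<Rightarrow> plane \<Rightarrow> plane \<Rightarrow> real" where
  "tensor_coeff B c p q z = B (chart_inv c z) (tangent_of A c (chart_inv c z) p) (tangent_of A c (chart_inv c z) q)"

lemma smooth_tensor_coeff: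
  "smooth_tensor2 A B \<Longrightarrow> c \<in> A \<Longrightarrow> smooth_on (chart_img c) (tensor_coeff B c p q)"
  unfolding smooth_tensor2_def tensor_coeff_def by blast

lemma tensor_coeff_eq:
  assumes "c \<in> A" "x \<in> chart_dom c" "u \<in> tangent_space A x" "v \<in> tangent_space A x"
  shows "B x u v = tensor_coeff B c (u c) (v c) (coord c x)"
  using assms by (simp add: tensor_coeff_def chart_simps tangent_of_inverse)

lemma tensor_coeff_bilinear:
  assumes "smooth_tensor2 A B" "c \<in> A" "z \<in> chart_img c"
  shows "tensor_coeff B c p q z =
    fst p * (fst q * tensor_coeff B c (1,0) (1,0) z + snd q * tensor_coeff B c (1,0) (0,1) z) +
    snd p * (fst q * tensor_coeff B c (0,1) (1,0) z + snd q * tensor_coeff B c (0,1) (0,1) z)"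
proof -
  define x where "x = chart_inv c z"
  have x: "c \<in> A" "x \<in> chart_dom c" using assms by (auto simp: x_def chart_simps)
  have dec: "tangent_of A c x p = (\<lambda>d. fst p *\<^sub>R tangent_of A c x (1,0) d + snd p *\<^sub>R tangent_of A c x (0,1) d)" for p :: plane
    using tangent_of_linear[OF x, of "fst p" "(1,0)" "snd p" "(0,1)"] by simp
  note T = tangent_of_in_tangent_space[OF x]
  have "B x (tangent_of A c x p) w = fst p * B x (tangent_of A c x (1,0)) w + snd p * B x (tangent_of A c x (0,1)) w"
    if "w \<in> tangent_space A x" for p w
    by (subst dec) (rule smooth_tensor2_bilinear(1)[OF assms(1) T T that])
  moreover have "B x w (tangent_of A c x q) = fst q * B x w (tangent_of A c x (1,0)) + snd q * B x w (tangent_of A c x (0,1))"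
    if "w \<in> tangent_space A x" for q w
    by (subst dec) (rule smooth_tensor2_bilinear(2)[OF assms(1) T T that])
  ultimately show ?thesis unfolding tensor_coeff_def x_def[symmetric] using T by metis
qed

definition density :: "'a tensor2 \<Rightarrow> 'a chart \<Rightarrow> plane \<Rightarrow> real" where
  "density \<omega> c = tensor_coeff \<omega> c (1,0) (0,1)"

text \<open>Up to a factor, the determinant is the only alternating bilinear form on the plane.\<close>

lemma area_form_coord:
  assumes "area_form A \<omega>" "c \<in> A" "x \<in> chart_dom c" "u \<in> tangent_space A x" "v \<in> tangent_space A x"
  shows "\<omega> x u v = density \<omega> c (coord c x) * det2 (u c) (v c)"
proof -
  have t: "smooth_tensor2 A \<omega>" and alt: "\<And>u. u \<in> tangent_space A x \<Longrightarrow> \<omega> x u u = 0"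
    using assms(1) by (auto simp: area_form_def)
  have z: "coord c x \<in> chart_img c" using assms by (simp add: chart_simps)
  have T: "tensor_coeff \<omega> c p p (coord c x) = 0" for p
    using alt[OF tangent_of_in_tangent_space[OF assms(2,3)]] assms by (simp add: tensor_coeff_def chart_simps)
  have "tensor_coeff \<omega> c (0,1) (1,0) (coord c x) = - tensor_coeff \<omega> c (1,0) (0,1) (coord c x)"
    using tensor_coeff_bilinear[OF t assms(2) z, of "(1,1)" "(1,1)"] T[of "(1,1)"] T[of "(1,0)"] T[of "(0,1)"] by simp
  then show ?thesis
    unfolding tensor_coeff_eq[OF assms(2-5)] tensor_coeff_bilinear[OF t assms(2) z, of "u c" "v c"] density_def det2_def
    by (simp add: T algebra_simps)
qed

lemma density_nonzero:
  assumes "area_form A \<omega>" "c \<in> A" "z \<in> chart_img c"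
  shows "density \<omega> c z \<noteq> 0"
proof
  assume d0: "density \<omega> c z = 0"
  define x where "x = chart_inv c z"
  have x: "c \<in> A" "x \<in> chart_dom c" "coord c x = z" using assms by (auto simp: x_def chart_simps)
  have "tangent_of A c x (1,0) \<noteq> (\<lambda>c. 0)"
    using tangent_of_component[OF x(1,2), of "(1,0)"] by (auto simp: zero_prod_def)
  then obtain v where "v \<in> tangent_space A x" "\<omega> x (tangent_of A c x (1,0)) v \<noteq> 0"
    using assms(1) tangent_of_in_tangent_space[OF x(1,2)] unfolding area_form_def by blast
  then show False using area_form_coord[OF assms(1) x(1,2) tangent_of_in_tangent_space[OF x(1,2)]] x d0 by simp
qed

lemma smooth_density:
  assumes "area_form A \<omega>" "c \<in> A"
  shows "smooth_on (chart_img c) (density \<omega> c)"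
  using assms smooth_tensor_coeff unfolding density_def area_form_def by blast

definition smooth_function :: "('a \<Rightarrow> real) \<Rightarrow> bool" where
  "smooth_function f \<longleftrightarrow> (\<forall>c\<in>A. smooth_on (chart_img c) (\<lambda>z. f (chart_inv c z)))"

lemma smooth_function_has_derivative:
  assumes "smooth_function f" "c \<in> A" "x \<in> chart_dom c"
  shows "((f \<circ> chart_inv c) has_derivative
    frechet_derivative (f \<circ> chart_inv c) (at (coord c x) within chart_img c)) (at (coord c x) within chart_img c)"
  using smooth_on_has_derivative[OF thick_chart_img, of c "f \<circ> chart_inv c"] assms
  by (simp add: smooth_function_def chart_simps comp_def)

lemma differential_chart_independent:
  assumes "smooth_function f" "c \<in> A" "x \<in> chart_dom c" "d \<in> A" "x \<in> chart_dom d" "v \<in> tangent_space A x"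
  shows "differential c f x v = differential d f x v"
proof -
  have "frechet_derivative (f \<circ> chart_inv c) (at (coord c x) within chart_img c) =
     (\<lambda>p. frechet_derivative (f \<circ> chart_inv d) (at (coord d x) within chart_img d) (transition_deriv c d x p))"
    by (rule chain_rule_transition[OF assms(2,4,3,5) open_UNIV UNIV_I
          chart_openin_img[OF is_chart_atlas[OF assms(2)]] _ smooth_function_has_derivative[OF assms(1-3)]
          chart_openin_img[OF is_chart_atlas[OF assms(4)]] _ smooth_function_has_derivative[OF assms(1,4,5)]])
      (use assms in \<open>simp_all add: chart_simps\<close>)
  moreover have "v d = transition_deriv c d x (v c)"
    using assms unfolding tangent_space_def by blast
  ultimately show ?thesis unfolding differential_def by metis
qed

text \<open>In each chart the equation for the vector field is solved by the rotated gradient divided by the density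
of \<open>\<omega>\<close>, which is smooth up to the boundary. The solutions in two charts represent the same tangent
vector: transported to the second chart, the first one solves the same equation there, and by
nondegeneracy this equation has only one solution.\<close>

lemma hamiltonian_vector_field_exists:
  assumes om: "area_form A \<omega>" and f: "smooth_function f"
  shows "\<exists>X. hamiltonian_vector_field A \<omega> f X"
proof -
  define D where "D c z = frechet_derivative (f \<circ> chart_inv c) (at z within chart_img c)" for c z
  define Y where "Y c z = inverse (density \<omega> c z) *\<^sub>R (D c z (0,1), - D c z (1,0))" for c z
  define X where "X x c = (if c \<in> A \<and> x \<in> chart_dom c then Y c (coord c x) else 0)" for x c
  have linD: "D c z p = fst p * D c z (1,0) + snd p * D c z (0,1)" if "c \<in> A" "z \<in> chart_img c" for c z p
  proof -
    have "bounded_linear (D c z)" unfolding D_def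
      using smooth_function_has_derivative[OF f that(1), of "chart_inv c z"] that
      by (simp add: chart_simps has_derivative_bounded_linear)
    then interpret bounded_linear "D c z" .
    have "D c z p = D c z (fst p *\<^sub>R (1,0) + snd p *\<^sub>R (0,1))" by simp
    then show ?thesis unfolding add scale by simp
  qed
  have Y: "density \<omega> c z * det2 q p = D c z p \<longleftrightarrow> q = Y c z" if "\<And>p. density \<omega> c z * det2 q p = D c z p" 
     "c \<in> A" "z \<in> chart_img c" for c z p q
    using that(1)[of "(1,0)"] that(1)[of "(0,1)"] density_nonzero[OF om that(2,3)] that(1)
    by (simp add: Y_def det2_def prod_eq_iff field_simps)
  have Yh: "density \<omega> c z * det2 (Y c z) p = D c z p" if "c \<in> A" "z \<in> chart_img c" for c z p
    using density_nonzero[OF om that] unfolding linD[OF that, of p]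
    by (simp add: Y_def det2_def field_simps)
  have XT: "X x = tangent_of A c x (Y c (coord c x))" if c: "c \<in> A" "x \<in> chart_dom c" for c x
  proof
    fix d
    let ?u = "tangent_of A c x (Y c (coord c x))"
    note u = tangent_of_in_tangent_space[OF c, of "Y c (coord c x)"]
    show "X x d = ?u d"
    proof (cases "d \<in> A \<and> x \<in> chart_dom d")
      case True
      then have d: "d \<in> A" "x \<in> chart_dom d" by auto
      have "density \<omega> d (coord d x) * det2 (?u d) p = D d (coord d x) p" for p
      proof -
        define v where "v = tangent_of A d x p"
        have v: "v \<in> tangent_space A x" "v d = p" using tangent_of_in_tangent_space[OF d] d by (auto simp: v_def)
        have "density \<omega> d (coord d x) * det2 (?u d) p = \<omega> x ?u v"
          using area_form_coord[OF om d u v(1)] v by simp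
        also have "\<dots> = D c (coord c x) (v c)"
          using area_form_coord[OF om c u v(1)] Yh c by (simp add: chart_simps)
        also have "\<dots> = D d (coord d x) p"
          using differential_chart_independent[OF f c d v(1)] v unfolding differential_def D_def by simp
        finally show ?thesis .
      qed
      then have "?u d = Y d (coord d x)" using Y[of d "coord d x" "?u d"] d by (simp add: chart_simps)
      then show ?thesis using True by (simp add: X_def)
    qed (auto simp: X_def tangent_of_def)
  qed
  have "smooth_vector_field A X" unfolding smooth_vector_field_def
  proof (intro conjI allI ballI)
    fix x
    obtain c where c: "c \<in> A" "x \<in> chart_dom c" by (rule ex_chart)
    then show "X x \<in> tangent_space A x" using XT tangent_of_in_tangent_space by simp
  next
    fix c assume c: "c \<in> A"
    have sm: "smooth_on (chart_img c) (\<lambda>z. D c z p)" for p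
      unfolding D_def using f c smooth_on_derivative[OF thick_chart_img[OF c], of "f \<circ> chart_inv c" p]
      by (simp add: smooth_function_def comp_def)
    have "smooth_on (chart_img c) (Y c)"
      unfolding Y_def using smooth_density[OF om c] density_nonzero[OF om c]
      by (intro smooth_on_scaleR smooth_on_inverse smooth_on_Pair sm
            smooth_on_compose[OF sm smooth_on_linear[OF bounded_linear_minus[OF bounded_linear_ident]]]) auto
    then show "smooth_on (chart_img c) (\<lambda>z. X (chart_inv c z) c)"
      by (rule smooth_on_cong_imp[rotated]) (use c in \<open>simp add: X_def chart_simps\<close>)
  qed
  moreover have "differential c f x v = \<omega> x (X x) v" if "c \<in> A" "x \<in> chart_dom c" "v \<in> tangent_space A x" for c x v
    unfolding XT[OF that(1,2)] area_form_coord[OF om that(1,2) tangent_of_in_tangent_space[OF that(1,2)] that(3)]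
    using Yh that by (simp add: chart_simps differential_def D_def)
  ultimately show ?thesis unfolding hamiltonian_vector_field_def by blast
qed

lemma hamiltonian_vector_field_component:
  assumes "area_form A \<omega>" "hamiltonian_vector_field A \<omega> f X" "c \<in> A" "x \<in> chart_dom c"
  shows "density \<omega> c (coord c x) * det2 (X x c) p =
    frechet_derivative (f \<circ> chart_inv c) (at (coord c x) within chart_img c) p"
proof -
  note T = tangent_of_in_tangent_space[OF assms(3,4), of p]
  have "X x \<in> tangent_space A x" using assms(2) by (simp add: hamiltonian_vector_field_def smooth_vector_field_def)
  then show ?thesis
    using assms area_form_coord[OF assms(1,3,4) _ T, of "X x"] T
    unfolding hamiltonian_vector_field_def differential_def by (metis tangent_of_component)
qed

end

section \<open>Smooth cut-off functions\<close>

text \<open>\<open>flat 0\<close> is the classical smooth function that vanishes on the negative half-line. The powers of \<open>1/x\<close>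
are those that appear in its derivatives, so that the family is closed under differentiation.\<close>

definition flat :: "nat \<Rightarrow> real \<Rightarrow> real" where
  "flat n x = (if x \<le> 0 then 0 else (1/x) ^ n * exp (- 1/x))"

text \<open>With \<open>y = 1/x\<close> this is \<open>exp y \<ge> y\<^sup>n\<^sup>+\<^sup>2 / (n + 2)!\<close>. A quadratic bound is what makes the
derivative at the origin vanish.\<close>

lemma flat_bound: "\<bar>flat n x\<bar> \<le> fact (n + 2) * x\<^sup>2"
proof (cases "x \<le> 0")
  case False
  define y where "y = 1/x"
  have y: "y > 0" using False by (simp add: y_def)
  have "y ^ (n + 2) / fact (n + 2) \<le> exp y"
  proof -
    have s: "(\<lambda>k. y ^ k /\<^sub>R fact k) sums exp y" by (rule exp_converges)
    have "(\<Sum>k\<in>{n+2}. y ^ k /\<^sub>R fact k) \<le> (\<Sum>k. y ^ k /\<^sub>R fact k)"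
      using y by (intro sum_le_suminf sums_summable[OF s]) auto
    then show ?thesis using sums_unique[OF s] by (simp add: divide_inverse mult.commute)
  qed
  then have "y ^ n * y\<^sup>2 / fact (n + 2) \<le> exp y"
    by (simp only: power_add)
  then have "y ^ n * y\<^sup>2 \<le> exp y * fact (n + 2)"
    by (simp only: pos_divide_le_eq[OF fact_gt_zero])
  then have "y ^ n * exp (- y) \<le> fact (n + 2) / y\<^sup>2"
  proof -
    have "y ^ n * exp (- y) \<le> F / y\<^sup>2" if "y ^ n * y\<^sup>2 \<le> exp y * F" for F
      using y that by (simp add: exp_minus field_simps)
    then show "y ^ n * y\<^sup>2 \<le> exp y * fact (n + 2) \<Longrightarrow> ?thesis" by blast
  qed
  moreover have "flat n x = y ^ n * exp (- y)" using False by (simp add: flat_def y_def)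
  moreover have "0 \<le> y ^ n * exp (- y)" using y by simp
  moreover have "fact (n + 2) / y\<^sup>2 = fact (n + 2) * x\<^sup>2" by (simp add: y_def power_one_over)
  ultimately show ?thesis by linarith
qed (simp add: flat_def)

lemma flat_derivative: "(flat n has_real_derivative (flat (n+2) x - real n * flat (n+1) x)) (at x)"
proof -
  consider "x < 0" | "x = 0" | "x > 0" by linarith
  then show ?thesis
  proof cases
    case 1
    have "(flat n has_real_derivative 0) (at x)"
      by (rule has_field_derivative_transform_within_open[OF DERIV_const[of 0], of "{..<0}"])
        (use 1 in \<open>auto simp: flat_def\<close>)
    then show ?thesis using 1 by (simp add: flat_def)
  next
    case 2
    have "(\<lambda>h. flat n h / h) \<midarrow>0\<rightarrow> 0"
    proof (rule Lim_null_comparison)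
      show "\<forall>\<^sub>F h in at 0. norm (flat n h / h) \<le> fact (n + 2) * \<bar>h\<bar>"
      proof (rule eventuallyI)
        fix h :: real
        have "\<bar>flat n h\<bar> / \<bar>h\<bar> \<le> fact (n + 2) * h\<^sup>2 / \<bar>h\<bar>" by (intro divide_right_mono flat_bound) simp
        also have "\<dots> = fact (n + 2) * \<bar>h\<bar>"
          by (cases "h = 0") (auto simp: power2_eq_square abs_if simp del: fact_Suc)
        finally show "norm (flat n h / h) \<le> fact (n + 2) * \<bar>h\<bar>" by simp
      qed
      show "((\<lambda>h::real. fact (n + 2) * \<bar>h\<bar>) \<longlongrightarrow> 0) (at 0)"
        using tendsto_mult[OF tendsto_const tendsto_rabs[OF tendsto_ident_at[of 0 UNIV]], of "fact (n + 2)"] by (simp del: fact_Suc)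
    qed
    then show ?thesis using 2 by (simp add: DERIV_def flat_def)
  next
    case 3
    have "((\<lambda>x. (1/x) ^ n * exp (- 1/x)) has_real_derivative (flat (n+2) x - real n * flat (n+1) x)) (at x)"
    proof -
      have "((\<lambda>x. 1/x) has_real_derivative - (1/x)\<^sup>2) (at x)"
        using 3 by (auto intro!: derivative_eq_intros simp: power2_eq_square)
      from DERIV_power[OF this, of n]
      have d1: "((\<lambda>x. (1/x) ^ n) has_real_derivative real n * (1/x) ^ (n - 1) * (- (1/x)\<^sup>2)) (at x)"
        by (simp add: mult_ac)
      have d2: "((\<lambda>x. exp (- 1/x)) has_real_derivative exp (- 1/x) * (1/x)\<^sup>2) (at x)"
        using 3 by (auto intro!: derivative_eq_intros simp: power2_eq_square)
      have "((\<lambda>x. (1/x) ^ n * exp (- 1/x)) has_real_derivative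
        (real n * (1/x) ^ (n - 1) * (- (1/x)\<^sup>2) * exp (- 1/x) + exp (- 1/x) * (1/x)\<^sup>2 * (1/x) ^ n)) (at x)"
        by (rule DERIV_mult[OF d1 d2])
      moreover have p: "real n * (1/x) ^ (n - 1) * (- (1/x)\<^sup>2) = - (real n * (1/x) ^ (n + 1))"
        by (cases n) (auto simp: power2_eq_square)
      have "real n * (1/x) ^ (n - 1) * (- (1/x)\<^sup>2) * exp (- 1/x) + exp (- 1/x) * (1/x)\<^sup>2 * (1/x) ^ n
          = flat (n+2) x - real n * flat (n+1) x"
        unfolding p using 3 by (simp add: flat_def power_add algebra_simps power2_eq_square)
      ultimately show ?thesis by (simp only:)
    qed
    then show ?thesis
      by (rule has_field_derivative_transform_within_open[of _ _ _ "{0<..}"]) (use 3 in \<open>auto simp: flat_def\<close>)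
  qed
qed

lemma Ck_on_flat: "Ck_on k UNIV (flat n)"
proof (induction k arbitrary: n)
  case 0
  then show ?case using flat_derivative DERIV_isCont continuous_at_imp_continuous_on by (simp, blast)
next
  case (Suc k)
  have "Ck_on k UNIV (\<lambda>x. (flat (n+2) x - real n * flat (n+1) x) * v)" for v
    by (intro Ck_on_mult Ck_on_diff Suc) auto
  then show ?case unfolding Ck_on_Suc_iff[OF open_UNIV]
    using flat_derivative[unfolded has_field_derivative_def]
    by (intro exI[of _ "\<lambda>x v. (flat (n+2) x - real n * flat (n+1) x) * v"]) simp
qed

text \<open>These are the profiles of radial Hamiltonians. The function \<open>u (|z|\<^sup>2)\<close> generates rotations with
speed proportional to \<open>u'\<close>, so the constant slope up to \<open>a\<close> means a rigid rotation of the inner disc, and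
the vanishing from \<open>b\<close> on means compact support. A linear function times a smooth step has both properties.\<close>

lemma linear_cutoff:
  fixes a b c :: real
  assumes "a < b"
  obtains u u' :: "real \<Rightarrow> real" where
    "\<And>k. Ck_on k UNIV u" "\<And>s. (u has_real_derivative u' s) (at s)"
    "\<And>s. s \<le> a \<Longrightarrow> u' s = c" "\<And>s. s \<ge> b \<Longrightarrow> u s = 0" "\<And>s. s \<ge> b \<Longrightarrow> u' s = 0"
    "\<And>B. \<exists>L\<ge>0. \<forall>s\<in>{0..B}. \<forall>t\<in>{0..B}. \<bar>u' s - u' t\<bar> \<le> L * \<bar>s - t\<bar>"
proof -
  \<comment> \<open>The step takes place in the middle third of the interval from \<open>a\<close> to \<open>b\<close>. Thus \<open>u\<close> is linear near \<open>a\<close>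
    and zero near \<open>b\<close>, and the derivatives at \<open>a\<close> and \<open>b\<close> themselves are as required.\<close>
  define \<tau> where "\<tau> s = 3 * (s - a) / (b - a) - 1" for s :: real
  define \<sigma> where "\<sigma> s = flat 0 (1 - \<tau> s) * inverse (flat 0 (\<tau> s) + flat 0 (1 - \<tau> s))" for s
  define u where "u s = c * s * \<sigma> s" for s
  define u' where "u' = deriv u"
  have pos: "flat 0 (\<tau> s) + flat 0 (1 - \<tau> s) \<noteq> 0" for s
  proof -
    have "flat 0 x \<ge> 0" "x > 0 \<Longrightarrow> flat 0 x > 0" for x by (auto simp: flat_def)
    moreover have "\<tau> s > 0 \<or> 1 - \<tau> s > 0" by linarith
    ultimately show ?thesis by (metis add_nonneg_pos add_pos_nonneg less_irrefl)
  qed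
  have ck\<tau>: "Ck_on k UNIV \<tau>" for k
  proof -
    have "\<tau> = (\<lambda>s. 3 / (b - a) * s + (- 3 * a / (b - a) - 1))"
      by (auto simp: \<tau>_def fun_eq_iff right_diff_distrib diff_divide_distrib)
    moreover have "Ck_on k UNIV (\<lambda>s. 3 / (b - a) * s + (- 3 * a / (b - a) - 1))"
      by (intro Ck_on_add Ck_on_mult Ck_on_ident) auto
    ultimately show ?thesis by simp
  qed
  have ckf: "Ck_on k UNIV (\<lambda>s. flat 0 (\<tau> s))" "Ck_on k UNIV (\<lambda>s. flat 0 (1 - \<tau> s))" for k
    using Ck_on_compose[OF open_UNIV open_UNIV _ ck\<tau> Ck_on_flat]
      Ck_on_compose[OF open_UNIV open_UNIV _ Ck_on_diff[OF open_UNIV Ck_on_const ck\<tau>] Ck_on_flat] by auto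
  have cku: "Ck_on k UNIV u" for k
    unfolding u_def \<sigma>_def by (intro Ck_on_mult Ck_on_inverse Ck_on_add ckf Ck_on_ident pos Ck_on_const open_UNIV)
  have du: "(u has_real_derivative u' s) (at s)" for s
  proof -
    have "u differentiable (at s)" using cku[of 1] by (simp add: differentiable_on_def)
    then show ?thesis unfolding u'_def by (simp add: DERIV_deriv_iff_real_differentiable)
  qed
  have s1: "\<sigma> s = 1" if "s \<le> a + (b - a) / 3" for s
  proof -
    have "\<tau> s \<le> 0" using that assms by (simp add: \<tau>_def field_simps)
    then show ?thesis using pos[of s] by (simp add: \<sigma>_def flat_def)
  qed
  have s0: "\<sigma> s = 0" if "s \<ge> b - (b - a) / 3" for s
  proof -
    have "1 - \<tau> s \<le> 0" using that assms by (simp add: \<tau>_def field_simps)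
    then show ?thesis by (simp add: \<sigma>_def flat_def)
  qed
  have u1: "u' s = c" if "s \<le> a" for s
  proof -
    have d: "((\<lambda>s. c * s) has_real_derivative c) (at s)" by (auto intro!: derivative_eq_intros)
    have "s < a + (b - a) / 3" using that assms by (simp add: field_simps)
    then have "(u has_real_derivative c) (at s)"
      by (intro has_field_derivative_transform_within_open[OF d, of "{..<a + (b-a)/3}"])
        (use s1 in \<open>auto simp: u_def\<close>)
    then show ?thesis using du DERIV_unique by blast
  qed
  have u0: "u' s = 0" if "s \<ge> b" for s
  proof -
    have "b - (b - a) / 3 < s" using that assms by (simp add: field_simps)
    then have "(u has_real_derivative 0) (at s)"
      by (intro has_field_derivative_transform_within_open[OF DERIV_const[of 0], of "{b - (b-a)/3<..}"])
        (use s0 in \<open>auto simp: u_def\<close>)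
    then show ?thesis using du DERIV_unique by blast
  qed
  have ck1: "Ck_on (Suc 0) UNIV u'"
  proof -
    have "frechet_derivative u (at s) 1 = u' s" for s
      using frechet_derivative_at[OF du[unfolded has_field_derivative_def], of s] by (metis mult.right_neutral)
    then have "u' = (\<lambda>s. frechet_derivative u (at s) 1)" by auto
    then show ?thesis using cku[of "Suc (Suc 0)"] by simp
  qed
  have lip: "\<exists>L\<ge>0. \<forall>s\<in>{0..B}. \<forall>t\<in>{0..B}. \<bar>u' s - u' t\<bar> \<le> L * \<bar>s - t\<bar>" for B
  proof -
    obtain L where "0 \<le> L" "\<And>x y. x \<in> {0..B} \<Longrightarrow> y \<in> {0..B} \<Longrightarrow> norm (u' x - u' y) \<le> L * norm (x - y)"
      by (rule Ck_on_lipschitz[OF open_UNIV ck1, of "{0..B}"]) auto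
    then show ?thesis by (intro exI[of _ L]) auto
  qed
  have ub: "u s = 0" if "s \<ge> b" for s 
  proof -
    have "b - (b - a) / 3 \<le> s" using that assms by (simp add: field_simps)
    then show ?thesis using s0 by (simp add: u_def)
  qed
  show thesis by (rule that[of u u', OF cku du u1 ub u0 lip])
qed

section \<open>The model map on the plane\<close>

text \<open>Every circle about \<open>p\<close> rotates with its own constant speed, which \<open>\<rho>\<close> gives as a function of the squared
radius; this is the time-\<open>a\<close> map.\<close>

definition twist :: "complex \<Rightarrow> (real \<Rightarrow> real) \<Rightarrow> real \<Rightarrow> complex \<Rightarrow> complex" where
  "twist p \<rho> a z = p + cis (a * \<rho> ((norm (z - p))\<^sup>2)) * (z - p)"

lemma norm_twist [simp]: "norm (twist p \<rho> a z - p) = norm (z - p)"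
  by (simp add: twist_def norm_mult)

lemma twist_add: "twist p \<rho> a (twist p \<rho> b z) = twist p \<rho> (a + b) z"
  unfolding twist_def[of p \<rho> a] norm_twist unfolding twist_def
  by (simp add: cis_mult[symmetric] distrib_right)

lemma twist_fix: "\<rho> ((norm (z - p))\<^sup>2) = 0 \<Longrightarrow> twist p \<rho> a z = z"
  by (simp add: twist_def)

lemma twist_uminus: "twist (- p) \<rho> a (- z) = - twist p \<rho> a z"
proof -
  have "norm (- z - - p) = norm (z - p)" using norm_minus_commute[of z p] by (simp add: algebra_simps)
  then show ?thesis unfolding twist_def by (simp add: algebra_simps)
qed

lemma norm_cis_diff_le: "norm (cis a - cis b) \<le> \<bar>a - b\<bar>"
proof -
  have "norm (cis a - cis b) \<le> 1 * norm (a - b)"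
    by (rule differentiable_bound[of UNIV cis "\<lambda>x h. h *\<^sub>R (\<i> * cis x)"])
      (auto intro!: onorm_bound has_derivative_cis[OF has_derivative_ident] simp: norm_mult)
  then show ?thesis by simp
qed

text \<open>Two points drift apart by the shear between neighbouring circles, whose total amount is proportional to
\<open>a\<close>. The linear growth in \<open>a\<close> is the source of zero entropy.\<close>

lemma twist_lipschitz:
  assumes L: "\<And>s t. s \<in> {0..R\<^sup>2} \<Longrightarrow> t \<in> {0..R\<^sup>2} \<Longrightarrow> \<bar>\<rho> s - \<rho> t\<bar> \<le> L * \<bar>s - t\<bar>" "0 \<le> L"
    and "norm (z - p) \<le> R" "norm (w - p) \<le> R"
  shows "norm (twist p \<rho> a z - twist p \<rho> a w) \<le> (1 + 2 * R\<^sup>2 * L * \<bar>a\<bar>) * norm (z - w)"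
proof -
  define \<alpha> \<beta> where "\<alpha> = a * \<rho> ((norm (z - p))\<^sup>2)" and "\<beta> = a * \<rho> ((norm (w - p))\<^sup>2)"
  have R: "0 \<le> R" using assms(3) norm_ge_zero order_trans by blast
  have "twist p \<rho> a z - twist p \<rho> a w = cis \<alpha> * (z - w) + (cis \<alpha> - cis \<beta>) * (w - p)"
    by (simp add: twist_def \<alpha>_def \<beta>_def algebra_simps)
  then have "norm (twist p \<rho> a z - twist p \<rho> a w) \<le> norm (z - w) + norm (cis \<alpha> - cis \<beta>) * norm (w - p)"
    using norm_triangle_ineq[of "cis \<alpha> * (z - w)" "(cis \<alpha> - cis \<beta>) * (w - p)"] by (simp add: norm_mult)
  also have "\<dots> \<le> norm (z - w) + \<bar>\<alpha> - \<beta>\<bar> * R"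
    using norm_cis_diff_le assms(4) R by (intro add_left_mono mult_mono) auto
  also have "\<bar>\<alpha> - \<beta>\<bar> \<le> \<bar>a\<bar> * (L * (2 * R * norm (z - w)))"
  proof -
    have "\<bar>(norm (z - p))\<^sup>2 - (norm (w - p))\<^sup>2\<bar> = (norm (z - p) + norm (w - p)) * \<bar>norm (z - p) - norm (w - p)\<bar>"
      by (simp add: power2_eq_square square_diff_square_factored abs_mult)
    also have "\<dots> \<le> (2 * R) * norm (z - w)"
    proof (rule mult_mono)
      show "\<bar>norm (z - p) - norm (w - p)\<bar> \<le> norm (z - w)"
        using norm_triangle_ineq3[of "z - p" "w - p"] by simp
    qed (use assms R in auto)
    finally have 1: "\<bar>(norm (z - p))\<^sup>2 - (norm (w - p))\<^sup>2\<bar> \<le> 2 * R * norm (z - w)" .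
    have "\<bar>\<rho> ((norm (z - p))\<^sup>2) - \<rho> ((norm (w - p))\<^sup>2)\<bar> \<le> L * \<bar>(norm (z - p))\<^sup>2 - (norm (w - p))\<^sup>2\<bar>"
      using assms by (intro L) (auto intro: power_mono)
    also have "\<dots> \<le> L * (2 * R * norm (z - w))" using 1 L(2) by (rule mult_left_mono)
    finally show ?thesis
      unfolding \<alpha>_def \<beta>_def right_diff_distrib[symmetric] abs_mult by (rule mult_left_mono) simp
  qed
  then have "norm (z - w) + \<bar>\<alpha> - \<beta>\<bar> * R \<le> norm (z - w) + \<bar>a\<bar> * (L * (2 * R * norm (z - w))) * R"
    using R by (intro add_left_mono mult_right_mono)
  also have "\<dots> = (1 + 2 * R\<^sup>2 * L * \<bar>a\<bar>) * norm (z - w)" by (simp add: algebra_simps power2_eq_square)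
  finally show ?thesis .
qed

lemma discs_disjoint:
  fixes z :: complex
  assumes "norm (z - 2) < 1"
  shows "norm (z - (- 2)) \<ge> 1"
proof -
  have "4 = norm ((z + 2) - (z - 2))" by simp
  also have "\<dots> \<le> norm (z + 2) + norm (z - 2)" by (rule norm_triangle_ineq4)
  finally show ?thesis using assms by simp
qed

lemma has_vector_derivative_cis_linear:
  "((\<lambda>t. cis (c * t)) has_vector_derivative c *\<^sub>R (\<i> * cis (c * t))) (at t within S)"
  unfolding has_vector_derivative_def
  by (rule has_derivative_eq_rhs, rule has_derivative_cis) (auto intro!: derivative_eq_intros)

text \<open>Profiles for the motions in the disc of radius \<open>4\<close>. All arguments are squared radii. The rotation about
the origin has angle \<open>pi\<close> up to radius \<open>3\<close>, a disc which contains the discs of radius \<open>1\<close> around \<open>2\<close> and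
\<open>-2\<close>, and stops at radius \<open>4\<close>. The rotations about \<open>2\<close> and \<open>-2\<close> have angle \<open>pi/2\<close> up to radius \<open>1/2\<close>
and stop at radius \<open>1\<close>. The bound \<open>36\<close> is the square of \<open>6\<close>, the largest distance from \<open>0\<close>, \<open>2\<close> or
\<open>-2\<close> to a point of the disc of radius \<open>4\<close>.\<close>

locale swap_model =
  fixes u \<theta> w \<eta> :: "real \<Rightarrow> real" and L :: real
  assumes smooth_u: "\<And>k. Ck_on k UNIV u" and deriv_u: "\<And>s. (u has_real_derivative \<theta> s) (at s)"
    and \<theta>_inner: "\<And>s. s \<le> 9 \<Longrightarrow> \<theta> s = pi" and u_outer: "\<And>s. s \<ge> 16 \<Longrightarrow> u s = 0" and \<theta>_outer: "\<And>s. s \<ge> 16 \<Longrightarrow> \<theta> s = 0"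
    and smooth_w: "\<And>k. Ck_on k UNIV w" and deriv_w: "\<And>s. (w has_real_derivative \<eta> s) (at s)"
    and \<eta>_inner: "\<And>s. s \<le> 1/4 \<Longrightarrow> \<eta> s = pi/2" and w_outer: "\<And>s. s \<ge> 1 \<Longrightarrow> w s = 0" and \<eta>_outer: "\<And>s. s \<ge> 1 \<Longrightarrow> \<eta> s = 0"
    and L: "0 \<le> L" "\<And>s t. s \<in> {0..36} \<Longrightarrow> t \<in> {0..36} \<Longrightarrow> \<bar>\<theta> s - \<theta> t\<bar> \<le> L * \<bar>s - t\<bar>"
      "\<And>s t. s \<in> {0..36} \<Longrightarrow> t \<in> {0..36} \<Longrightarrow> \<bar>\<eta> s - \<eta> t\<bar> \<le> L * \<bar>s - t\<bar>"

lemma swap_model_exists: obtains u \<theta> w \<eta> L where "swap_model u \<theta> w \<eta> L"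
proof -
  obtain u \<theta> :: "real \<Rightarrow> real" where u: 
    "\<And>k. Ck_on k UNIV u" "\<And>s. (u has_real_derivative \<theta> s) (at s)"
    "\<And>s. s \<le> 9 \<Longrightarrow> \<theta> s = pi" "\<And>s. s \<ge> 16 \<Longrightarrow> u s = 0" "\<And>s. s \<ge> 16 \<Longrightarrow> \<theta> s = 0"
    "\<And>B. \<exists>L\<ge>0. \<forall>s\<in>{0..B}. \<forall>t\<in>{0..B}. \<bar>\<theta> s - \<theta> t\<bar> \<le> L * \<bar>s - t\<bar>"
    by (rule linear_cutoff[of 9 16 pi]) (simp, rule that)
  obtain w \<eta> :: "real \<Rightarrow> real" where w: 
    "\<And>k. Ck_on k UNIV w" "\<And>s. (w has_real_derivative \<eta> s) (at s)"
    "\<And>s. s \<le> 1/4 \<Longrightarrow> \<eta> s = pi/2" "\<And>s. s \<ge> 1 \<Longrightarrow> w s = 0" "\<And>s. s \<ge> 1 \<Longrightarrow> \<eta> s = 0"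
    "\<And>B. \<exists>L\<ge>0. \<forall>s\<in>{0..B}. \<forall>t\<in>{0..B}. \<bar>\<eta> s - \<eta> t\<bar> \<le> L * \<bar>s - t\<bar>"
    by (rule linear_cutoff[of "1/4" 1 "pi/2"]) (simp, rule that)
  obtain L1 where L1: "L1 \<ge> 0" "\<forall>s\<in>{0..36}. \<forall>t\<in>{0..36}. \<bar>\<theta> s - \<theta> t\<bar> \<le> L1 * \<bar>s - t\<bar>" using u(6) by blast
  obtain L2 where L2: "L2 \<ge> 0" "\<forall>s\<in>{0..36}. \<forall>t\<in>{0..36}. \<bar>\<eta> s - \<eta> t\<bar> \<le> L2 * \<bar>s - t\<bar>" using w(6) by blast
  have "\<bar>\<theta> s - \<theta> t\<bar> \<le> (L1 + L2) * \<bar>s - t\<bar>" "\<bar>\<eta> s - \<eta> t\<bar> \<le> (L1 + L2) * \<bar>s - t\<bar>" 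
    if "s \<in> {0..36}" "t \<in> {0..36}" for s t
  proof -
    have "\<bar>\<theta> s - \<theta> t\<bar> \<le> L1 * \<bar>s - t\<bar>" "\<bar>\<eta> s - \<eta> t\<bar> \<le> L2 * \<bar>s - t\<bar>"
      "0 \<le> L1 * \<bar>s - t\<bar>" "0 \<le> L2 * \<bar>s - t\<bar>" using L1 L2 that by auto
    then show "\<bar>\<theta> s - \<theta> t\<bar> \<le> (L1 + L2) * \<bar>s - t\<bar>" "\<bar>\<eta> s - \<eta> t\<bar> \<le> (L1 + L2) * \<bar>s - t\<bar>"
      by (auto simp: distrib_right)
  qed
  then have "swap_model u \<theta> w \<eta> (L1 + L2)"
    using u(1-5) w(1-5) L1(1) L2(1) by unfold_locales auto
  then show thesis by (rule that)
qed

context swap_model begin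

definition rot :: "real \<Rightarrow> complex \<Rightarrow> complex" where "rot = twist 0 \<theta>"
definition swirl :: "real \<Rightarrow> complex \<Rightarrow> complex" where
  "swirl a z = twist (- 2) \<eta> a (twist 2 \<eta> a z)"
definition flow :: "real \<Rightarrow> complex \<Rightarrow> complex" where "flow t z = rot t (swirl t z)"

abbreviation "G \<equiv> flow 1"

lemma twist_fix_outer: "norm (z - p) \<ge> 1 \<Longrightarrow> twist p \<eta> a z = z"
  by (intro twist_fix \<eta>_outer) (simp add: power2_nonneg_ge_1_iff)

lemma swirl_right: "norm (z - 2) < 1 \<Longrightarrow> swirl a z = twist 2 \<eta> a z"
  using discs_disjoint[of "twist 2 \<eta> a z"] unfolding swirl_def by (simp add: twist_fix_outer)

lemma swirl_left: "norm (z + 2) < 1 \<Longrightarrow> swirl a z = twist (- 2) \<eta> a z"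
  using discs_disjoint[of z] unfolding swirl_def
  by (metis diff_minus_eq_add linorder_not_less twist_fix_outer)

lemma swirl_outside: "norm (z - 2) \<ge> 1 \<Longrightarrow> norm (z + 2) \<ge> 1 \<Longrightarrow> swirl a z = z"
  unfolding swirl_def by (simp add: twist_fix_outer)

lemma swirl_uminus: "swirl a (- z) = - swirl a z"
proof -
  have nm: "norm (- z - 2) = norm (z + 2)" "norm (- z + 2) = norm (z - 2)"
    using norm_minus_cancel[of "z + 2"] norm_minus_cancel[of "z - 2"] by (simp_all del: norm_minus_cancel)
  consider "norm (z - 2) < 1" | "norm (z + 2) < 1" | "norm (z - 2) \<ge> 1" "norm (z + 2) \<ge> 1" by linarith
  then show ?thesis
  proof cases
    case 1 then show ?thesis using twist_uminus[of 2 \<eta> a z] swirl_left[of "- z"] swirl_right[of z] nm by simp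
  next
    case 2 then show ?thesis using twist_uminus[of "- 2" \<eta> a z] swirl_right[of "- z"] swirl_left[of z] nm by simp
  next
    case 3 then show ?thesis using nm by (simp add: swirl_outside)
  qed
qed

lemma swirl_add: "swirl a (swirl b z) = swirl (a + b) z"
proof -
  consider "norm (z - 2) < 1" | "norm (z + 2) < 1" | "norm (z - 2) \<ge> 1" "norm (z + 2) \<ge> 1" by linarith
  then show ?thesis
  proof cases
    case 1 then show ?thesis by (simp add: swirl_right twist_add)
  next
    case 2
    then have "norm (twist (- 2) \<eta> b z + 2) < 1" using norm_twist[of "- 2" \<eta> b z] by simp
    then show ?thesis using 2 by (simp add: swirl_left twist_add)
  next
    case 3 then show ?thesis by (simp add: swirl_outside)
  qed
qed

lemma norm_swirl:
  shows "norm z \<le> 3 \<Longrightarrow> norm (swirl a z) \<le> 3" and "norm z > 3 \<Longrightarrow> swirl a z = z"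
proof -
  have r: "norm y \<le> 3" if "norm (y - 2) < 1" for y :: complex
    using norm_triangle_ineq[of "y - 2" 2] that by simp
  have l: "norm y \<le> 3" if "norm (y + 2) < 1" for y :: complex
    using norm_triangle_ineq4[of "y + 2" 2] that by simp
  consider "norm (z - 2) < 1" | "norm (z + 2) < 1" | "norm (z - 2) \<ge> 1" "norm (z + 2) \<ge> 1" by linarith
  then have "(norm z \<le> 3 \<longrightarrow> norm (swirl a z) \<le> 3) \<and> (norm z > 3 \<longrightarrow> swirl a z = z)"
  proof cases
    case 1 then show ?thesis using r[of z] r[of "twist 2 \<eta> a z"] by (simp add: swirl_right)
  next
    case 2 then show ?thesis using l[of z] l[of "twist (- 2) \<eta> a z"] norm_twist[of "- 2" \<eta> a z] by (simp add: swirl_left)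
  next
    case 3 then show ?thesis by (simp add: swirl_outside)
  qed
  then show "norm z \<le> 3 \<Longrightarrow> norm (swirl a z) \<le> 3" and "norm z > 3 \<Longrightarrow> swirl a z = z" by auto
qed

lemma norm_rot [simp]: "norm (rot a z) = norm z"
  using norm_twist[of 0 \<theta> a z] by (simp add: rot_def)

lemma rot_add: "rot a (rot b z) = rot (a + b) z"
  by (simp add: rot_def twist_add)

lemma rot_inner: "norm z \<le> 3 \<Longrightarrow> rot a z = cis (a * pi) * z"
  using \<theta>_inner[of "(norm z)\<^sup>2"] power_mono[of "norm z" 3 2] by (simp add: rot_def twist_def)

text \<open>On the disc of radius \<open>3\<close> the rotation is \<open>z \<mapsto> -z\<close> and \<open>swirl\<close> is odd, and outside this disc \<open>swirl\<close> is
the identity. The commutation is the reason for turning both small discs alike: it lets the iterates of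
\<open>G\<close> factor into twists.\<close>

lemma rot_swirl: "rot 1 (swirl a z) = swirl a (rot 1 z)"
proof (cases "norm z \<le> 3")
  case True
  then show ?thesis using norm_swirl(1)[OF True, of a] by (simp add: rot_inner swirl_uminus)
next
  case False
  then show ?thesis using norm_swirl(2)[of z a] norm_swirl(2)[of "rot 1 z" a] by simp
qed

lemma rot_swirl_nat: "rot (real n) (swirl a z) = swirl a (rot (real n) z)"
proof (induction n)
  case 0
  then show ?case by (simp add: rot_def twist_def)
next
  case (Suc n)
  have "rot (real (Suc n)) y = rot 1 (rot (real n) y)" for y by (simp add: rot_add)
  then show ?case using Suc rot_swirl by metis
qed

lemma G_iterate: "(G ^^ n) z = rot (real n) (swirl (real n) z)"
proof (induction n)
  case 0
  then show ?case by (simp add: rot_def swirl_def twist_def)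
next
  case (Suc n)
  have "(G ^^ Suc n) z = G ((G ^^ n) z)" by simp
  also have "\<dots> = rot 1 (swirl 1 (rot (real n) (swirl (real n) z)))" by (simp only: Suc.IH flow_def)
  also have "\<dots> = rot 1 (rot (real n) (swirl 1 (swirl (real n) z)))" by (simp only: rot_swirl_nat)
  also have "\<dots> = rot (real (Suc n)) (swirl (real (Suc n)) z)" by (simp add: rot_add swirl_add)
  finally show ?case .
qed

lemma norm_swirl_le: "norm z \<le> 4 \<Longrightarrow> norm (swirl a z) \<le> 4"
  using norm_swirl[of z a] by (cases "norm z \<le> 3") auto

lemma norm_flow_le: "norm z \<le> 4 \<Longrightarrow> norm (flow t z) \<le> 4"
  unfolding flow_def using norm_swirl_le by simp

text \<open>Each of the three twists contributes one factor; \<open>72 = 2 * 6\<^sup>2\<close> comes from \<open>twist_lipschitz\<close> with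
radius \<open>6\<close>.\<close>

lemma G_iterate_lipschitz:
  assumes "norm z \<le> 4" "norm y \<le> 4"
  shows "norm ((G ^^ n) z - (G ^^ n) y) \<le> (1 + 72 * L * real n) ^ 3 * norm (z - y)"
proof -
  define c where "c = 1 + 72 * L * real n"
  have c: "0 \<le> c" using L(1) by (simp add: c_def)
  have tw: "norm (twist p \<eta> n a - twist p \<eta> n b) \<le> c * norm (a - b)"
    if "norm (a - p) \<le> 6" "norm (b - p) \<le> 6" for a b p
    using twist_lipschitz[of 6 \<eta> L a p b "real n"] L that by (simp add: c_def)
  have ro: "norm (rot n a - rot n b) \<le> c * norm (a - b)" if "norm a \<le> 4" "norm b \<le> 4" for a b
    using twist_lipschitz[of 6 \<theta> L a 0 b "real n"] L that by (simp add: c_def rot_def)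
  have near: "norm (a - 2) \<le> 6" "norm (a - (- 2)) \<le> 6" if "norm a \<le> 4" for a :: complex
    using norm_triangle_ineq4[of a 2] norm_triangle_ineq[of a 2] that by auto
  have tw4: "norm (twist 2 \<eta> n a - (- 2)) \<le> 6" if "norm a \<le> 4" for a
  proof (cases "norm (a - 2) < 1")
    case True
    have "norm (twist 2 \<eta> n a + 2) \<le> norm (twist 2 \<eta> n a - 2) + norm (4::complex)"
      using norm_triangle_ineq[of "twist 2 \<eta> n a - 2" 4] by (simp add: add.commute)
    then show ?thesis using True by simp
  next
    case False
    then show ?thesis using near(2)[OF that] by (simp add: twist_fix_outer)
  qed
  have "norm ((G ^^ n) z - (G ^^ n) y) \<le> c * norm (swirl n z - swirl n y)"
    unfolding G_iterate using assms by (intro ro norm_swirl_le)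
  also have "norm (swirl n z - swirl n y) \<le> c * norm (twist 2 \<eta> n z - twist 2 \<eta> n y)"
    unfolding swirl_def using assms by (intro tw tw4)
  also have "norm (twist 2 \<eta> n z - twist 2 \<eta> n y) \<le> c * norm (z - y)"
    using assms by (intro tw near)
  finally have "norm ((G ^^ n) z - (G ^^ n) y) \<le> c * (c * (c * norm (z - y)))"
    using c by (simp add: mult_left_mono)
  then show ?thesis by (simp add: c_def power3_eq_cube mult.assoc)
qed

text \<open>In two rounds the disc around \<open>2\<close> returns to its place and has made two quarter turns about its centre.\<close>

lemma G_right:
  assumes "norm (z - 2) \<le> 1/2"
  shows "G z = - 2 - \<i> * (z - 2)" "G (G z) = 4 - z"
proof -
  have e: "\<eta> ((norm (z - 2))\<^sup>2) = pi/2" using power_mono[OF assms, of 2] by (intro \<eta>_inner) (simp add: power_divide)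
  have sw: "swirl a z = 2 + cis (a * (pi/2)) * (z - 2)" for a
    using assms by (subst swirl_right) (auto simp only: twist_def e)
  have "norm z \<le> 3" using norm_triangle_ineq[of "z - 2" 2] assms by simp
  then have n3: "norm (swirl a z) \<le> 3" for a by (rule norm_swirl)
  show "G z = - 2 - \<i> * (z - 2)" using n3[of 1] unfolding flow_def rot_inner[OF n3] by (simp add: sw)
  have "G (G z) = (G ^^ 2) z" by (simp add: numeral_2_eq_2)
  also have "\<dots> = 4 - z" unfolding G_iterate using n3[of 2] by (simp add: rot_inner sw)
  finally show "G (G z) = 4 - z" .
qed


definition center :: "real \<Rightarrow> complex" where "center t = 2 * cis (pi * t)"

text \<open>The generator of \<open>flow\<close>: a rotation about the origin superposed with rotations about the two centres,
which are carried along by the first one.\<close>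

definition model_field :: "real \<Rightarrow> complex \<Rightarrow> complex" where
  "model_field t z = of_real (\<theta> ((norm z)\<^sup>2)) * \<i> * z
     + of_real (\<eta> ((norm (z - center t))\<^sup>2)) * \<i> * (z - center t)
     + of_real (\<eta> ((norm (z + center t))\<^sup>2)) * \<i> * (z + center t)"

definition model_hamiltonian :: "real \<Rightarrow> complex \<Rightarrow> real" where
  "model_hamiltonian t z = - (u (z \<bullet> z) + w ((z - center t) \<bullet> (z - center t)) + w ((z + center t) \<bullet> (z + center t))) / 2"

lemma flow_right:
  assumes "norm (z - 2) < 1"
  shows "flow t z = center t + cis ((pi + \<eta> ((norm (z - 2))\<^sup>2)) * t) * (z - 2)"
proof -
  have "norm z \<le> 3" using norm_triangle_ineq[of "z - 2" 2] assms by simp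
  then have "norm (swirl t z) \<le> 3" by (rule norm_swirl)
  then show ?thesis
    using assms by (simp add: flow_def rot_inner swirl_right twist_def center_def cis_mult[symmetric] algebra_simps)
qed

lemma flow_uminus: "flow t (- z) = - flow t z"
  using twist_uminus[of 0 \<theta> t "swirl t z"] by (simp add: flow_def swirl_uminus rot_def)

lemma model_field_uminus: "model_field t (- z) = - model_field t z"
proof -
  have "norm (- z - center t) = norm (z + center t)" "norm (center t - z) = norm (z - center t)"
    using norm_minus_cancel[of "z + center t"] norm_minus_commute by (simp_all del: norm_minus_cancel)
  then show ?thesis by (simp add: model_field_def algebra_simps)
qed

lemma norm_center [simp]: "norm (center t) = 2"
  by (simp add: center_def norm_mult)

lemma outer_field_zero: 
  assumes "norm y \<ge> 1" shows "\<eta> ((norm y)\<^sup>2) = 0"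
  using assms by (intro \<eta>_outer) (simp add: power2_nonneg_ge_1_iff)

lemma flow_derivative_right:
  assumes "norm (z - 2) < 1"
  shows "((\<lambda>t. flow t z) has_vector_derivative model_field t (flow t z)) (at t within S)"
proof -
  define \<omega> where "\<omega> = pi + \<eta> ((norm (z - 2))\<^sup>2)"
  have fl: "flow t z = 2 * cis (pi * t) + cis (\<omega> * t) * (z - 2)" for t
    using flow_right[OF assms] by (simp add: \<omega>_def center_def)
  have "((\<lambda>t. flow t z) has_vector_derivative 2 * (pi *\<^sub>R (\<i> * cis (pi * t))) + (\<omega> *\<^sub>R (\<i> * cis (\<omega> * t))) * (z - 2)) (at t within S)"
    unfolding fl by (intro has_vector_derivative_add has_vector_derivative_mult_left
        has_vector_derivative_mult_right has_vector_derivative_cis_linear)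
  moreover have "model_field t (flow t z) = 2 * (pi *\<^sub>R (\<i> * cis (pi * t))) + (\<omega> *\<^sub>R (\<i> * cis (\<omega> * t))) * (z - 2)"
  proof -
    have d: "flow t z - center t = cis (\<omega> * t) * (z - 2)" by (simp add: fl center_def)
    have nd: "norm (flow t z - center t) = norm (z - 2)" unfolding d by (simp add: norm_mult)
    have "norm (2 * center t) \<le> norm (flow t z + center t) + norm (flow t z - center t)"
      using norm_triangle_ineq4[of "flow t z + center t" "flow t z - center t"] by simp
    then have far: "norm (flow t z + center t) \<ge> 1" using nd assms by (simp add: norm_mult)
    have "norm (flow t z) \<le> 3"
      using norm_triangle_ineq[of "flow t z - center t" "center t"] nd assms by simp
    then have th: "\<theta> ((norm (flow t z))\<^sup>2) = pi" using power_mono[of "norm (flow t z)" 3 2] by (intro \<theta>_inner) simp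
    have "model_field t (flow t z) = of_real pi * \<i> * flow t z + of_real (\<eta> ((norm (z - 2))\<^sup>2)) * \<i> * (cis (\<omega> * t) * (z - 2))"
      unfolding model_field_def nd outer_field_zero[OF far] th unfolding d by simp
    also have "\<dots> = 2 * (pi *\<^sub>R (\<i> * cis (pi * t))) + (\<omega> *\<^sub>R (\<i> * cis (\<omega> * t))) * (z - 2)"
      by (simp add: fl \<omega>_def scaleR_conv_of_real algebra_simps)
    finally show ?thesis .
  qed
  ultimately show ?thesis by simp
qed

text \<open>The discs around the two centres are exchanged by the symmetry \<open>z \<mapsto> -z\<close> of the flow and its generator.
Outside of them only the rotation about the origin acts, and the moving centres never come closer than
\<open>1\<close> to the point.\<close>

lemma flow_derivative:
  "((\<lambda>t. flow t z) has_vector_derivative model_field t (flow t z)) (at t within S)"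
proof -
  consider "norm (z - 2) < 1" | "norm (z + 2) < 1" | "norm (z - 2) \<ge> 1" "norm (z + 2) \<ge> 1" by linarith
  then show ?thesis
  proof cases
    case 1 then show ?thesis by (rule flow_derivative_right)
  next
    case 2
    then have "norm (- z - 2) < 1" using norm_minus_cancel[of "z + 2"] by (simp del: norm_minus_cancel)
    from flow_derivative_right[OF this, of t S]
    have "((\<lambda>t. - flow t z) has_vector_derivative - model_field t (flow t z)) (at t within S)"
      by (simp add: flow_uminus model_field_uminus)
    from has_vector_derivative_minus[OF this] show ?thesis by simp
  next
    case 3
    define \<omega> where "\<omega> = \<theta> ((norm z)\<^sup>2)"
    have fl: "flow t z = cis (\<omega> * t) * z" for t
      using 3 by (simp add: flow_def swirl_outside rot_def twist_def \<omega>_def mult.commute)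
    have "((\<lambda>t. flow t z) has_vector_derivative (\<omega> *\<^sub>R (\<i> * cis (\<omega> * t))) * z) (at t within S)"
      unfolding fl by (intro has_vector_derivative_mult_left has_vector_derivative_cis_linear)
    moreover have "norm (flow t z - center t) \<ge> 1 \<and> norm (flow t z + center t) \<ge> 1"
    proof (cases "norm z \<le> 3")
      case True
      then have "(norm z)\<^sup>2 \<le> 9" using power_mono[of "norm z" 3 2] by simp
      then have "\<omega> = pi" unfolding \<omega>_def by (rule \<theta>_inner)
      then have "flow t z - center t = cis (pi * t) * (z - 2)" "flow t z + center t = cis (pi * t) * (z + 2)"
        by (simp_all add: fl center_def algebra_simps)
      then show ?thesis using 3 by (simp add: norm_mult)
    next
      case False
      then have "norm (flow t z) > 3" by (simp add: fl norm_mult)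
      then show ?thesis
        using norm_triangle_ineq2[of "flow t z" "center t"] norm_triangle_ineq2[of "flow t z" "- center t"] by simp
    qed
    moreover have "norm (flow t z) = norm z" by (simp add: fl norm_mult)
    ultimately show ?thesis
      by (simp add: model_field_def outer_field_zero fl \<omega>_def scaleR_conv_of_real mult_ac)
  qed
qed

lemma flow_0: "flow 0 z = z"
  by (simp add: flow_def swirl_def rot_def twist_def)

text \<open>The expression \<open>Im (cnj a * b)\<close> is the standard area form of the plane, so that \<open>model_field\<close> is the
Hamiltonian vector field of \<open>model_hamiltonian\<close>.\<close>

lemma model_hamiltonian_derivative:
  "(model_hamiltonian t has_derivative (\<lambda>v. Im (cnj (model_field t z) * v))) (at z)"
proof -
  have q: "((\<lambda>z. f ((z - c) \<bullet> (z - c))) has_derivative (\<lambda>v. f' ((z - c) \<bullet> (z - c)) * (2 * ((z - c) \<bullet> v)))) (at z)"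
    if f: "\<And>s. (f has_real_derivative f' s) (at s)" for f f' :: "real \<Rightarrow> real" and c :: complex
  proof -
    have "((\<lambda>z. (z - c) \<bullet> (z - c)) has_derivative (\<lambda>v. 2 * ((z - c) \<bullet> v))) (at z)"
      by (auto intro!: derivative_eq_intros simp: inner_commute)
    from has_derivative_compose[OF this f[unfolded has_field_derivative_def]] show ?thesis by simp
  qed
  have "(model_hamiltonian t has_derivative (\<lambda>v. - (\<theta> ((z - 0) \<bullet> (z - 0)) * (2 * ((z - 0) \<bullet> v))
     + \<eta> ((z - center t) \<bullet> (z - center t)) * (2 * ((z - center t) \<bullet> v))
     + \<eta> ((z - (- center t)) \<bullet> (z - (- center t))) * (2 * ((z - (- center t)) \<bullet> v))) / 2)) (at z)"
    unfolding model_hamiltonian_def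
    using q[OF deriv_u, of 0] q[OF deriv_w, of "center t"] q[OF deriv_w, of "- center t"]
    by (auto intro!: derivative_eq_intros)
  moreover have "Im (cnj (model_field t z) * v) = - (\<theta> ((z - 0) \<bullet> (z - 0)) * (2 * ((z - 0) \<bullet> v))
     + \<eta> ((z - center t) \<bullet> (z - center t)) * (2 * ((z - center t) \<bullet> v))
     + \<eta> ((z - (- center t)) \<bullet> (z - (- center t))) * (2 * ((z - (- center t)) \<bullet> v))) / 2" for v
  proof -
    have c: "Im (cnj (of_real r * \<i> * y) * v) = - r * (y \<bullet> v)" for r y
      by (simp add: inner_complex_def algebra_simps)
    have l: "Im (cnj (a + b + d) * v) = Im (cnj a * v) + Im (cnj b * v) + Im (cnj d * v)" for a b d
      by (simp add: algebra_simps)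
    show ?thesis unfolding model_field_def l c power2_norm_eq_inner diff_0_right diff_minus_eq_add by (simp add: field_simps)
  qed
  ultimately show ?thesis by (simp only:)
qed

lemma model_hamiltonian_outer:
  assumes "norm z \<ge> 4"
  shows "model_hamiltonian t z = 0"
proof -
  have "norm (z - center t) \<ge> 1" "norm (z + center t) \<ge> 1"
    using norm_triangle_ineq2[of z "center t"] norm_triangle_ineq2[of z "- center t"] assms by auto
  then have "(norm (z - center t))\<^sup>2 \<ge> 1" "(norm (z + center t))\<^sup>2 \<ge> 1" by (simp_all add: power2_nonneg_ge_1_iff)
  moreover have "(norm z)\<^sup>2 \<ge> 16" using power_mono[of 4 "norm z" 2] assms by simp
  ultimately show ?thesis
    by (simp add: model_hamiltonian_def power2_norm_eq_inner[symmetric] u_outer w_outer)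
qed

lemma smooth_model_hamiltonian:
  "Ck_on k UNIV (\<lambda>(t, z). model_hamiltonian t z)"
proof -
  have fst: "Ck_on k UNIV (fst :: real \<times> complex \<Rightarrow> real)" and snd: "Ck_on k UNIV (snd :: real \<times> complex \<Rightarrow> complex)"
    by (auto intro: Ck_on_linear bounded_linear_fst bounded_linear_snd)
  have pit: "Ck_on k UNIV (\<lambda>p :: real \<times> complex. pi * fst p)"
    by (intro Ck_on_mult fst) auto
  have "Ck_on k UNIV (\<lambda>p :: real \<times> complex. cos (pi * fst p) *\<^sub>R 2 + sin (pi * fst p) *\<^sub>R (2 * \<i>))"
    by (intro Ck_on_add Ck_on_scaleR Ck_on_const open_UNIV Ck_on_compose[OF open_UNIV open_UNIV _ pit Ck_on_cos]
        Ck_on_compose[OF open_UNIV open_UNIV _ pit Ck_on_sin]) auto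
  moreover have "cos (pi * t) *\<^sub>R 2 + sin (pi * t) *\<^sub>R (2 * \<i>) = center t" for t
    by (simp add: center_def complex_eq_iff)
  ultimately have cen: "Ck_on k UNIV (\<lambda>p :: real \<times> complex. center (fst p))" by simp
  have sq: "Ck_on k UNIV (\<lambda>p :: real \<times> complex. g (f p \<bullet> f p))" if "Ck_on k UNIV f" "Ck_on k UNIV g" for f :: "real \<times> complex \<Rightarrow> complex" and g :: "real \<Rightarrow> real"
    by (rule Ck_on_compose[OF open_UNIV open_UNIV _ Ck_on_inner[OF open_UNIV that(1) that(1)] that(2)]) auto
  have "Ck_on k UNIV (\<lambda>p. - (u (snd p \<bullet> snd p) + w ((snd p - center (fst p)) \<bullet> (snd p - center (fst p)))
     + w ((snd p + center (fst p)) \<bullet> (snd p + center (fst p)))) * inverse 2)"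
    by (intro Ck_on_mult Ck_on_minus Ck_on_add sq smooth_u smooth_w snd cen Ck_on_diff Ck_on_const open_UNIV)
  moreover have "(\<lambda>(t, z). model_hamiltonian t z) = (\<lambda>p. - (u (snd p \<bullet> snd p) + w ((snd p - center (fst p)) \<bullet> (snd p - center (fst p)))
     + w ((snd p + center (fst p)) \<bullet> (snd p + center (fst p)))) * inverse 2)"
    by (rule ext) (simp only: case_prod_beta model_hamiltonian_def divide_inverse)
  ultimately show ?thesis by (simp only:)
qed

end

section \<open>Vanishing of the topological entropy\<close>

text \<open>The cells are squares of side \<open>\<epsilon>\<close>, indexed by their lower left corners.\<close>

lemma grid_partition:
  fixes R \<epsilon> :: real
  assumes "0 < \<epsilon>" "0 \<le> R"
  obtains q :: "complex \<Rightarrow> int \<times> int" where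
    "finite (q ` cball 0 R)" "real (card (q ` cball 0 R)) \<le> (2 * R / \<epsilon> + 3)\<^sup>2"
    "\<And>z y. q z = q y \<Longrightarrow> dist z y \<le> 2 * \<epsilon>"
proof -
  define q where "q z = (\<lfloor>Re z / \<epsilon>\<rfloor>, \<lfloor>Im z / \<epsilon>\<rfloor>)" for z
  define N where "N = \<lceil>R / \<epsilon>\<rceil>"
  have "0 \<le> R / \<epsilon>" using assms by simp
  then have N: "0 \<le> N" unfolding N_def by linarith
  have fl: "\<lfloor>x / \<epsilon>\<rfloor> \<in> {- N..N}" if "\<bar>x\<bar> \<le> R" for x
  proof -
    have "- (R / \<epsilon>) \<le> x / \<epsilon>" "x / \<epsilon> \<le> R / \<epsilon>" using that assms by (auto simp: field_simps abs_le_iff)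
    then have "- real_of_int N \<le> x / \<epsilon>" "x / \<epsilon> \<le> real_of_int N" unfolding N_def by linarith+
    then show ?thesis by (auto simp: le_floor_iff floor_le_iff)
  qed
  have sub: "q ` cball 0 R \<subseteq> {- N..N} \<times> {- N..N}"
  proof
    fix y assume "y \<in> q ` cball 0 R"
    then obtain z where z: "norm z \<le> R" "y = q z" by auto
    then have "\<bar>Re z\<bar> \<le> R" "\<bar>Im z\<bar> \<le> R" using abs_Re_le_cmod[of z] abs_Im_le_cmod[of z] by linarith+
    then show "y \<in> {- N..N} \<times> {- N..N}" using fl z unfolding q_def by blast
  qed
  have fin: "finite ({- N..N} \<times> {- N..N})" by simp
  show thesis
  proof (rule that[of q])
    show "finite (q ` cball 0 R)" using sub fin by (rule finite_subset)
    have "real (card (q ` cball 0 R)) \<le> real (card ({- N..N} \<times> {- N..N}))"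
      by (rule of_nat_mono[OF card_mono[OF fin sub]])
    also have "\<dots> = (real_of_int (2 * N + 1))\<^sup>2"
      using N by (simp add: card_cartesian_product power2_eq_square)
    also have "\<dots> \<le> (2 * R / \<epsilon> + 3)\<^sup>2"
    proof (rule power_mono)
      have "real_of_int N \<le> R / \<epsilon> + 1" unfolding N_def by linarith
      then show "real_of_int (2 * N + 1) \<le> 2 * R / \<epsilon> + 3" by simp
    qed (use N in simp)
    finally show "real (card (q ` cball 0 R)) \<le> (2 * R / \<epsilon> + 3)\<^sup>2" .
  next
    fix z y assume "q z = q y"
    then have e: "\<lfloor>Re z / \<epsilon>\<rfloor> = \<lfloor>Re y / \<epsilon>\<rfloor>" "\<lfloor>Im z / \<epsilon>\<rfloor> = \<lfloor>Im y / \<epsilon>\<rfloor>" by (auto simp: q_def)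
    have "\<bar>a - b\<bar> \<le> \<epsilon>" if "\<lfloor>a / \<epsilon>\<rfloor> = \<lfloor>b / \<epsilon>\<rfloor>" for a b
    proof -
      have "\<bar>a / \<epsilon> - b / \<epsilon>\<bar> \<le> 1" using that by linarith
      then have "\<bar>a - b\<bar> / \<epsilon> \<le> 1" using assms(1) by (simp add: diff_divide_distrib[symmetric] abs_divide)
      then show ?thesis using assms(1) by (simp add: field_simps)
    qed
    then have "\<bar>Re (z - y)\<bar> \<le> \<epsilon>" "\<bar>Im (z - y)\<bar> \<le> \<epsilon>" using e by auto
    then show "dist z y \<le> 2 * \<epsilon>" using cmod_le[of "z - y"] by (simp add: dist_norm)
  qed
qed

lemma cover_entropy_le_0:
  assumes "\<And>n. n > 0 \<Longrightarrow> real (min_subcover_card K (iterated_cover K f C n)) \<le> c * real n ^ d" "c \<ge> 1"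
  shows "cover_entropy K f C \<le> 0"
proof -
  define a where "a n = ln (real (min_subcover_card K (iterated_cover K f C n))) / real n" for n
  have lim: "(\<lambda>n. (ln c + real d * ln (real n)) / real n) \<longlonglongrightarrow> 0"
  proof -
    have "(\<lambda>n. ln c / real n + real d * (ln (real n) / real n)) \<longlonglongrightarrow> 0 + real d * 0"
      by (intro tendsto_add tendsto_mult tendsto_const lim_const_over_n lim_ln_over_n)
    then show ?thesis by (simp add: add_divide_distrib)
  qed
  have "a n \<le> (ln c + real d * ln (real n)) / real n" if "n > 0" for n
  proof -
    let ?m = "real (min_subcover_card K (iterated_cover K f C n))"
    have "ln ?m \<le> ln c + real d * ln (real n)"
    proof (cases "?m = 0")
      case True
      then show ?thesis using assms(2) that by simp
    next
      case False
      then have "ln ?m \<le> ln (c * real n ^ d)" using assms(1)[OF that] by (intro ln_mono) auto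
      also have "\<dots> = ln c + real d * ln (real n)" using assms(2) that by (simp add: ln_mult ln_realpow)
      finally show ?thesis .
    qed
    then show ?thesis unfolding a_def by (intro divide_right_mono) auto
  qed
  then have "limsup (\<lambda>n. ereal (a n)) \<le> limsup (\<lambda>n. ereal ((ln c + real d * ln (real n)) / real n))"
    by (intro Limsup_mono) (auto simp: eventually_sequentially intro!: exI[of _ 1])
  also have "\<dots> = 0"
    using lim by (intro lim_imp_Limsup) (auto simp: zero_ereal_def)
  finally show ?thesis unfolding cover_entropy_def a_def .
qed

lemma min_subcover_card_le:
  assumes "D \<subseteq> C" "finite D" "K \<subseteq> \<Union>D"
  shows "min_subcover_card K C \<le> card D"
  unfolding min_subcover_card_def by (rule Least_le) (use assms in blast)

text \<open>The empty compact set already contributes \<open>0\<close> to the supremum, because \<open>ln 0 = 0\<close>.\<close>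

lemma topological_entropy_nonneg: "0 \<le> topological_entropy f"
proof -
  have "min_subcover_card {} C = 0" for C :: "'a set set"
    using min_subcover_card_le[of "{}" C "{}"] by simp
  then have "cover_entropy {} f C = 0" for C
    unfolding cover_entropy_def by (simp add: zero_ereal_def[symmetric] Limsup_const)
  moreover have "open_cover {} {}" by (simp add: open_cover_def)
  ultimately have "0 \<le> compact_entropy {} f"
    unfolding compact_entropy_def by (metis SUP_upper mem_Collect_eq)
  then show ?thesis unfolding topological_entropy_def by (intro SUP_upper2[of "{}"]) auto
qed

text \<open>Let \<open>\<mu>\<close> be a Lebesgue number of the cover. Points whose distance is at most \<open>\<mu>\<close> divided by the Lipschitz
constant stay \<open>\<mu>\<close>-close during the first \<open>n\<close> steps, so that a grid cell of this size lies in one member of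
the iterated cover; the number of cells is polynomial in \<open>n\<close>. The points outside the disc are fixed, and
for them constant itineraries through a finite subcover suffice for all \<open>n\<close>.\<close>

lemma topological_entropy_zero_polynomial_growth:
  fixes g :: "'a::t2_space \<Rightarrow> 'a" and \<psi> :: "'a \<Rightarrow> complex"
  assumes hom: "homeomorphism D (cball 0 R) \<psi> \<psi>'" and R: "0 \<le> R"
    and gD: "\<And>x. x \<in> D \<Longrightarrow> g x \<in> D" and conj: "\<And>x. x \<in> D \<Longrightarrow> \<psi> (g x) = F (\<psi> x)"
    and gid: "\<And>x. x \<notin> D \<Longrightarrow> g x = x"
    and lip: "\<And>n z y. z \<in> cball 0 R \<Longrightarrow> y \<in> cball 0 R \<Longrightarrow>
       dist ((F ^^ n) z) ((F ^^ n) y) \<le> (1 + b * real n) ^ d * dist z y" and b: "0 \<le> b"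
  shows "topological_entropy g = 0"
proof (rule antisym[OF _ topological_entropy_nonneg])
  have hD: "\<psi> ` D = cball 0 R" "\<And>x. x \<in> D \<Longrightarrow> \<psi>' (\<psi> x) = x" "\<And>z. z \<in> cball 0 R \<Longrightarrow> \<psi> (\<psi>' z) = z"
    "\<And>z. z \<in> cball 0 R \<Longrightarrow> \<psi>' z \<in> D"
    and cont: "continuous_on (cball 0 R) \<psi>'" and contp: "continuous_on D \<psi>"
    using hom by (auto simp: homeomorphism_def)
  have cD: "compact D" 
    using compact_continuous_image[OF cont] hom by (simp add: homeomorphism_def)
  have itD: "(g ^^ n) x \<in> D \<and> \<psi> ((g ^^ n) x) = (F ^^ n) (\<psi> x)" if "x \<in> D" for n x
    by (induction n) (use that gD conj in auto)
  have itid: "(g ^^ n) x = x" if "x \<notin> D" for n x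
    by (induction n) (use that gid in auto)
  have "cover_entropy K g C \<le> 0" if K: "compact K" "g ` K \<subseteq> K" and C: "open_cover K C" for K C
  proof -
    have Kit: "(g ^^ n) x \<in> K" if "x \<in> K" for n x
      by (induction n) (use that K in auto)
    have Cop: "\<And>U. U \<in> C \<Longrightarrow> openin (top_of_set K) U" and CK: "\<Union>C = K" using C by (auto simp: open_cover_def)
    obtain C0 where C0: "C0 \<subseteq> C" "finite C0" "K \<subseteq> \<Union>C0"
      using K(1)[unfolded compact_eq_openin_cover, rule_format, of C] Cop CK by auto
    have "\<exists>W. open W \<and> cball 0 R \<inter> {z. \<psi>' z \<in> K} \<inter> W = {z \<in> cball 0 R. \<psi>' z \<in> U}" if U: "U \<in> C" for U
    proof -
      obtain V where V: "open V" "U = K \<inter> V" using Cop[OF U] by (auto simp: openin_open)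
      have "openin (top_of_set (cball 0 R)) (cball 0 R \<inter> \<psi>' -` V)"
        using cont V(1) by (rule continuous_openin_preimage_gen)
      then obtain W where W: "open W" "cball 0 R \<inter> \<psi>' -` V = cball 0 R \<inter> W" by (auto simp: openin_open)
      then have "cball 0 R \<inter> {z. \<psi>' z \<in> K} \<inter> W = {z \<in> cball 0 R. \<psi>' z \<in> U}" unfolding V(2) by blast
      then show ?thesis using W(1) by blast
    qed
    then obtain W where W: "\<And>U. U \<in> C \<Longrightarrow> open (W U)"
      "\<And>U. U \<in> C \<Longrightarrow> cball 0 R \<inter> {z. \<psi>' z \<in> K} \<inter> W U = {z \<in> cball 0 R. \<psi>' z \<in> U}" by metis
    \<comment> \<open>the part of \<open>K\<close> in the disc, seen in the plane, where the Lebesgue number lemma applies\<close>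
    define S where "S = cball 0 R \<inter> {z. \<psi>' z \<in> K}"
    have "S = \<psi> ` (D \<inter> K)"
    proof -
      have "z \<in> \<psi> ` (D \<inter> K)" if "z \<in> S" for z
        using that hD unfolding S_def by (intro image_eqI[of _ _ "\<psi>' z"]) auto
      then show ?thesis using hD unfolding S_def by auto
    qed
    moreover have inS: "\<psi> y \<in> S" if "y \<in> D" "y \<in> K" for y
    proof -
      have "\<psi> y \<in> cball 0 R" using that(1) hD(1) by blast
      then show ?thesis using that hD(2) by (simp add: S_def)
    qed
    moreover have "compact (D \<inter> K)" using cD K(1) compact_Int by blast
    ultimately have cS: "compact S"
      using compact_continuous_image contp continuous_on_subset by (metis inf_le1)
    have WS: "\<psi>' z \<in> U" if "z \<in> S" "U \<in> C" "z \<in> W U" for z U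
      using that(1,3) W(2)[OF that(2)] unfolding S_def by blast
    have SW: "\<exists>U\<in>C. z \<in> W U" if "z \<in> S" for z
    proof -
      have "\<psi>' z \<in> K" using that by (simp add: S_def)
      then obtain U where "U \<in> C" "\<psi>' z \<in> U" using CK by blast
      then show ?thesis using W(2)[of U] that unfolding S_def by blast
    qed
    obtain \<mu> where \<mu>: "0 < \<mu>" "\<And>T. T \<subseteq> S \<Longrightarrow> T \<noteq> {} \<Longrightarrow> (\<And>z y. z \<in> T \<Longrightarrow> y \<in> T \<Longrightarrow> dist z y \<le> \<mu>) \<Longrightarrow> \<exists>U\<in>C. T \<subseteq> W U"
    proof (cases "S = {}")
      case True
      show ?thesis by (rule that[of 1]) (use True in auto)
    next
      case False
      then have ne: "W ` C \<noteq> {}" using SW by blast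
      obtain \<delta> where \<delta>: "0 < \<delta>" "\<And>T. T \<subseteq> S \<Longrightarrow> diameter T < \<delta> \<Longrightarrow> \<exists>B\<in>W ` C. T \<subseteq> B"
        by (rule Lebesgue_number_lemma[OF cS ne]) (use SW W(1) in auto)
      have "\<exists>U\<in>C. T \<subseteq> W U" if "T \<subseteq> S" "T \<noteq> {}" "\<And>z y. z \<in> T \<Longrightarrow> y \<in> T \<Longrightarrow> dist z y \<le> \<delta>/2" for T
      proof -
        have "diameter T \<le> \<delta>/2" by (rule diameter_le) (use that \<delta> in \<open>auto simp: dist_norm\<close>)
        then show ?thesis using \<delta>(2)[OF that(1)] \<delta>(1) by auto
      qed
      then show ?thesis using that[of "\<delta>/2"] \<delta>(1) by auto
    qed
    define c where "c = real (card C0) + (4 * R * (1 + b) ^ d / \<mu> + 3)\<^sup>2 + 1"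
    show ?thesis
    proof (rule cover_entropy_le_0[of _ _ _ c "2 * d"])
      show "c \<ge> 1" by (simp add: c_def)
      fix n :: nat assume n: "n > 0"
      define \<epsilon> where "\<epsilon> = \<mu> / (2 * (1 + b * real n) ^ d)"
      have bn: "1 \<le> 1 + b * real n" using b by simp
      then have bnp: "1 \<le> (1 + b * real n) ^ d" by (rule one_le_power)
      have \<epsilon>: "0 < \<epsilon>" unfolding \<epsilon>_def using \<mu>(1) bnp by (intro divide_pos_pos) auto
      obtain q :: "complex \<Rightarrow> int \<times> int" where q: "finite (q ` cball 0 R)" "real (card (q ` cball 0 R)) \<le> (2 * R / \<epsilon> + 3)\<^sup>2"
        "\<And>z y. q z = q y \<Longrightarrow> dist z y \<le> 2 * \<epsilon>" by (rule grid_partition[OF \<epsilon> R]) (rule that)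
      have "\<exists>U\<in>C. \<forall>z\<in>S. q z = k \<longrightarrow> (F ^^ i) z \<in> W U" if k: "k \<in> q ` S" and i: "i < n" for i k
      proof -
        define T where "T = (F ^^ i) ` {z \<in> S. q z = k}"
        have FS: "(F ^^ i) z \<in> S" if "z \<in> S" for z
        proof -
          have z: "\<psi>' z \<in> D" "\<psi>' z \<in> K" "\<psi> (\<psi>' z) = z" using that hD by (auto simp: S_def)
          then have "(F ^^ i) z = \<psi> ((g ^^ i) (\<psi>' z))" "(g ^^ i) (\<psi>' z) \<in> D" "(g ^^ i) (\<psi>' z) \<in> K"
            using itD[OF z(1), of i] Kit by auto
          then show ?thesis using hD by (auto simp: S_def)
        qed
        have "\<exists>U\<in>C. T \<subseteq> W U"
        proof (rule \<mu>(2))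
          show "T \<subseteq> S" "T \<noteq> {}" using FS k by (auto simp: T_def)
          fix z y assume "z \<in> T" "y \<in> T"
          then obtain z' y' where zy: "z = (F ^^ i) z'" "y = (F ^^ i) y'" "z' \<in> S" "y' \<in> S" "q z' = q y'" by (auto simp: T_def)
          have "dist z y \<le> (1 + b * real i) ^ d * dist z' y'" using lip zy by (simp add: S_def)
          also have "\<dots> \<le> (1 + b * real n) ^ d * (2 * \<epsilon>)"
            using q(3)[OF zy(5)] b i by (intro mult_mono power_mono add_left_mono mult_left_mono) auto
          also have "\<dots> = \<mu>" using bn by (simp add: \<epsilon>_def)
          finally show "dist z y \<le> \<mu>" .
        qed
        then show ?thesis unfolding T_def by blast
      qed
      then obtain v where v: "\<And>k i. k \<in> q ` S \<Longrightarrow> i < n \<Longrightarrow> v k i \<in> C"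
        "\<And>k i z. k \<in> q ` S \<Longrightarrow> i < n \<Longrightarrow> z \<in> S \<Longrightarrow> q z = k \<Longrightarrow> (F ^^ i) z \<in> W (v k i)"
        by metis
      define cell where "cell u = {x \<in> K. \<forall>i<n. (g ^^ i) x \<in> u i}" for u :: "nat \<Rightarrow> 'a set"
      define E where "E = (\<lambda>U. cell (\<lambda>i. U)) ` C0 \<union> (\<lambda>k. cell (v k)) ` (q ` S)"
      have qS: "q ` S \<subseteq> q ` cball 0 R" by (auto simp: S_def)
      then have fqS: "finite (q ` S)" using q(1) finite_subset by blast
      have cellI: "cell u \<in> iterated_cover K g C n" if "\<And>i. i < n \<Longrightarrow> u i \<in> C" for u
        unfolding iterated_cover_def cell_def by (intro CollectI exI[of _ u]) (simp add: that)
      have "E \<subseteq> iterated_cover K g C n"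
      proof
        fix e assume "e \<in> E"
        then consider U where "U \<in> C0" "e = cell (\<lambda>i. U)" | k where "k \<in> q ` S" "e = cell (v k)"
          unfolding E_def by blast
        then show "e \<in> iterated_cover K g C n"
        proof cases
          case 1
          then show ?thesis using C0(1) by (auto intro: cellI)
        next
          case 2
          then show ?thesis using v(1) by (simp add: cellI)
        qed
      qed
      moreover have "finite E" unfolding E_def using C0(2) fqS by blast
      moreover have "K \<subseteq> \<Union>E"
      proof
        fix x assume x: "x \<in> K"
        show "x \<in> \<Union>E"
        proof (cases "x \<in> D")
          case True
          then have xS: "\<psi> x \<in> S" using x hD by (auto simp: S_def)
          have "(g ^^ i) x \<in> v (q (\<psi> x)) i" if "i < n" for i
          proof -
            have "(F ^^ i) (\<psi> x) \<in> W (v (q (\<psi> x)) i)" using v(2) xS that by blast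
            moreover have gi: "\<psi> ((g ^^ i) x) = (F ^^ i) (\<psi> x)" "(g ^^ i) x \<in> D" using itD[OF True] by auto
            moreover have "\<psi> ((g ^^ i) x) \<in> S" by (rule inS[OF gi(2) Kit[OF x]])
            moreover have "v (q (\<psi> x)) i \<in> C" using v(1) xS that by blast
            ultimately have "\<psi>' (\<psi> ((g ^^ i) x)) \<in> v (q (\<psi> x)) i" by (auto intro: WS)
            then show ?thesis using hD(2) gi(2) by simp
          qed
          then have "x \<in> cell (v (q (\<psi> x)))" using x by (simp add: cell_def)
          then show ?thesis unfolding E_def using xS by blast
        next
          case False
          obtain U where "U \<in> C0" "x \<in> U" using C0(3) x by blast
          then have "x \<in> cell (\<lambda>i. U)" using x by (simp add: cell_def itid[OF False])
          then show ?thesis unfolding E_def using \<open>U \<in> C0\<close> by blast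
        qed
      qed
      ultimately have "min_subcover_card K (iterated_cover K g C n) \<le> card E" by (rule min_subcover_card_le)
      also have "\<dots> \<le> card C0 + card (q ` S)"
        unfolding E_def using C0(2) fqS by (intro order_trans[OF card_Un_le] add_mono card_image_le)
      also have "card (q ` S) \<le> card (q ` cball 0 R)" using qS q(1) by (intro card_mono)
      finally have "real (min_subcover_card K (iterated_cover K g C n)) \<le> real (card C0) + (2 * R / \<epsilon> + 3)\<^sup>2"
        using q(2) by linarith
      also have "(2 * R / \<epsilon> + 3)\<^sup>2 \<le> ((4 * R * (1 + b) ^ d / \<mu> + 3) * real n ^ d)\<^sup>2"
      proof (rule power_mono)
        have n1: "1 \<le> real n ^ d" using n by (intro one_le_power) simp
        have "(1 + b * real n) ^ d \<le> ((1 + b) * real n) ^ d"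
          using n b by (intro power_mono) (auto simp: algebra_simps)
        then have "4 * R / \<mu> * (1 + b * real n) ^ d \<le> 4 * R / \<mu> * ((1 + b) ^ d * real n ^ d)"
          using R \<mu>(1) by (intro mult_left_mono) (auto simp: power_mult_distrib)
        moreover have "2 * R / \<epsilon> = 4 * R / \<mu> * (1 + b * real n) ^ d" by (simp add: \<epsilon>_def)
        ultimately show "2 * R / \<epsilon> + 3 \<le> (4 * R * (1 + b) ^ d / \<mu> + 3) * real n ^ d"
          using n1 by (simp add: distrib_right)
      qed (use R \<epsilon> in simp)
      also have "\<dots> = (4 * R * (1 + b) ^ d / \<mu> + 3)\<^sup>2 * real n ^ (2 * d)"
        by (simp add: power_mult_distrib power_mult[symmetric] mult.commute)
      finally have "real (min_subcover_card K (iterated_cover K g C n))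
        \<le> real (card C0) + (4 * R * (1 + b) ^ d / \<mu> + 3)\<^sup>2 * real n ^ (2 * d)" by simp
      also have "\<dots> \<le> real (card C0) * real n ^ (2 * d) + (4 * R * (1 + b) ^ d / \<mu> + 3)\<^sup>2 * real n ^ (2 * d) + real n ^ (2 * d)"
      proof -
        have n1: "1 \<le> real n ^ (2 * d)" using n by (intro one_le_power) simp
        then have "real (card C0) * 1 \<le> real (card C0) * real n ^ (2 * d)" by (intro mult_left_mono) auto
        then show ?thesis using n1 by linarith
      qed
      finally show "real (min_subcover_card K (iterated_cover K g C n)) \<le> c * real n ^ (2 * d)"
        by (simp add: c_def distrib_right)
    qed
  qed
  then show "topological_entropy g \<le> 0"
    unfolding topological_entropy_def compact_entropy_def by (intro SUP_least) auto
qed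

section \<open>Uniqueness of integral curves\<close>

lemma at_within_rel_open:
  assumes "open W" "t \<in> W" "S = T \<inter> W"
  shows "at t within S = at t within T"
  by (rule at_within_nhd[of t W]) (use assms in auto)

text \<open>At a point where \<open>|w|\<close> attains its maximum \<open>M\<close>, the mean value inequality gives \<open>M \<le> e B M \<le> M/2\<close>.\<close>

lemma zero_of_small_derivative:
  fixes w :: "real \<Rightarrow> 'b::real_normed_vector"
  assumes "0 \<le> e" "e * B \<le> 1/2"
    and d: "\<And>t. t \<in> {t0 - e..t0 + e} \<Longrightarrow> (w has_vector_derivative w' t) (at t within {t0 - e..t0 + e})"
    and b: "\<And>t. t \<in> {t0 - e..t0 + e} \<Longrightarrow> norm (w' t) \<le> B * norm (w t)" and "0 \<le> B"
    and w0: "w t0 = 0" and t: "t \<in> {t0 - e..t0 + e}"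
  shows "w t = 0"
proof -
  let ?I = "{t0 - e..t0 + e}"
  have cont: "continuous_on ?I (\<lambda>t. norm (w t))"
    using d by (intro continuous_intros continuous_on_vector_derivative) blast
  obtain s where s: "s \<in> ?I" "\<And>r. r \<in> ?I \<Longrightarrow> norm (w r) \<le> norm (w s)"
    using continuous_attains_sup[OF _ _ cont] t by auto
  have t0: "t0 \<in> ?I" using assms(1) by auto
  have "norm (w s - w t0) \<le> (B * norm (w s)) * norm (s - t0)"
  proof (rule differentiable_bound[of ?I w "\<lambda>t h. h *\<^sub>R w' t"])
    show "onorm (\<lambda>h. h *\<^sub>R w' r) \<le> B * norm (w s)" if "r \<in> ?I" for r
    proof -
      have "norm (w' r) \<le> B * norm (w s)"
        using b[OF that] mult_left_mono[OF s(2)[OF that] \<open>0 \<le> B\<close>] by linarith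
      then show ?thesis
        by (intro onorm_bound) (auto simp: mult.commute intro: mult_left_mono order_trans[OF norm_ge_zero])
    qed
  qed (use s t0 d in \<open>auto simp: has_vector_derivative_def\<close>)
  also have "\<dots> \<le> (B * norm (w s)) * e"
    using s(1) \<open>0 \<le> B\<close> by (intro mult_left_mono) (auto simp: abs_le_iff)
  also have "\<dots> = (e * B) * norm (w s)" by simp
  also have "\<dots> \<le> (1/2) * norm (w s)" using assms(2) by (intro mult_right_mono) auto
  finally have "norm (w s) \<le> 0" using w0 by simp
  then show ?thesis using s(2)[OF t] by simp
qed

context smooth_surface begin

lemma open_coord_preimage:
  assumes "c \<in> A" "open U"
  shows "open (chart_dom c \<inter> coord c -` U)"
  by (rule continuous_open_preimage[OF continuous_on_coord[OF is_chart_atlas[OF assms(1)]]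
        chart_open_dom[OF is_chart_atlas[OF assms(1)]] assms(2)])

text \<open>The set of times at which the curves agree is closed because the surface is Hausdorff. It is open because
in a chart the vector field extends to a smooth, hence locally Lipschitz field on an open subset of the
plane, also at boundary points.\<close>

lemma integral_curve_unique:
  assumes X: "smooth_vector_field A X"
    and \<gamma>: "integral_curve A UNIV (\<lambda>_. X) \<gamma>" "integral_curve A UNIV (\<lambda>_. X) \<beta>"
    and eq: "\<gamma> s = \<beta> s"
  shows "\<gamma> = \<beta>"
proof -
  have cont: "continuous_on UNIV \<gamma>" "continuous_on UNIV \<beta>" using \<gamma> by (auto simp: integral_curve_def)
  let ?E = "{t. \<gamma> t = \<beta> t}"
  have "closed ?E" using cont by (rule closed_Collect_eq)
  moreover have "open ?E" unfolding open_dist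
  proof (intro ballI)
    fix t0 assume "t0 \<in> ?E"
    then have e0: "\<gamma> t0 = \<beta> t0" by simp
    obtain c where c: "c \<in> A" "\<gamma> t0 \<in> chart_dom c" by (rule ex_chart)
    define z0 where "z0 = coord c (\<gamma> t0)"
    have sm: "smooth_on (chart_img c) (\<lambda>z. X (chart_inv c z) c)"
      using X c by (simp add: smooth_vector_field_def)
    have z0: "z0 \<in> chart_img c" using c by (simp add: z0_def chart_simps)
    obtain U F where U: "open U" "z0 \<in> U" "\<And>k. Ck_on k U F"
      "\<And>z. z \<in> U \<Longrightarrow> z \<in> chart_img c \<Longrightarrow> F z = X (chart_inv c z) c"
      using smooth_onE[OF sm z0] by metis
    obtain r where r: "r > 0" "cball z0 r \<subseteq> U" using U open_contains_cball by blast
    obtain B where B: "0 \<le> B" "\<And>x y. x \<in> cball z0 r \<Longrightarrow> y \<in> cball z0 r \<Longrightarrow> norm (F x - F y) \<le> B * norm (x - y)"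
      by (rule Ck_on_lipschitz[OF U(1,3), of "cball z0 r"]) (use r in auto)
    define N where "N = chart_dom c \<inter> coord c -` ball z0 r"
    have oN: "open N" unfolding N_def by (rule open_coord_preimage[OF c(1) open_ball])
    have "open (\<gamma> -` N \<inter> \<beta> -` N)"
      using open_vimage[OF oN cont(1)] open_vimage[OF oN cont(2)] by blast
    moreover have "t0 \<in> \<gamma> -` N \<inter> \<beta> -` N" using c e0 r by (auto simp: N_def z0_def)
    ultimately obtain e1 where e1: "e1 > 0" "cball t0 e1 \<subseteq> \<gamma> -` N \<inter> \<beta> -` N"
      using open_contains_cball by metis
    \<comment> \<open>so short a time that the Lipschitz constant \<open>B\<close> cannot separate the curves\<close>
    define e where "e = min e1 (1 / (2 * (B + 1)))"
    have e: "0 < e" using e1 B by (simp add: e_def)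
    have eB: "e * B \<le> 1/2"
    proof -
      have "e * B \<le> 1 / (2 * (B + 1)) * (B + 1)" using B e by (intro mult_mono) (auto simp: e_def)
      also have "\<dots> = 1/2" using B(1) by (simp add: field_simps)
      finally show ?thesis .
    qed
    define w where "w t = coord c (\<gamma> t) - coord c (\<beta> t)" for t
    have inN: "\<gamma> t \<in> N" "\<beta> t \<in> N" if "t \<in> {t0 - e..t0 + e}" for t
    proof -
      have "t \<in> cball t0 e1" using that by (auto simp: e_def dist_real_def)
      then show "\<gamma> t \<in> N" "\<beta> t \<in> N" using e1 by auto
    qed
    have der: "((\<lambda>t. coord c (\<alpha> t)) has_vector_derivative F (coord c (\<alpha> t))) (at t within {t0 - e..t0 + e})"
      if "integral_curve A UNIV (\<lambda>_. X) \<alpha>" "\<alpha> t \<in> N" for \<alpha> t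
    proof -
      have a: "\<alpha> t \<in> chart_dom c" "coord c (\<alpha> t) \<in> U" using that r by (auto simp: N_def)
      then have "((coord c \<circ> \<alpha>) has_vector_derivative X (\<alpha> t) c) (at t)"
        using that(1) c(1) by (simp add: integral_curve_def)
      moreover have "F (coord c (\<alpha> t)) = X (\<alpha> t) c" using U(4) a c(1) by (simp add: chart_simps)
      ultimately show ?thesis by (simp add: comp_def has_vector_derivative_at_within)
    qed
    have "w t = 0" if "t \<in> {t0 - e..t0 + e}" for t
    proof (rule zero_of_small_derivative[of e B t0 w "\<lambda>t. F (coord c (\<gamma> t)) - F (coord c (\<beta> t))"])
      fix t assume "t \<in> {t0 - e..t0 + e}"
      note N = inN[OF this]
      show "(w has_vector_derivative F (coord c (\<gamma> t)) - F (coord c (\<beta> t))) (at t within {t0 - e..t0 + e})"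
        unfolding w_def by (intro has_vector_derivative_diff der \<gamma> N)
      show "norm (F (coord c (\<gamma> t)) - F (coord c (\<beta> t))) \<le> B * norm (w t)"
        unfolding w_def using N by (intro B(2)) (auto simp: N_def)
    qed (use e eB B e0 that in \<open>auto simp: w_def\<close>)
    then have "\<gamma> t = \<beta> t" if "t \<in> {t0 - e..t0 + e}" for t
      using inN[OF that] that c(1) unfolding N_def w_def by (metis Int_iff chart_simps(2) eq_iff_diff_eq_0)
    then have "y \<in> ?E" if "dist y t0 < e" for y
      using that by (simp add: dist_real_def abs_less_iff)
    then show "\<exists>e>0. \<forall>y. dist y t0 < e \<longrightarrow> y \<in> ?E" using e by blast
  qed
  moreover have "s \<in> ?E" using eq by simp
  ultimately have "?E = UNIV" using clopen[of ?E] by blast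
  then show ?thesis by auto
qed

text \<open>Both sides are integral curves in \<open>s\<close> with the same value at \<open>s = 0\<close>.\<close>

lemma flow_group_law:
  assumes X: "smooth_vector_field A X" and \<phi>: "flow_on A UNIV (\<lambda>_. X) \<phi>"
  shows "\<phi> s (\<phi> t x) = \<phi> (s + t) x"
proof -
  have ic: "integral_curve A UNIV (\<lambda>_. X) (\<lambda>s. \<phi> s x)" for x using \<phi> by (simp add: flow_on_def)
  have "integral_curve A UNIV (\<lambda>_. X) (\<lambda>s. \<phi> (s + t) x)"
    unfolding integral_curve_def
  proof (intro conjI ballI impI)
    have "continuous_on UNIV (\<lambda>s. \<phi> s x)" using ic by (simp add: integral_curve_def)
    then show "continuous_on UNIV (\<lambda>s. \<phi> (s + t) x)"
      by (rule continuous_on_compose2) (auto intro!: continuous_intros)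
    fix s c assume c: "c \<in> A" "\<phi> (s + t) x \<in> chart_dom c"
    then have "((coord c \<circ> (\<lambda>s. \<phi> s x)) has_vector_derivative X (\<phi> (s + t) x) c) (at (s + t))"
      using ic by (simp add: integral_curve_def)
    then have "(((coord c \<circ> (\<lambda>s. \<phi> s x)) \<circ> (\<lambda>s. s + t)) has_vector_derivative 1 *\<^sub>R X (\<phi> (s + t) x) c) (at s)"
      by (intro vector_diff_chain_at) (auto intro!: derivative_eq_intros)
    then show "((coord c \<circ> (\<lambda>s. \<phi> (s + t) x)) has_vector_derivative X (\<phi> (s + t) x) c) (at s)"
      by (simp add: comp_def)
  qed
  then have "(\<lambda>s. \<phi> s (\<phi> t x)) = (\<lambda>s. \<phi> (s + t) x)"
    by (intro integral_curve_unique[OF X ic, where s=0]) (use \<phi> in \<open>auto simp: flow_on_def\<close>)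
  then show ?thesis by metis
qed

section \<open>Comparison of the Riemannian distance with coordinates\<close>

text \<open>The components of the velocity are derivatives within a thick set of times, to which the calculus of
smooth functions on such sets applies.\<close>

lemma smooth_curve_velocity:
  assumes \<gamma>: "smooth_curve A \<gamma>" and c: "c \<in> A" and t: "t \<in> {0..1}" "\<gamma> t \<in> chart_dom c"
  defines "S \<equiv> {t \<in> {0..1}. \<gamma> t \<in> chart_dom c}"
  shows "at t within S = at t within {0..1}"
    and "velocity A \<gamma> t c = frechet_derivative (coord c \<circ> \<gamma>) (at t within S) 1"
    and "((coord c \<circ> \<gamma>) has_vector_derivative velocity A \<gamma> t c) (at t within {0..1})"
    and "thick S"
proof -
  have "openin (top_of_set {0..1}) ({0..1} \<inter> \<gamma> -` chart_dom c)"
    using \<gamma> chart_open_dom[OF is_chart_atlas[OF c]] unfolding smooth_curve_def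
    by (intro continuous_openin_preimage_gen) auto
  moreover have "S = {0..1} \<inter> \<gamma> -` chart_dom c" unfolding S_def by blast
  ultimately have op: "openin (top_of_set {0..1}) S" by (simp only:)
  then obtain W where W: "open W" "S = {0..1} \<inter> W" by (auto simp: openin_open)
  have tS: "t \<in> S" using t by (simp add: S_def)
  show at: "at t within S = at t within {0..1}" using at_within_rel_open[OF W(1) _ W(2)] W(2) tS by blast
  show th: "thick S" by (rule thick_openin[OF thick_interval op])
  let ?D = "frechet_derivative (coord c \<circ> \<gamma>) (at t within S)"
  have d: "((coord c \<circ> \<gamma>) has_derivative ?D) (at t within S)"
    using smooth_on_has_derivative[OF th _ tS, where f="coord c \<circ> \<gamma>"] \<gamma> c by (simp add: smooth_curve_def S_def)
  then interpret bounded_linear ?D by (rule has_derivative_bounded_linear)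
  have "?D h = h *\<^sub>R ?D 1" for h using scale[of h 1] by simp
  then have "?D = (\<lambda>h. h *\<^sub>R ?D 1)" by (rule ext)
  then have vd: "((coord c \<circ> \<gamma>) has_vector_derivative ?D 1) (at t within {0..1})"
    unfolding has_vector_derivative_def using d unfolding at by (simp only:)
  then have "vector_derivative (coord c \<circ> \<gamma>) (at t within {0..1}) = ?D 1"
    using vector_derivative_within_cbox[of 0 1 t] t by simp
  then show v: "velocity A \<gamma> t c = ?D 1" using c t by (simp add: velocity_def)
  show "((coord c \<circ> \<gamma>) has_vector_derivative velocity A \<gamma> t c) (at t within {0..1})"
    using vd v by simp
qed

lemma velocity_in_tangent_space:
  assumes \<gamma>: "smooth_curve A \<gamma>" and t: "t \<in> {0..1}"
  shows "velocity A \<gamma> t \<in> tangent_space A (\<gamma> t)"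
proof -
  have "velocity A \<gamma> t d = transition_deriv c d (\<gamma> t) (velocity A \<gamma> t c)"
    if c: "c \<in> A" "\<gamma> t \<in> chart_dom c" and d: "d \<in> A" "\<gamma> t \<in> chart_dom d" for c d
  proof -
    define W where "W = chart_dom c \<inter> chart_dom d"
    have "open W" unfolding W_def using chart_open_dom is_chart_atlas c d by blast
    then have "openin (top_of_set {0..1}) ({0..1} \<inter> \<gamma> -` W)"
      using \<gamma> unfolding smooth_curve_def by (intro continuous_openin_preimage_gen) auto
    moreover define S where "S = {0..1} \<inter> \<gamma> -` W"
    ultimately have th: "thick S" using thick_openin[OF thick_interval] by simp
    have tS: "t \<in> S" using c d t by (simp add: S_def W_def)
    have sub: "S \<subseteq> {0..1}" by (simp add: S_def)
    have dc: "((coord c \<circ> \<gamma>) has_derivative (\<lambda>h. h *\<^sub>R velocity A \<gamma> t c)) (at t within S)"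
      and dd: "((coord d \<circ> \<gamma>) has_derivative (\<lambda>h. h *\<^sub>R velocity A \<gamma> t d)) (at t within S)"
      using smooth_curve_velocity(3)[OF \<gamma> _ t] c d has_derivative_subset[OF _ sub] unfolding has_vector_derivative_def by blast+
    have "(coord c \<circ> \<gamma>) ` S \<subseteq> overlap c d" by (auto simp: S_def W_def overlap_def)
    then have "(transition c d has_derivative transition_deriv c d (\<gamma> t)) (at ((coord c \<circ> \<gamma>) t) within (coord c \<circ> \<gamma>) ` S)"
      using has_derivative_subset has_derivative_transition[OF c(1) d(1) c(2) d(2)] by (metis comp_apply)
    from diff_chain_within[OF dc this]
    have "((coord d \<circ> \<gamma>) has_derivative (transition_deriv c d (\<gamma> t) \<circ> (\<lambda>h. h *\<^sub>R velocity A \<gamma> t c))) (at t within S)"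
      by (rule has_derivative_transform[OF tS, rotated]) (use c in \<open>auto simp: transition_coord S_def W_def\<close>)
    from thick_derivative_unique[OF th tS dd this] have "1 *\<^sub>R velocity A \<gamma> t d = (transition_deriv c d (\<gamma> t) \<circ> (\<lambda>h. h *\<^sub>R velocity A \<gamma> t c)) 1"
      by (rule fun_cong)
    then show ?thesis by simp
  qed
  moreover have "velocity A \<gamma> t c = 0" if "\<not> (c \<in> A \<and> \<gamma> t \<in> chart_dom c)" for c
    unfolding velocity_def using that by (rule if_not_P)
  ultimately show ?thesis unfolding tangent_space_def by blast
qed

text \<open>Continuity ensures that the integral in \<open>curve_length\<close> is a genuine one; for a non-integrable function it
would have the default value \<open>0\<close>, and a lower bound for lengths could not hold.\<close>

lemma continuous_on_speed:
  assumes \<gamma>: "smooth_curve A \<gamma>" and \<rho>: "smooth_tensor2 A \<rho>"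
  shows "continuous_on {0..1} (\<lambda>t. sqrt (\<rho> (\<gamma> t) (velocity A \<gamma> t) (velocity A \<gamma> t)))"
proof -
  have "continuous (at t within {0..1}) (\<lambda>t. \<rho> (\<gamma> t) (velocity A \<gamma> t) (velocity A \<gamma> t))" if t: "t \<in> {0..1}" for t
  proof -
    obtain c where c: "c \<in> A" "\<gamma> t \<in> chart_dom c" by (rule ex_chart)
    define S where "S = {t \<in> {0..1}. \<gamma> t \<in> chart_dom c}"
    have tS: "t \<in> S" using t c by (simp add: S_def)
    note v = smooth_curve_velocity[OF \<gamma> c(1), folded S_def]
    have th: "thick S" by (rule v(4)[OF t c(2)])
    have sm: "smooth_on S (coord c \<circ> \<gamma>)" using \<gamma> c(1) by (simp add: smooth_curve_def S_def)
    have cfd: "continuous_on S (\<lambda>t. frechet_derivative (coord c \<circ> \<gamma>) (at t within S) 1)"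
      by (intro smooth_on_imp_continuous_on smooth_on_derivative th sm)
    have cv: "continuous_on S (\<lambda>t. velocity A \<gamma> t c)"
      by (rule continuous_on_eq[OF cfd]) (use v(2) in \<open>auto simp: S_def\<close>)
    have "continuous_on S (coord c \<circ> \<gamma>)" using sm by (rule smooth_on_imp_continuous_on)
    then have ct: "continuous_on S (\<lambda>t. tensor_coeff \<rho> c p q (coord c (\<gamma> t)))" for p q
      using continuous_on_compose2[OF smooth_on_imp_continuous_on[OF smooth_tensor_coeff[OF \<rho> c(1), of p q]], of S "coord c \<circ> \<gamma>"]
        c(1) by (auto simp: S_def chart_simps image_subset_iff)
    have "\<rho> (\<gamma> t) (velocity A \<gamma> t) (velocity A \<gamma> t) = 
       fst (velocity A \<gamma> t c) * (fst (velocity A \<gamma> t c) * tensor_coeff \<rho> c (1,0) (1,0) (coord c (\<gamma> t)) + snd (velocity A \<gamma> t c) * tensor_coeff \<rho> c (1,0) (0,1) (coord c (\<gamma> t))) +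
       snd (velocity A \<gamma> t c) * (fst (velocity A \<gamma> t c) * tensor_coeff \<rho> c (0,1) (1,0) (coord c (\<gamma> t)) + snd (velocity A \<gamma> t c) * tensor_coeff \<rho> c (0,1) (0,1) (coord c (\<gamma> t)))"
      if "t \<in> S" for t
    proof -
      have t01: "t \<in> {0..1}" "\<gamma> t \<in> chart_dom c" using that by (auto simp: S_def)
      note V = velocity_in_tangent_space[OF \<gamma> t01(1)]
      show ?thesis
        unfolding tensor_coeff_eq[OF c(1) t01(2) V V]
        by (rule tensor_coeff_bilinear[OF \<rho> c(1)]) (use c(1) t01 in \<open>simp add: chart_simps\<close>)
    qed
    note eq = this
    have "continuous_on S (\<lambda>t. 
       fst (velocity A \<gamma> t c) * (fst (velocity A \<gamma> t c) * tensor_coeff \<rho> c (1,0) (1,0) (coord c (\<gamma> t)) + snd (velocity A \<gamma> t c) * tensor_coeff \<rho> c (1,0) (0,1) (coord c (\<gamma> t))) +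
       snd (velocity A \<gamma> t c) * (fst (velocity A \<gamma> t c) * tensor_coeff \<rho> c (0,1) (1,0) (coord c (\<gamma> t)) + snd (velocity A \<gamma> t c) * tensor_coeff \<rho> c (0,1) (0,1) (coord c (\<gamma> t))))"
      by (intro continuous_intros cv ct)
    then have "continuous_on S (\<lambda>t. \<rho> (\<gamma> t) (velocity A \<gamma> t) (velocity A \<gamma> t))"
      by (rule continuous_on_eq) (rule eq[symmetric])
    then have "continuous (at t within S) (\<lambda>t. \<rho> (\<gamma> t) (velocity A \<gamma> t) (velocity A \<gamma> t))"
      using tS continuous_on_eq_continuous_within by blast
    then show ?thesis using v(1)[OF t c(2)] by simp
  qed
  then show ?thesis by (intro continuous_on_real_sqrt) (simp add: continuous_on_eq_continuous_within)
qed

text \<open>The quadratic form is continuous and positive on the compact set of unit vectors over \<open>K\<close>.\<close>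

lemma metric_lower_bound:
  assumes \<rho>: "riemannian_metric A \<rho>" and c: "c \<in> A" and K: "compact K" "K \<subseteq> chart_img c"
  obtains m where "0 < m" "\<And>z p. z \<in> K \<Longrightarrow> m * norm p \<le> sqrt (tensor_coeff \<rho> c p p z)"
proof (cases "K = {}")
  case True
  show thesis by (rule that[of 1]) (use True in auto)
next
  case False
  have t: "smooth_tensor2 A \<rho>" using \<rho> by (simp add: riemannian_metric_def)
  define Q where "Q z p = fst p * (fst p * tensor_coeff \<rho> c (1,0) (1,0) z + snd p * tensor_coeff \<rho> c (1,0) (0,1) z) +
    snd p * (fst p * tensor_coeff \<rho> c (0,1) (1,0) z + snd p * tensor_coeff \<rho> c (0,1) (0,1) z)" for z and p :: plane
  have Q: "tensor_coeff \<rho> c p p z = Q z p" if "z \<in> K" for z p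
    unfolding Q_def using tensor_coeff_bilinear[OF t c] that K by blast
  have pos: "0 < Q z p" if "z \<in> K" "p \<noteq> 0" for z p
  proof -
    let ?x = "chart_inv c z"
    have x: "?x \<in> chart_dom c" using that K c by (auto simp: chart_simps)
    have "tangent_of A c ?x p \<noteq> (\<lambda>d. 0)" using tangent_of_component[OF c x, of p] that(2) by auto
    then have "0 < tensor_coeff \<rho> c p p z"
      unfolding tensor_coeff_def using \<rho> tangent_of_in_tangent_space[OF c x] by (simp add: riemannian_metric_def)
    then show ?thesis using Q that by simp
  qed
  have ct: "continuous_on (K \<times> sphere 0 1) (\<lambda>y. tensor_coeff \<rho> c p q (fst y))" for p q
    by (rule continuous_on_compose2[OF smooth_on_imp_continuous_on[OF smooth_tensor_coeff[OF t c]]])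
      (use K in \<open>auto intro!: continuous_intros\<close>)
  have cts: "continuous_on (K \<times> sphere (0::plane) 1) (\<lambda>y. Q (fst y) (snd y))"
    unfolding Q_def by (intro continuous_intros ct)
  have cpt: "compact (K \<times> sphere (0::plane) 1)" using K by (intro compact_Times) auto
  have ne: "K \<times> sphere (0::plane) 1 \<noteq> {}"
  proof -
    have "(1,0) \<in> sphere (0::plane) 1" by (simp add: norm_Pair)
    then show ?thesis using False by blast
  qed
  obtain y where y: "y \<in> K \<times> sphere (0::plane) 1"
      and "\<forall>y'\<in>K \<times> sphere (0::plane) 1. Q (fst y) (snd y) \<le> Q (fst y') (snd y')"
    using continuous_attains_inf[OF cpt ne cts] by blast
  then have y2: "Q (fst y) (snd y) \<le> Q z p" if "z \<in> K" "norm p = 1" for z p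
    using that by (auto dest!: bspec[of _ _ "(z, p)"])
  define M where "M = Q (fst y) (snd y)"
  have M: "0 < M" unfolding M_def using y by (intro pos) auto
  show thesis
  proof (rule that[of "sqrt M"])
    fix z p assume z: "z \<in> K"
    have hom: "Q z (a *\<^sub>R p) = a\<^sup>2 * Q z p" for a p by (simp add: Q_def power2_eq_square algebra_simps)
    have "M * (norm p)\<^sup>2 \<le> Q z p"
    proof (cases "p = 0")
      case False
      have "M \<le> Q z ((1 / norm p) *\<^sub>R p)" unfolding M_def using False z by (intro y2) auto
      then show ?thesis unfolding hom using False by (simp add: field_simps power2_eq_square)
    qed (simp add: Q_def)
    then have "sqrt (M * (norm p)\<^sup>2) \<le> sqrt (Q z p)" by (rule real_sqrt_le_mono)
    then show "sqrt M * norm p \<le> sqrt (tensor_coeff \<rho> c p p z)" using Q[OF z] by (simp add: real_sqrt_mult)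
  qed (use M in simp)
qed

text \<open>Up to the first exit from the open ball the curve lies in the chart. It does so also at the exit time,
since the compact closed ball is closed in the Hausdorff surface, and there its coordinates have moved by
exactly \<open>r\<close>.\<close>

lemma curve_length_escape:
  assumes \<rho>: "riemannian_metric A \<rho>" and c: "c \<in> A" and r: "0 < r" "cball z0 r \<subseteq> chart_img c"
    and m: "0 < m" "\<And>z p. z \<in> cball z0 r \<Longrightarrow> m * norm p \<le> sqrt (tensor_coeff \<rho> c p p z)"
    and \<gamma>: "smooth_curve A \<gamma>" "\<gamma> 0 \<in> chart_dom c" "coord c (\<gamma> 0) = z0"
    and out: "\<not> (\<gamma> 1 \<in> chart_dom c \<and> coord c (\<gamma> 1) \<in> ball z0 r)"
  shows "m * r \<le> curve_length A \<rho> \<gamma>"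
proof -
  define B where "B = chart_dom c \<inter> coord c -` ball z0 r"
  define C where "C = chart_inv c ` cball z0 r"
  have oB: "open B" unfolding B_def by (rule open_coord_preimage[OF c open_ball])
  have "compact C" unfolding C_def
    using continuous_on_subset[OF continuous_on_chart_inv[OF is_chart_atlas[OF c]] r(2)] by (intro compact_continuous_image) auto
  then have cC: "closed C" by (rule compact_imp_closed)
  have BC: "B \<subseteq> C"
  proof
    fix x assume "x \<in> B"
    then have "x = chart_inv c (coord c x)" "coord c x \<in> cball z0 r" using c by (auto simp: B_def chart_simps)
    then show "x \<in> C" unfolding C_def by blast
  qed
  have C: "x \<in> chart_dom c \<and> coord c x \<in> cball z0 r" if "x \<in> C" for x
    using that c r(2) unfolding C_def by (auto simp: chart_simps subset_iff)
  have cont: "continuous_on {0..1} \<gamma>" using \<gamma>(1) by (simp add: smooth_curve_def)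
  define T where "T = {0..1} \<inter> \<gamma> -` (- B)"
  have "closed T" unfolding T_def using cont oB by (intro continuous_closed_preimage) auto
  moreover have "bounded T" unfolding T_def by (rule bounded_subset[OF bounded_closed_interval]) auto
  ultimately have cT: "compact T" by (simp add: compact_eq_bounded_closed)
  have "1 \<in> T" using out by (auto simp: T_def B_def)
  then obtain \<tau> where \<tau>: "\<tau> \<in> T" "\<And>t. t \<in> T \<Longrightarrow> \<tau> \<le> t"
    using compact_attains_inf[OF cT] by blast
  have "0 \<notin> T" using \<gamma> r by (auto simp: T_def B_def)
  then have \<tau>01: "0 < \<tau>" "\<tau> \<le> 1" using \<tau>(1) by (auto simp: T_def intro: order_le_neq_trans)
  have inB: "\<gamma> t \<in> B" if "0 \<le> t" "t < \<tau>" for t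
    using \<tau>(2)[of t] that \<tau>01 by (auto simp: T_def)
  have "closed ({0..1} \<inter> \<gamma> -` C)" using cont cC by (intro continuous_closed_preimage) auto
  moreover have "{0<..<\<tau>} \<subseteq> {0..1} \<inter> \<gamma> -` C"
  proof
    fix t assume t: "t \<in> {0<..<\<tau>}"
    then have "\<gamma> t \<in> C" using inB[of t] BC by auto
    then show "t \<in> {0..1} \<inter> \<gamma> -` C" using t \<tau>01 by auto
  qed
  ultimately have "closure {0<..<\<tau>} \<subseteq> {0..1} \<inter> \<gamma> -` C" by (rule closure_minimal[rotated])
  then have inC: "\<gamma> t \<in> C" if "t \<in> {0..\<tau>}" for t using that \<tau>01 by auto
  have "coord c (\<gamma> \<tau>) \<notin> ball z0 r" using \<tau>(1) C[OF inC[of \<tau>]] \<tau>01 by (auto simp: T_def B_def)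
  then have far: "r \<le> norm (coord c (\<gamma> \<tau>) - coord c (\<gamma> 0))" using \<gamma>(3) by (simp add: dist_norm norm_minus_commute)
  define sp where "sp t = sqrt (\<rho> (\<gamma> t) (velocity A \<gamma> t) (velocity A \<gamma> t))" for t
  have contsp: "continuous_on {0..1} sp"
    unfolding sp_def using continuous_on_speed[OF \<gamma>(1)] \<rho> by (simp add: riemannian_metric_def)
  have sub: "{0..\<tau>} \<subseteq> {0..1}" using \<tau>01 by auto
  have isp: "sp integrable_on {0..1}" "sp integrable_on {0..\<tau>}"
    using contsp continuous_on_subset[OF contsp sub] by (auto intro: integrable_continuous_interval)
  have hi: "((\<lambda>t. velocity A \<gamma> t c) has_integral ((coord c \<circ> \<gamma>) \<tau> - (coord c \<circ> \<gamma>) 0)) {0..\<tau>}"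
  proof (rule fundamental_theorem_of_calculus)
    fix t assume t: "t \<in> {0..\<tau>}"
    then show "((coord c \<circ> \<gamma>) has_vector_derivative velocity A \<gamma> t c) (at t within {0..\<tau>})"
      using smooth_curve_velocity(3)[OF \<gamma>(1) c, of t] C[OF inC[OF t]] sub has_vector_derivative_within_subset[OF _ sub] by auto
  qed (use \<tau>01 in simp)
  have i1: "(\<lambda>t. velocity A \<gamma> t c) integrable_on {0..\<tau>}" using hi by (rule has_integral_integrable)
  have i2: "(\<lambda>t. (1/m) * sp t) integrable_on {0..\<tau>}" by (rule integrable_on_mult_right[OF isp(2)])
  have "norm (integral {0..\<tau>} (\<lambda>t. velocity A \<gamma> t c)) \<le> integral {0..\<tau>} (\<lambda>t. (1/m) * sp t)"
  proof (rule Henstock_Kurzweil_Integration.integral_norm_bound_integral[OF i1 i2])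
    fix t assume t: "t \<in> {0..\<tau>}"
    then have t1: "t \<in> {0..1}" using sub by auto
    note x = C[OF inC[OF t]] and v = velocity_in_tangent_space[OF \<gamma>(1) t1]
    have "m * norm (velocity A \<gamma> t c) \<le> sp t"
      unfolding sp_def tensor_coeff_eq[OF c conjunct1[OF x] v v] by (rule m(2)[OF conjunct2[OF x]])
    then show "norm (velocity A \<gamma> t c) \<le> (1/m) * sp t" using m(1) by (simp add: field_simps)
  qed
  then have "r \<le> (1/m) * integral {0..\<tau>} sp"
    using far integral_unique[OF hi] by simp
  also have "integral {0..\<tau>} sp \<le> integral {0..1} sp"
  proof (rule integral_subset_le[OF sub isp(2,1)], rule ballI)
    fix t :: real assume t: "t \<in> {0..1}"
    have "0 \<le> \<rho> x u u" if "u \<in> tangent_space A x" for x u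
    proof (cases "u = (\<lambda>c. 0)")
      case True
      obtain d where d: "d \<in> A" "x \<in> chart_dom d" by (rule ex_chart)
      have "tensor_coeff \<rho> d 0 0 (coord d x) = 0"
        using tensor_coeff_bilinear[of \<rho> d "coord d x" 0 0] \<rho> d by (simp add: riemannian_metric_def chart_simps)
      then show ?thesis using tensor_coeff_eq[OF d that that, of \<rho>] True by simp
    next
      case False
      then show ?thesis using \<rho> that by (auto simp: riemannian_metric_def intro: less_imp_le)
    qed
    then show "0 \<le> sp t" unfolding sp_def using velocity_in_tangent_space[OF \<gamma>(1) t] by simp
  qed
  finally have "r \<le> (1/m) * integral {0..1} sp" using m(1) by (simp add: divide_right_mono)
  then show ?thesis using m(1) unfolding curve_length_def sp_def by (simp add: field_simps)
qed

text \<open>A curve that leaves the coordinate ball of radius \<open>r\<close> about its initial point is at least \<open>m r\<close> long,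
with one constant \<open>m\<close> for all initial points over the compact set \<open>K\<close>.\<close>

lemma riemannian_dist_coordinates:
  assumes \<rho>: "riemannian_metric A \<rho>" and c: "c \<in> A" and V: "open V" "V \<subseteq> chart_img c"
    and K: "compact K" "K \<subseteq> V" and \<delta>: "0 < \<delta>"
  obtains \<epsilon> :: real where "0 < \<epsilon>" 
    "\<And>x y. x \<in> chart_dom c \<Longrightarrow> coord c x \<in> K \<Longrightarrow> riemannian_dist A \<rho> x y < ereal \<epsilon> \<Longrightarrow>
        y \<in> chart_dom c \<and> coord c y \<in> V \<and> dist (coord c x) (coord c y) < \<delta>"
proof -
  obtain e where e: "e > 0" "(\<Union>z\<in>K. cball z e) \<subseteq> V" by (rule compact_subset_open_imp_cball_epsilon_subset[OF K(1) V(1) K(2)])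
  define r where "r = min e \<delta>"
  have r: "0 < r" "r \<le> \<delta>" "r \<le> e" using e \<delta> by (auto simp: r_def)
  have sub: "(\<Union>z\<in>K. cball z r) \<subseteq> V" using e(2) r(3) by (meson UN_mono order_refl order_trans subset_cball)
  obtain m where m: "0 < m" "\<And>z p. z \<in> (\<Union>z\<in>K. cball z r) \<Longrightarrow> m * norm p \<le> sqrt (tensor_coeff \<rho> c p p z)"
    by (rule metric_lower_bound[OF \<rho> c compact_minkowski_sum_cball[OF K(1)], of r]) (use sub V in auto)
  show thesis
  proof (rule that[of "m * r"])
    fix x y assume x: "x \<in> chart_dom c" "coord c x \<in> K" and d: "riemannian_dist A \<rho> x y < ereal (m * r)"
    obtain \<gamma> where \<gamma>: "smooth_curve A \<gamma>" "\<gamma> 0 = x" "\<gamma> 1 = y" "curve_length A \<rho> \<gamma> < m * r"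
      using d unfolding riemannian_dist_def INF_less_iff by auto
    have sub': "cball (coord c x) r \<subseteq> V" using sub x by blast
    have "y \<in> chart_dom c \<and> coord c y \<in> ball (coord c x) r"
    proof (rule ccontr)
      assume "\<not> ?thesis"
      moreover have "m * norm p \<le> sqrt (tensor_coeff \<rho> c p p z)" if "z \<in> cball (coord c x) r" for z p
        using that x(2) by (intro m(2)) blast
      moreover have "cball (coord c x) r \<subseteq> chart_img c" using sub' V(2) by blast
      ultimately have "m * r \<le> curve_length A \<rho> \<gamma>"
        using x(1) \<gamma>(1-3) by (intro curve_length_escape[OF \<rho> c r(1) _ m(1), of "coord c x"]) simp_all
      then show False using \<gamma>(4) by simp
    qed
    then show "y \<in> chart_dom c \<and> coord c y \<in> V \<and> dist (coord c x) (coord c y) < \<delta>"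
      using r subsetD[OF sub', of "coord c y"] by auto
  qed (use m r in simp)
qed

end

section \<open>Darboux coordinates\<close>

definition vertical_integral :: "real \<Rightarrow> (plane \<Rightarrow> real) \<Rightarrow> plane \<Rightarrow> real" where
  "vertical_integral b h = (\<lambda>(x, y). integral {b..y} (\<lambda>s. h (x, s)))"

text \<open>The horizontal derivative is again a vertical integral, of the horizontal derivative of \<open>h\<close>, and the
vertical derivative is \<open>h\<close>. In this form the statement can be iterated and gives smoothness.\<close>

lemma vertical_integral_has_derivative:
  assumes O: "open U" "Ck_on (Suc 0) U h" and sub: "{a1<..<a2} \<times> {b1..b2} \<subseteq> U"
    and z: "z \<in> {a1<..<a2} \<times> {b1<..<b2}"
  shows "(vertical_integral b1 h has_derivative
    (\<lambda>v. fst v * vertical_integral b1 (\<lambda>p. frechet_derivative h (at p) (1, 0)) z + snd v * h z)) (at z)"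
proof -
  obtain x y where xy: "z = (x, y)" "x \<in> {a1<..<a2}" "y \<in> {b1<..<b2}" using z by auto
  have ch: "continuous_on U h" using Ck_on_Suc_imp[OF O] by simp
  have cD: "continuous_on U (\<lambda>p. frechet_derivative h (at p) (1, 0))" using O(2) by simp
  have dh: "(h has_derivative frechet_derivative h (at p)) (at p)" if "p \<in> U" for p
    by (rule Ck_on_has_derivative[OF O that])
  have cs: "continuous_on {b1..b2} (\<lambda>s. h (x, s))" if "x \<in> {a1<..<a2}" for x
    by (rule continuous_on_compose2[OF ch]) (use sub that in \<open>auto intro!: continuous_intros\<close>)
  have fx: "((\<lambda>x. integral (cbox b1 y) (\<lambda>s. h (x, s))) has_field_derivative
      integral (cbox b1 y) (\<lambda>s. frechet_derivative h (at (x, s)) (1, 0))) (at x within {a1<..<a2})"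
  proof (rule leibniz_rule_field_derivative[where f="\<lambda>x s. h (x, s)" and fx="\<lambda>x s. frechet_derivative h (at (x, s)) (1, 0)"])
    fix x' s assume "x' \<in> {a1<..<a2}" "s \<in> cbox b1 y"
    then have p: "(x', s) \<in> U" using sub xy by auto
    then interpret D: bounded_linear "frechet_derivative h (at (x', s))"
      using dh has_derivative_bounded_linear by blast
    have "((\<lambda>x. (x, s)) has_derivative (\<lambda>v. (v, 0))) (at x')"
      by (auto intro!: derivative_eq_intros)
    from diff_chain_at[OF this dh[OF p]]
    have "((\<lambda>x. h (x, s)) has_derivative (\<lambda>v. frechet_derivative h (at (x', s)) (v, 0))) (at x')"
      by (simp add: comp_def)
    moreover have "frechet_derivative h (at (x', s)) (v, 0) = frechet_derivative h (at (x', s)) (1, 0) * v" for v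
      using D.scale[of v "(1, 0)"] by simp
    then have "(\<lambda>v. frechet_derivative h (at (x', s)) (v, 0)) = (*) (frechet_derivative h (at (x', s)) (1, 0))"
      by (rule ext)
    ultimately have "((\<lambda>x. h (x, s)) has_field_derivative frechet_derivative h (at (x', s)) (1, 0)) (at x')"
      unfolding has_field_derivative_def by (simp only:)
    then show "((\<lambda>x. h (x, s)) has_field_derivative frechet_derivative h (at (x', s)) (1, 0)) (at x' within {a1<..<a2})"
      by (rule has_field_derivative_at_within)
  next
    fix x' assume "x' \<in> {a1<..<a2}"
    from continuous_on_subset[OF cs[OF this], of "{b1..y}"]
    show "(\<lambda>s. h (x', s)) integrable_on cbox b1 y"
      using xy by (auto intro: integrable_continuous_interval)
  next
    have "continuous_on ({a1<..<a2} \<times> cbox b1 y) (\<lambda>p. frechet_derivative h (at p) (1, 0))"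
      by (rule continuous_on_subset[OF cD]) (use sub xy in auto)
    then show "continuous_on ({a1<..<a2} \<times> cbox b1 y) (\<lambda>(x, s). frechet_derivative h (at (x, s)) (1, 0))"
      by (simp add: case_prod_beta)
  qed (use xy in auto)
  have "((\<lambda>(x, y). integral {b1..y} (\<lambda>s. h (x, s))) has_derivative
     (\<lambda>(tx, ty). integral {b1..y} (\<lambda>s. frechet_derivative h (at (x, s)) (1, 0)) * tx + blinfun_apply (blinfun_mult_right (h (x, y))) ty))
     (at (x, y) within {a1<..<a2} \<times> {b1<..<b2})"
  proof (rule has_derivative_partialsI)
    show "((\<lambda>x. integral {b1..y} (\<lambda>s. h (x, s))) has_derivative
        (*) (integral {b1..y} (\<lambda>s. frechet_derivative h (at (x, s)) (1, 0)))) (at x within {a1<..<a2})"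
      using fx by (simp add: has_field_derivative_def)
  next
    fix x' y' assume a: "x' \<in> {a1<..<a2}" "y' \<in> {b1<..<b2}"
    have "((\<lambda>y. integral {b1..y} (\<lambda>s. h (x', s))) has_real_derivative h (x', y')) (at y' within {b1..b2})"
      using integral_has_real_derivative[OF cs[OF a(1)]] a by auto
    then have "((\<lambda>y. integral {b1..y} (\<lambda>s. h (x', s))) has_real_derivative h (x', y')) (at y' within {b1<..<b2})"
      by (rule has_field_derivative_subset) auto
    then show "((\<lambda>y. integral {b1..y} (\<lambda>s. h (x', s))) has_derivative
        blinfun_apply (blinfun_mult_right (h (x', y')))) (at y' within {b1<..<b2})"
      by (simp add: has_field_derivative_def)
  next
    have "continuous_on ({a1<..<a2} \<times> {b1<..<b2}) (\<lambda>p. blinfun_mult_right (h p))"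
      by (intro bounded_linear.continuous_on[OF bounded_linear_blinfun_mult_right] continuous_on_subset[OF ch]) (use sub in auto)
    moreover have "(\<lambda>(x, y). blinfun_mult_right (h (x, y))) = (\<lambda>p. blinfun_mult_right (h p))"
      by (auto simp: fun_eq_iff)
    ultimately show "continuous (at (x, y) within {a1<..<a2} \<times> {b1<..<b2}) (\<lambda>(x, y). blinfun_mult_right (h (x, y)))"
      using xy by (simp add: continuous_on_eq_continuous_within)
  qed (use xy in auto)
  moreover have "open ({a1<..<a2} \<times> {b1<..<b2})" by (intro open_Times) auto
  ultimately have "((\<lambda>(x, y). integral {b1..y} (\<lambda>s. h (x, s))) has_derivative
     (\<lambda>(tx, ty). integral {b1..y} (\<lambda>s. frechet_derivative h (at (x, s)) (1, 0)) * tx + h (x, y) * ty)) (at (x, y))"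
    using xy by (simp add: at_within_open_NO_MATCH)
  then show ?thesis unfolding vertical_integral_def xy(1)
    by (rule has_derivative_eq_rhs) (auto simp: fun_eq_iff)
qed

lemma Ck_on_vertical_integral:
  assumes O: "open U" "\<And>k. Ck_on k U h" and sub: "{a1<..<a2} \<times> {b1..b2} \<subseteq> U"
  shows "Ck_on k ({a1<..<a2} \<times> {b1<..<b2}) (vertical_integral b1 h)"
  using O(2)
proof (induction k arbitrary: h)
  case 0
  show ?case unfolding Ck_on.simps
    using vertical_integral_has_derivative[OF O(1) 0 sub] has_derivative_continuous
    by (intro continuous_at_imp_continuous_on ballI) blast
next
  case (Suc k)
  let ?V = "{a1<..<a2} \<times> {b1<..<b2}"
  let ?h' = "\<lambda>p. frechet_derivative h (at p) (1, 0)"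
  have V: "open ?V" by (intro open_Times) auto
  have VU: "?V \<subseteq> U" using sub by auto
  have h': "Ck_on k U ?h'" for k using Suc.prems[of "Suc k"] by simp
  have "Ck_on k ?V (\<lambda>z. fst v * vertical_integral b1 ?h' z + snd v * h z)" for v :: plane
    by (intro Ck_on_add Ck_on_mult Ck_on_const V Suc.IH[OF h'] Ck_on_subset[OF O(1) V VU Suc.prems])
  then show ?case unfolding Ck_on_Suc_iff[OF V]
    using vertical_integral_has_derivative[OF O(1) Suc.prems sub]
    by (intro exI[of _ "\<lambda>z v. fst v * vertical_integral b1 ?h' z + snd v * h z"]) simp
qed

text \<open>The map \<open>(x, y) \<mapsto> (x, F (x, y))\<close>, where \<open>F\<close> is the integral of \<open>f\<close> along the vertical segment below
\<open>(x, y)\<close>, has the Jacobian determinant \<open>f\<close>. By the mean value theorem it is injective on a box, as \<open>f\<close> has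
no zeros, and by invariance of domain its image is open. A dilation makes the image contain the disc of
radius \<open>4\<close>, at the price of the constant \<open>\<kappa>\<close>.\<close>

lemma darboux_chart:
  fixes f :: "plane \<Rightarrow> real"
  assumes U: "open U" "z0 \<in> U" and f: "\<And>k. Ck_on k U f" "\<And>z. z \<in> U \<Longrightarrow> f z \<noteq> 0"
  obtains V and \<Psi> :: "plane \<Rightarrow> complex" and \<Psi>' and \<kappa> :: real where
    "open V" "V \<subseteq> U" "\<And>k. Ck_on k V \<Psi>" "homeomorphism V (\<Psi> ` V) \<Psi> \<Psi>'" "open (\<Psi> ` V)" "cball 0 4 \<subseteq> \<Psi> ` V"
    "\<And>z p q. z \<in> V \<Longrightarrow> f z * det2 p q =
       \<kappa> * Im (cnj (frechet_derivative \<Psi> (at z) p) * frechet_derivative \<Psi> (at z) q)"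
proof -
  obtain x0 y0 where z0: "z0 = (x0, y0)" by fastforce
  obtain X Y where XY: "open X" "open Y" "z0 \<in> X \<times> Y" "X \<times> Y \<subseteq> U" using open_prod_elim[OF U] by metis
  obtain r1 where r1: "r1 > 0" "cball x0 r1 \<subseteq> X" using XY z0 open_contains_cball by blast
  obtain r2 where r2: "r2 > 0" "cball y0 r2 \<subseteq> Y" using XY z0 open_contains_cball by blast
  define V where "V = {x0 - r1<..<x0 + r1} \<times> {y0 - r2<..<y0 + r2}"
  have box: "{x0 - r1<..<x0 + r1} \<times> {y0 - r2..y0 + r2} \<subseteq> U"
  proof -
    have "{x0 - r1<..<x0 + r1} \<subseteq> X" using r1(2) by (auto simp: subset_iff dist_real_def)
    moreover have "{y0 - r2..y0 + r2} \<subseteq> Y" using r2(2) by (auto simp: subset_iff dist_real_def)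
    ultimately show ?thesis using XY(4) by blast
  qed
  have V: "open V" "V \<subseteq> U" "z0 \<in> V" unfolding V_def using box r1 r2 z0 by (auto intro: open_Times)
  define F where "F = vertical_integral (y0 - r2) f"
  have ckF: "Ck_on k V F" for k
    unfolding F_def V_def by (rule Ck_on_vertical_integral[OF U(1) f(1) box])
  obtain Fx where dF: "(F has_derivative (\<lambda>v. fst v * Fx z + snd v * f z)) (at z)" if "z \<in> V" for z
    using vertical_integral_has_derivative[OF U(1) f(1) box] unfolding F_def V_def by blast
  define \<Psi>0 where "\<Psi>0 z = complex_of_real (fst z - x0) + \<i> * complex_of_real (F z - F z0)" for z
  have inj: "inj_on \<Psi>0 V"
  proof (rule inj_onI)
    fix p q assume pq: "p \<in> V" "q \<in> V" "\<Psi>0 p = \<Psi>0 q"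
    then have e: "fst p = fst q" "F p = F q" by (auto simp: \<Psi>0_def complex_eq_iff)
    have "snd p = snd q"
    proof (rule ccontr)
      define l u where "l = min (snd p) (snd q)" and "u = max (snd p) (snd q)"
      assume "snd p \<noteq> snd q"
      then have lu: "l < u" by (auto simp: l_def u_def)
      have "F (fst p, snd p) = F p" "F (fst p, snd q) = F q" by (simp only: prod.collapse) (simp only: e(1) prod.collapse)
      then have Fl: "F (fst p, l) = F (fst p, u)"
        using e(2) by (cases "snd p \<le> snd q") (simp_all add: l_def u_def min_def max_def)
      have inV: "(fst p, y) \<in> V" if "l \<le> y" "y \<le> u" for y
        using pq(1,2) that unfolding V_def l_def u_def by (auto simp: min_def max_def split: if_splits)
      have d: "((\<lambda>y. F (fst p, y)) has_real_derivative f (fst p, y)) (at y)" if "l \<le> y" "y \<le> u" for y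
      proof -
        have "((\<lambda>y. (fst p, y)) has_derivative (\<lambda>v. (0, v))) (at y)" by (auto intro!: derivative_eq_intros)
        from diff_chain_at[OF this dF[OF inV[OF that]]]
        have "((\<lambda>y. F (fst p, y)) has_derivative (\<lambda>v. v * f (fst p, y))) (at y)" by (simp add: comp_def)
        then show ?thesis unfolding has_field_derivative_def
          by (rule has_derivative_eq_rhs) (simp add: fun_eq_iff mult.commute)
      qed
      obtain y where y: "l < y" "y < u" "F (fst p, u) - F (fst p, l) = (u - l) * f (fst p, y)"
        using MVT2[OF lu, of "\<lambda>y. F (fst p, y)" "\<lambda>y. f (fst p, y)"] d by blast
      then have "f (fst p, y) = 0" using Fl lu by simp
      then show False using f(2) inV[of y] V(2) y by auto
    qed
    then show "p = q" using e by (simp add: prod_eq_iff)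
  qed
  have ck0: "Ck_on k V \<Psi>0" for k
    unfolding \<Psi>0_def
    by (intro Ck_on_add Ck_on_mult Ck_on_const V Ck_on_linear_compose[OF V(1) bounded_linear_of_real] Ck_on_diff ckF
        Ck_on_linear bounded_linear_fst)
  have "open (\<Psi>0 ` V)"
    using ck0[of 0] inj V by (intro invariance_of_domain_gen) (auto simp: DIM_complex)
  moreover have "0 \<in> \<Psi>0 ` V" using V(3) by (intro image_eqI[of _ _ z0]) (auto simp: \<Psi>0_def z0)
  ultimately obtain e where e: "e > 0" "cball 0 e \<subseteq> \<Psi>0 ` V" using open_contains_cball by blast
  define c where "c = 4 / e"
  have c: "c > 0" using e by (simp add: c_def)
  define \<Psi> where "\<Psi> z = c *\<^sub>R \<Psi>0 z" for z
  have ck: "Ck_on k V \<Psi>" for k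
    unfolding \<Psi>_def by (intro Ck_on_scaleR Ck_on_const V ck0)
  have injP: "inj_on \<Psi> V" using inj c by (auto simp: inj_on_def \<Psi>_def)
  have contP: "continuous_on V \<Psi>" using ck[of 0] by simp
  have openP: "open (\<Psi> ` V)" using contP injP V by (intro invariance_of_domain_gen) (auto simp: DIM_complex)
  have hom: "homeomorphism V (\<Psi> ` V) \<Psi> (inv_into V \<Psi>)"
    unfolding homeomorphism_def
    using contP injP V continuous_on_inverse_open[OF V(1) contP, of "inv_into V \<Psi>"] by (auto simp: DIM_complex)
  have ball: "cball 0 4 \<subseteq> \<Psi> ` V"
  proof
    fix w :: complex assume "w \<in> cball 0 4"
    then have "(1 / c) *\<^sub>R w \<in> cball 0 e" using e by (simp add: c_def field_simps)
    then obtain z where "z \<in> V" "(1 / c) *\<^sub>R w = \<Psi>0 z" using e by blast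
    then have "w = \<Psi> z" using c by (simp add: \<Psi>_def) (metis divide_self_if less_irrefl scaleR_one scaleR_scaleR times_divide_eq_right mult_1_right)
    then show "w \<in> \<Psi> ` V" using \<open>z \<in> V\<close> by blast
  qed
  have dP: "frechet_derivative \<Psi> (at z) p = c *\<^sub>R (complex_of_real (fst p) + \<i> * complex_of_real (fst p * Fx z + snd p * f z))"
    if "z \<in> V" for z p
  proof -
    have "(\<Psi> has_derivative (\<lambda>p. c *\<^sub>R (complex_of_real (fst p) + \<i> * complex_of_real (fst p * Fx z + snd p * f z)))) (at z)"
    proof -
      have "((\<lambda>z. F z - F z0) has_derivative (\<lambda>p. fst p * Fx z + snd p * f z)) (at z)"
        using has_derivative_diff[OF dF[OF that] has_derivative_const[of "F z0"]] by simp
      moreover have "((\<lambda>z::plane. fst z - x0) has_derivative fst) (at z)"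
        by (auto intro!: derivative_eq_intros)
      ultimately show ?thesis unfolding \<Psi>_def \<Psi>0_def
        by (intro has_derivative_scaleR_right has_derivative_add has_derivative_mult_right has_derivative_of_real)
    qed
    from frechet_derivative_at[OF this, symmetric] show ?thesis by (rule fun_cong)
  qed
  have "f z * det2 p q = (1 / c\<^sup>2) * Im (cnj (frechet_derivative \<Psi> (at z) p) * frechet_derivative \<Psi> (at z) q)"
    if "z \<in> V" for z p q
    unfolding dP[OF that] using c by (simp add: det2_def power2_eq_square field_simps)
  then show thesis by (rule that[OF V(1,2) ck hom openP ball])
qed

section \<open>The swap of two discs on a surface\<close>

text \<open>\<open>Im (cnj a * b)\<close> is the determinant of the plane vectors \<open>a\<close> and \<open>b\<close>.\<close>

lemma complex_det_cancel:
  assumes "Im (cnj d * a) = 0" "Im (cnj d * b) = 0" "Im (cnj a * b) \<noteq> 0"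
  shows "d = 0"
proof -
  have "Re d * Im a = Im d * Re a" "Re d * Im b = Im d * Re b" using assms by (auto simp: algebra_simps)
  then have "Re d * (Re a * Im b - Im a * Re b) = 0" "Im d * (Re a * Im b - Im a * Re b) = 0"
    by algebra+
  then show ?thesis using assms(3) by (auto simp: complex_eq_iff algebra_simps)
qed

text \<open>The set \<open>V\<close> is a piece of the image of the chart \<open>c\<close> away from the boundary, with area coordinates \<open>\<Psi>\<close>
on it.\<close>

locale swap_on_surface = smooth_surface A + swap_model u \<theta> w \<eta> L
  for A :: "'a::t2_space chart set" and u \<theta> w \<eta> :: "real \<Rightarrow> real" and L :: real +
  fixes \<omega> :: "'a tensor2" and c :: "'a chart" and V :: "plane set"
    and \<Psi> :: "plane \<Rightarrow> complex" and \<Psi>' :: "complex \<Rightarrow> plane" and \<kappa> :: real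
  assumes area: "area_form A \<omega>" and cA: "c \<in> A"
    and openV: "open V" and V_img: "V \<subseteq> chart_img c" and V_interior: "V \<subseteq> {z. 0 < snd z}"
    and smooth_\<Psi>: "\<And>k. Ck_on k V \<Psi>" and hom\<Psi>: "homeomorphism V (\<Psi> ` V) \<Psi> \<Psi>'"
    and open_image: "open (\<Psi> ` V)" and ball_image: "cball 0 4 \<subseteq> \<Psi> ` V"
    and darboux: "\<And>z p q. z \<in> V \<Longrightarrow> density \<omega> c z * det2 p q =
       \<kappa> * Im (cnj (frechet_derivative \<Psi> (at z) p) * frechet_derivative \<Psi> (at z) q)"
begin

text \<open>Transfer to the surface: \<open>\<psi>\<close> are the area coordinates on the open set \<open>U\<close>, and \<open>D\<close> is the closed disc
that carries the whole dynamics.\<close>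

definition U where "U = chart_dom c \<inter> coord c -` V"
definition \<psi> where "\<psi> x = \<Psi> (coord c x)"
definition \<psi>' where "\<psi>' z = chart_inv c (\<Psi>' z)"
definition D where "D = \<psi>' ` cball 0 4"

lemma \<Psi>'_facts:
  shows \<Psi>'\<Psi>: "z \<in> V \<Longrightarrow> \<Psi>' (\<Psi> z) = z" and \<Psi>\<Psi>': "y \<in> \<Psi> ` V \<Longrightarrow> \<Psi> (\<Psi>' y) = y" and \<Psi>'_in: "y \<in> \<Psi> ` V \<Longrightarrow> \<Psi>' y \<in> V"
    and cont\<Psi>: "continuous_on V \<Psi>" and cont\<Psi>': "continuous_on (\<Psi> ` V) \<Psi>'"
  using hom\<Psi> unfolding homeomorphism_def by auto

lemma chart_inv_V:
  assumes "z \<in> V"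
  shows "chart_inv c z \<in> chart_dom c" and "coord c (chart_inv c z) = z"
  using chart_simps(3,4)[OF cA subsetD[OF V_img assms]] .

lemma openU: "open U"
  unfolding U_def by (rule open_coord_preimage[OF cA openV])

lemma \<psi>_facts:
  shows \<psi>'\<psi>: "x \<in> U \<Longrightarrow> \<psi>' (\<psi> x) = x" and \<psi>\<psi>': "y \<in> \<Psi> ` V \<Longrightarrow> \<psi> (\<psi>' y) = y" and \<psi>'_in: "y \<in> \<Psi> ` V \<Longrightarrow> \<psi>' y \<in> U"
    and coord_\<psi>': "y \<in> \<Psi> ` V \<Longrightarrow> coord c (\<psi>' y) = \<Psi>' y"
    and cont\<psi>: "continuous_on U \<psi>" and cont\<psi>': "continuous_on (\<Psi> ` V) \<psi>'"
proof -
  show "x \<in> U \<Longrightarrow> \<psi>' (\<psi> x) = x" using cA by (auto simp: U_def \<psi>_def \<psi>'_def \<Psi>'\<Psi> chart_simps)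
  show c': "y \<in> \<Psi> ` V \<Longrightarrow> coord c (\<psi>' y) = \<Psi>' y"
    using \<Psi>'_in[of y] by (simp add: \<psi>'_def chart_inv_V)
  then show "y \<in> \<Psi> ` V \<Longrightarrow> \<psi> (\<psi>' y) = y" by (simp add: \<psi>_def \<Psi>\<Psi>')
  show "y \<in> \<Psi> ` V \<Longrightarrow> \<psi>' y \<in> U"
    using c' \<Psi>'_in[of y] by (simp add: U_def \<psi>'_def chart_inv_V)
  show "continuous_on U \<psi>" unfolding \<psi>_def U_def
    by (rule continuous_on_compose2[OF cont\<Psi>])
      (auto intro: continuous_on_subset[OF continuous_on_coord[OF is_chart_atlas[OF cA]]])
  show "continuous_on (\<Psi> ` V) \<psi>'" unfolding \<psi>'_def
    by (rule continuous_on_compose2[OF continuous_on_chart_inv[OF is_chart_atlas[OF cA]] cont\<Psi>'])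
      (use V_img \<Psi>'\<Psi> in auto)
qed

lemma ballD: "norm y \<le> 4 \<Longrightarrow> y \<in> \<Psi> ` V"
  using ball_image by (auto simp: subset_iff)

lemma D_iff: "x \<in> D \<longleftrightarrow> x \<in> U \<and> norm (\<psi> x) \<le> 4"
proof
  assume "x \<in> D"
  then obtain y where y: "norm y \<le> 4" "x = \<psi>' y" by (auto simp: D_def)
  then show "x \<in> U \<and> norm (\<psi> x) \<le> 4" using ballD[OF y(1)] \<psi>'_in \<psi>\<psi>' by simp
next
  assume "x \<in> U \<and> norm (\<psi> x) \<le> 4"
  then show "x \<in> D" unfolding D_def using \<psi>'\<psi> by (intro image_eqI[of _ _ "\<psi> x"]) auto
qed

lemma compactD: "compact D" unfolding D_def
  by (intro compact_continuous_image continuous_on_subset[OF cont\<psi>' ball_image]) auto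

lemma closedD: "closed D" using compactD by (rule compact_imp_closed)

lemma homeomorphismD: "homeomorphism D (cball 0 4) \<psi> \<psi>'"
proof (rule homeomorphismI)
  show "continuous_on D \<psi>" by (rule continuous_on_subset[OF cont\<psi>]) (auto simp: D_iff)
  show "continuous_on (cball 0 4) \<psi>'" by (rule continuous_on_subset[OF cont\<psi>' ball_image])
qed (use ballD \<psi>\<psi>' \<psi>'\<psi> \<psi>'_in in \<open>auto simp: D_iff\<close>)

definition hamiltonian :: "real \<Rightarrow> 'a \<Rightarrow> real" where
  "hamiltonian t x = (if x \<in> U then \<kappa> * model_hamiltonian t (\<psi> x) else 0)"

definition swap_flow :: "real \<Rightarrow> 'a \<Rightarrow> 'a" where
  "swap_flow t x = (if x \<in> D then \<psi>' (flow t (\<psi> x)) else x)"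

lemma hamiltonian_outside: "x \<notin> D \<Longrightarrow> hamiltonian t x = 0"
  using model_hamiltonian_outer[of "\<psi> x" t] by (auto simp: hamiltonian_def D_iff)

text \<open>Near a point of \<open>U\<close> the Hamiltonian is a composition of smooth maps. A point outside \<open>U\<close> lies outside
the closed set \<open>D\<close>, and near it the Hamiltonian vanishes.\<close>

lemma smooth_hamiltonian:
  assumes d: "d \<in> A"
  shows "smooth_on ({0..1} \<times> chart_img d) (\<lambda>(t, z). hamiltonian t (chart_inv d z))"
proof (rule smooth_on_local)
  fix p assume p: "p \<in> {0..1::real} \<times> chart_img d"
  then obtain t z where tz: "p = (t, z)" "z \<in> chart_img d" by auto
  have nbhd: "\<exists>W. open W \<and> p \<in> W \<and> (\<forall>s y. (s, y) \<in> W \<inter> ({0..1} \<times> chart_img d) \<longrightarrow> chart_inv d y \<in> M)"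
    if M: "open M" "chart_inv d z \<in> M" for M
  proof -
    obtain W where W: "open W" "{z \<in> chart_img d. chart_inv d z \<in> M} = half_plane \<inter> W"
      using openin_chart_preimage[OF is_chart_atlas[OF d] M(1)] by (auto simp: openin_open)
    have "chart_img d \<subseteq> half_plane" using chart_openin_img[OF is_chart_atlas[OF d]] openin_imp_subset by blast
    then have "chart_inv d y \<in> M" if "y \<in> W" "y \<in> chart_img d" for y using W(2) that by blast
    moreover have "z \<in> W" using W(2) tz M(2) by blast
    ultimately show ?thesis using W(1) tz
      by (intro exI[of _ "UNIV \<times> W"]) (auto intro: open_Times)
  qed
  show "\<exists>W. open W \<and> p \<in> W \<and> smooth_on (W \<inter> ({0..1} \<times> chart_img d)) (\<lambda>(t, z). hamiltonian t (chart_inv d z))"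
  proof (cases "chart_inv d z \<in> U")
    case False
    then have "chart_inv d z \<in> - D" by (simp add: D_iff)
    then obtain W where W: "open W" "p \<in> W" "\<And>s y. (s, y) \<in> W \<inter> ({0..1} \<times> chart_img d) \<Longrightarrow> chart_inv d y \<in> - D"
      using nbhd[of "- D"] closedD by (auto simp: open_closed)
    have "smooth_on (W \<inter> ({0..1} \<times> chart_img d)) (\<lambda>(t, z). hamiltonian t (chart_inv d z))"
      by (rule smooth_on_cong_imp[OF _ smooth_on_const[of _ 0]]) (use W(3) hamiltonian_outside in auto)
    then show ?thesis using W by blast
  next
    case True
    then obtain W where W: "open W" "p \<in> W" "\<And>s y. (s, y) \<in> W \<inter> ({0..1} \<times> chart_img d) \<Longrightarrow> chart_inv d y \<in> U"
      using nbhd[OF openU] by blast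
    let ?S = "W \<inter> ({0..1} \<times> chart_img d)"
    have inO: "snd q \<in> overlap d c" "transition d c (snd q) \<in> V" if "q \<in> ?S" for q
    proof -
      have "snd q \<in> chart_img d" "chart_inv d (snd q) \<in> U" using that W(3)[of "fst q" "snd q"] by auto
      then show "snd q \<in> overlap d c" "transition d c (snd q) \<in> V"
        by (auto simp: overlap_eq[OF is_chart_atlas[OF d]] U_def transition_def)
    qed
    have s1: "smooth_on ?S (\<lambda>q. transition d c (snd q))"
      by (rule smooth_on_compose[OF smooth_on_linear[OF bounded_linear_snd] smooth_transition[OF d cA]]) (use inO in blast)
    have "smooth_on V \<Psi>" using smooth_\<Psi> smooth_on_open_iff[OF openV] by blast
    then have s2: "smooth_on ?S (\<lambda>q. \<Psi> (transition d c (snd q)))"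
      by (rule smooth_on_compose[OF s1]) (use inO in blast)
    have s3: "smooth_on ?S (\<lambda>q. (fst q, \<Psi> (transition d c (snd q))))"
      by (intro smooth_on_Pair s2 smooth_on_linear bounded_linear_fst)
    have "smooth_on UNIV (\<lambda>(t, z). model_hamiltonian t z)"
      using smooth_model_hamiltonian smooth_on_Ck[OF open_UNIV] by blast
    from smooth_on_compose[OF s3 this]
    have "smooth_on ?S (\<lambda>q. model_hamiltonian (fst q) (\<Psi> (transition d c (snd q))))" by simp
    then have "smooth_on ?S (\<lambda>q. \<kappa> * model_hamiltonian (fst q) (\<Psi> (transition d c (snd q))))"
      by (intro smooth_on_mult smooth_on_const)
    then have "smooth_on ?S (\<lambda>(t, z). hamiltonian t (chart_inv d z))"
    proof (rule smooth_on_cong_imp[rotated])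
      fix q assume q: "q \<in> ?S"
      then have "chart_inv d (snd q) \<in> U" using W(3)[of "fst q" "snd q"] by auto
      then show "\<kappa> * model_hamiltonian (fst q) (\<Psi> (transition d c (snd q))) = (case q of (t, z) \<Rightarrow> hamiltonian t (chart_inv d z))"
        by (simp add: hamiltonian_def case_prod_beta transition_def \<psi>_def)
    qed
    then show ?thesis using W by blast
  qed
qed

lemma smooth_function_hamiltonian:
  assumes "t \<in> {0..1}"
  shows "smooth_function (hamiltonian t)"
  unfolding smooth_function_def
proof
  fix d assume d: "d \<in> A"
  have "smooth_on (chart_img d) (\<lambda>z. (t, z))"
    by (intro smooth_on_Pair smooth_on_const smooth_on_linear[of "\<lambda>z. z"] bounded_linear_ident)
  from smooth_on_compose[OF this smooth_hamiltonian[OF d]]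
  have "smooth_on (chart_img d) (\<lambda>z. case (t, z) of (t, z) \<Rightarrow> hamiltonian t (chart_inv d z))"
    using assms by (simp add: image_subset_iff)
  then show "smooth_on (chart_img d) (\<lambda>z. hamiltonian t (chart_inv d z))" by (simp only: prod.case)
qed

lemma hamiltonian_admissible: "admissible_hamiltonian A hamiltonian"
  unfolding admissible_hamiltonian_def
proof (intro conjI ballI exI[of _ D])
  show "D \<subseteq> manifold_interior A"
  proof
    fix x assume "x \<in> D"
    then have "x \<in> chart_dom c" "coord c x \<in> V" by (auto simp: D_iff U_def)
    then show "x \<in> manifold_interior A" using cA V_interior unfolding manifold_interior_def by blast
  qed
qed (use smooth_hamiltonian compactD hamiltonian_outside in auto)

lemma thickV: "thick V"
proof (rule thick_openin[OF thick_half_plane])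
  have "V = half_plane \<inter> V" using V_interior by (auto simp: half_plane_def)
  then show "openin (top_of_set half_plane) V" using openV by (auto simp: openin_open)
qed

lemma \<Psi>_derivative: "z \<in> V \<Longrightarrow> (\<Psi> has_derivative frechet_derivative \<Psi> (at z)) (at z)"
  by (rule Ck_on_has_derivative[OF openV smooth_\<Psi>])

text \<open>Both sides have the same determinant with every vector: this is the defining equation of the Hamiltonian
vector field, once on the surface and once for the model, related by \<open>darboux\<close>.\<close>

lemma field_in_coordinates:
  assumes t: "t \<in> {0..1}" and X: "hamiltonian_vector_field A \<omega> (hamiltonian t) X" and x: "x \<in> U"
  shows "frechet_derivative \<Psi> (at (coord c x)) (X x c) = model_field t (\<psi> x)"
proof -
  define z where "z = coord c x"
  have z: "z \<in> V" "x \<in> chart_dom c" using x by (auto simp: z_def U_def)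
  let ?D = "frechet_derivative \<Psi> (at z)"
  let ?F = "frechet_derivative (hamiltonian t \<circ> chart_inv c) (at z within chart_img c)"
  have "((\<lambda>z. \<kappa> * model_hamiltonian t (\<Psi> z)) has_derivative (\<lambda>p. \<kappa> * Im (cnj (model_field t (\<Psi> z)) * ?D p))) (at z)"
    using has_derivative_mult_right[OF has_derivative_compose[OF \<Psi>_derivative[OF z(1)] model_hamiltonian_derivative]] .
  then have "((\<lambda>z. \<kappa> * model_hamiltonian t (\<Psi> z)) has_derivative (\<lambda>p. \<kappa> * Im (cnj (model_field t (\<Psi> z)) * ?D p))) (at z within V)"
    by (rule has_derivative_at_withinI)
  then have d1: "((hamiltonian t \<circ> chart_inv c) has_derivative (\<lambda>p. \<kappa> * Im (cnj (model_field t (\<Psi> z)) * ?D p))) (at z within V)"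
  proof (rule has_derivative_transform[OF z(1), rotated])
    fix y assume "y \<in> V"
    then have "chart_inv c y \<in> U" "coord c (chart_inv c y) = y" by (simp_all add: U_def chart_inv_V)
    then show "(hamiltonian t \<circ> chart_inv c) y = \<kappa> * model_hamiltonian t (\<Psi> y)"
      by (simp add: hamiltonian_def \<psi>_def)
  qed
  have d2: "((hamiltonian t \<circ> chart_inv c) has_derivative ?F) (at z within V)"
    using has_derivative_subset[OF smooth_function_has_derivative[OF smooth_function_hamiltonian[OF t] cA z(2)] V_img]
    by (simp add: z_def)
  have F: "?F p = \<kappa> * Im (cnj (model_field t (\<Psi> z)) * ?D p)" for p
    using fun_cong[OF thick_derivative_unique[OF thickV z(1) d2 d1]] .
  have e: "\<kappa> * Im (cnj (?D (X x c)) * ?D p) = \<kappa> * Im (cnj (model_field t (\<Psi> z)) * ?D p)" for p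
  proof -
    have "\<kappa> * Im (cnj (?D (X x c)) * ?D p) = density \<omega> c z * det2 (X x c) p"
      by (rule darboux[OF z(1), symmetric])
    also have "\<dots> = ?F p"
      using hamiltonian_vector_field_component[OF area X cA z(2), of p] by (simp only: z_def)
    finally show ?thesis unfolding F .
  qed
  have "density \<omega> c z \<noteq> 0" using density_nonzero[OF area cA] z(1) V_img by blast
  then have nd: "\<kappa> * Im (cnj (?D (1,0)) * ?D (0,1)) \<noteq> 0" using darboux[OF z(1), of "(1,0)" "(0,1)"] by (simp add: det2_def)
  have "Im (cnj (?D (X x c) - model_field t (\<Psi> z)) * ?D p) = 0" for p
    using e[of p] nd unfolding complex_cnj_diff left_diff_distrib minus_complex.sel
    by (simp only: mult_cancel_left) auto
  note zero = this
  have "Im (cnj (?D (1,0)) * ?D (0,1)) \<noteq> 0" using nd unfolding mult_eq_0_iff by blast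
  then have "?D (X x c) - model_field t (\<Psi> z) = 0" by (rule complex_det_cancel[OF zero zero])
  then show ?thesis by (simp add: z_def \<psi>_def)
qed

lemma field_outside:
  assumes t: "t \<in> {0..1}" and X: "hamiltonian_vector_field A \<omega> (hamiltonian t) X" and x: "x \<notin> D"
    and d: "d \<in> A" "x \<in> chart_dom d"
  shows "X x d = 0"
proof -
  define z where "z = coord d x"
  let ?F = "frechet_derivative (hamiltonian t \<circ> chart_inv d) (at z within chart_img d)"
  define S where "S = {z \<in> chart_img d. chart_inv d z \<in> - D}"
  have th: "thick S" unfolding S_def by (rule thick_chart_preimage[OF is_chart_atlas[OF d(1)]]) (use closedD in auto)
  have zS: "z \<in> S" using d x by (simp add: S_def z_def chart_simps)
  have d2: "((hamiltonian t \<circ> chart_inv d) has_derivative ?F) (at z within S)"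
    unfolding z_def by (rule has_derivative_subset[OF smooth_function_has_derivative[OF smooth_function_hamiltonian[OF t] d]]) (auto simp: S_def)
  have "((hamiltonian t \<circ> chart_inv d) has_derivative (\<lambda>p. 0)) (at z within S)"
    by (rule has_derivative_transform[OF zS _ has_derivative_const[of 0]]) (auto simp: S_def hamiltonian_outside)
  from thick_derivative_unique[OF th zS d2 this] have F: "?F = (\<lambda>p. 0)" .
  have "density \<omega> d z * det2 (X x d) p = 0" for p
    using hamiltonian_vector_field_component[OF area X d, of p] F by (simp add: z_def)
  moreover have "density \<omega> d z \<noteq> 0" using density_nonzero[OF area d(1)] d by (simp add: z_def chart_simps)
  ultimately have "det2 (X x d) p = 0" for p by simp
  from this[of "(1,0)"] this[of "(0,1)"] show ?thesis by (auto simp: det2_def prod_eq_iff)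
qed

text \<open>In the chart \<open>c\<close> the curve is the image under \<open>\<Psi>'\<close> of an explicit flow line of the model, and the
derivative of \<open>\<Psi>'\<close> is a left inverse of that of \<open>\<Psi>\<close>, which takes the Hamiltonian vector field to
\<open>model_field\<close>. For the other charts the transition maps are applied.\<close>

lemma swap_flow_curve:
  assumes X: "\<And>t. t \<in> {0..1} \<Longrightarrow> hamiltonian_vector_field A \<omega> (hamiltonian t) (X t)" and x: "x \<in> D"
  shows "integral_curve A {0..1} X (\<lambda>t. swap_flow t x)"
proof -
  define \<zeta> where "\<zeta> t = flow t (\<psi> x)" for t
  have \<zeta>4: "norm (\<zeta> t) \<le> 4" for t unfolding \<zeta>_def by (rule norm_flow_le) (use x in \<open>simp add: D_iff\<close>)
  then have \<zeta>V: "\<zeta> t \<in> \<Psi> ` V" for t by (rule ballD)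
  define \<gamma> where "\<gamma> t = \<psi>' (\<zeta> t)" for t
  have sf: "(\<lambda>t. swap_flow t x) = \<gamma>" using x by (auto simp: swap_flow_def \<gamma>_def \<zeta>_def)
  have \<gamma>U: "\<gamma> t \<in> U" for t unfolding \<gamma>_def using \<zeta>V \<psi>'_in by blast
  have c\<gamma>: "coord c (\<gamma> t) = \<Psi>' (\<zeta> t)" for t unfolding \<gamma>_def by (rule coord_\<psi>'[OF \<zeta>V])
  have \<psi>\<gamma>: "\<psi> (\<gamma> t) = \<zeta> t" for t unfolding \<gamma>_def by (rule \<psi>\<psi>'[OF \<zeta>V])
  have d\<zeta>: "(\<zeta> has_vector_derivative model_field t (\<zeta> t)) (at t within S)" for t S
    unfolding \<zeta>_def by (rule flow_derivative)
  have "continuous_on {0..1} \<zeta>" using d\<zeta> by (intro continuous_on_vector_derivative) blast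
  then have cont: "continuous_on {0..1} \<gamma>" unfolding \<gamma>_def
    by (rule continuous_on_compose2[OF cont\<psi>']) (use \<zeta>V in auto)
  have dc: "((coord c \<circ> \<gamma>) has_vector_derivative X t (\<gamma> t) c) (at t within S)" if t: "t \<in> {0..1}" for t S
  proof -
    define z where "z = \<Psi>' (\<zeta> t)"
    have z: "z \<in> V" "\<Psi> z = \<zeta> t" unfolding z_def using \<Psi>'_in \<Psi>\<Psi>' \<zeta>V by auto
    let ?D = "frechet_derivative \<Psi> (at z)"
    have lin: "bounded_linear ?D" using \<Psi>_derivative[OF z(1)] by (rule has_derivative_bounded_linear)
    have "inj ?D"
    proof -
      have "p = 0" if "?D p = 0" for p
      proof -
        have "density \<omega> c z * det2 p q = 0" for q using darboux[OF z(1), of p q] that by simp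
        moreover have "density \<omega> c z \<noteq> 0" using density_nonzero[OF area cA] z(1) V_img by blast
        ultimately have "det2 p q = 0" for q by simp
        from this[of "(1,0)"] this[of "(0,1)"] show ?thesis by (auto simp: det2_def prod_eq_iff)
      qed
      then show ?thesis using bounded_linear.linear[OF lin] linear_injective_0 by blast
    qed
    then obtain g' where g': "linear g'" "g' \<circ> ?D = id"
      using linear_injective_left_inverse bounded_linear.linear[OF lin] by blast
    have "(\<Psi>' has_derivative g') (at (\<zeta> t))"
    proof (rule has_derivative_inverse_basic[where T="\<Psi> ` V"])
      show "(\<Psi> has_derivative ?D) (at (\<Psi>' (\<zeta> t)))" using \<Psi>_derivative[OF z(1)] by (simp add: z_def)
      show "continuous (at (\<zeta> t)) \<Psi>'" using cont\<Psi>' open_image \<zeta>V continuous_on_eq_continuous_at by blast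
    qed (use g' open_image \<zeta>V \<Psi>\<Psi>' in \<open>auto simp: linear_conv_bounded_linear\<close>)
    then have "((\<Psi>' \<circ> \<zeta>) has_derivative (g' \<circ> (\<lambda>h. h *\<^sub>R model_field t (\<zeta> t)))) (at t within S)"
      using diff_chain_within[OF d\<zeta>[unfolded has_vector_derivative_def] has_derivative_at_withinI] by blast
    moreover have "g' \<circ> (\<lambda>h. h *\<^sub>R model_field t (\<zeta> t)) = (\<lambda>h. h *\<^sub>R g' (model_field t (\<zeta> t)))"
      using linear_cmul[OF g'(1)] by auto
    moreover have "\<Psi>' \<circ> \<zeta> = coord c \<circ> \<gamma>" using c\<gamma> by auto
    moreover have "g' (model_field t (\<zeta> t)) = X t (\<gamma> t) c"
    proof -
      have "?D (X t (\<gamma> t) c) = model_field t (\<zeta> t)"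
        using field_in_coordinates[OF t X[OF t] \<gamma>U] by (simp add: c\<gamma> z_def \<psi>\<gamma>)
      then show ?thesis using g'(2) by (metis comp_apply id_apply)
    qed
    ultimately show ?thesis unfolding has_vector_derivative_def by simp
  qed
  have "((coord d \<circ> \<gamma>) has_vector_derivative X t (\<gamma> t) d) (at t within {0..1})"
    if t: "t \<in> {0..1}" and d: "d \<in> A" "\<gamma> t \<in> chart_dom d" for t d
  proof -
    have "openin (top_of_set {0..1}) ({0..1} \<inter> \<gamma> -` chart_dom d)"
      using cont chart_open_dom[OF is_chart_atlas[OF d(1)]] by (rule continuous_openin_preimage_gen)
    then obtain W where W: "open W" "{0..1} \<inter> \<gamma> -` chart_dom d = {0..1} \<inter> W" by (auto simp: openin_open)
    define S where "S = {0..1} \<inter> \<gamma> -` chart_dom d"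
    have tS: "t \<in> S" using t d by (simp add: S_def)
    have at: "at t within S = at t within {0..1}"
      by (rule at_within_rel_open[OF W(1)]) (use tS W(2) in \<open>auto simp: S_def\<close>)
    have gc: "\<gamma> s \<in> chart_dom c" for s using \<gamma>U by (simp add: U_def)
    have "(coord c \<circ> \<gamma>) ` S \<subseteq> overlap c d" using gc by (auto simp: S_def overlap_def)
    then have tr: "(transition c d has_derivative transition_deriv c d (\<gamma> t)) (at ((coord c \<circ> \<gamma>) t) within (coord c \<circ> \<gamma>) ` S)"
      using has_derivative_subset[OF has_derivative_transition[OF cA d(1) gc d(2)]] by simp
    from diff_chain_within[OF dc[OF t, unfolded has_vector_derivative_def] this]
    have "((coord d \<circ> \<gamma>) has_derivative (transition_deriv c d (\<gamma> t) \<circ> (\<lambda>h. h *\<^sub>R X t (\<gamma> t) c))) (at t within S)"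
      by (rule has_derivative_transform[OF tS, rotated]) (use gc cA in \<open>auto simp: transition_coord\<close>)
    moreover have "transition_deriv c d (\<gamma> t) \<circ> (\<lambda>h. h *\<^sub>R X t (\<gamma> t) c) = (\<lambda>h. h *\<^sub>R X t (\<gamma> t) d)"
    proof -
      have "X t (\<gamma> t) \<in> tangent_space A (\<gamma> t)"
        using X[OF t] by (simp add: hamiltonian_vector_field_def smooth_vector_field_def)
      then have "X t (\<gamma> t) d = transition_deriv c d (\<gamma> t) (X t (\<gamma> t) c)"
        unfolding tangent_space_def using cA d gc by blast
      then show ?thesis
        using bounded_linear.linear[OF transition_deriv_linear[OF cA d(1) gc d(2)]] by (auto simp: linear_cmul)
    qed
    ultimately show ?thesis unfolding has_vector_derivative_def at by simp
  qed
  then show ?thesis unfolding integral_curve_def sf using cont by blast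
qed

lemma swap_in_Ham: "swap_flow 1 \<in> Ham A \<omega>"
proof -
  have "\<forall>t\<in>{0..1}. \<exists>X. hamiltonian_vector_field A \<omega> (hamiltonian t) X"
    using hamiltonian_vector_field_exists[OF area smooth_function_hamiltonian] by blast
  then obtain X where X: "\<And>t. t \<in> {0..1} \<Longrightarrow> hamiltonian_vector_field A \<omega> (hamiltonian t) (X t)" by metis
  have "flow_on A {0..1} X swap_flow"
    unfolding flow_on_def
  proof (intro allI conjI)
    fix x
    show "swap_flow 0 x = x" using \<psi>'\<psi> by (auto simp: swap_flow_def flow_0 D_iff)
    show "integral_curve A {0..1} X (\<lambda>t. swap_flow t x)"
    proof (cases "x \<in> D")
      case False
      then have "(\<lambda>t. swap_flow t x) = (\<lambda>t. x)" by (simp add: swap_flow_def)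
      then show ?thesis
        using field_outside[OF _ X False] by (auto simp: integral_curve_def comp_def)
    qed (rule swap_flow_curve[OF X])
  qed
  then show ?thesis unfolding Ham_def using hamiltonian_admissible X by blast
qed

lemma swap_in_D: "x \<in> D \<Longrightarrow> swap_flow 1 x \<in> D \<and> \<psi> (swap_flow 1 x) = G (\<psi> x)"
proof -
  assume x: "x \<in> D"
  then have "norm (G (\<psi> x)) \<le> 4" by (intro norm_flow_le) (simp add: D_iff)
  then show ?thesis using x ballD \<psi>\<psi>' \<psi>'_in by (simp add: swap_flow_def D_iff)
qed

lemma swap_entropy: "topological_entropy (swap_flow 1) = 0"
proof (rule topological_entropy_zero_polynomial_growth[OF homeomorphismD])
  show "dist ((G ^^ n) z) ((G ^^ n) y) \<le> (1 + 72 * L * real n) ^ 3 * dist z y"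
    if "z \<in> cball 0 4" "y \<in> cball 0 4" for n z y
    using G_iterate_lipschitz[of z y n] that by (simp add: dist_norm)
qed (use swap_in_D L(1) in \<open>auto simp: swap_flow_def\<close>)

end

section \<open>The obstruction\<close>

text \<open>Since \<open>2 p - z\<close> is the half turn about \<open>p\<close>, the average of \<open>z\<close> and \<open>T z\<close> is \<open>s\<close>-close to \<open>p\<close>, and
Brouwer's theorem applies to \<open>z \<mapsto> (z + T z) / 2\<close>, which has the same fixed points as \<open>T\<close>.\<close>

lemma fixed_point_near_rotation:
  fixes T :: "complex \<Rightarrow> complex"
  assumes r: "0 < r" and T: "continuous_on (cball p r) T"
    and near: "\<And>z. z \<in> cball p r \<Longrightarrow> dist (T z) (2 * p - z) \<le> 2 * s" and s: "s \<le> r"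
  obtains z where "z \<in> cball p s" "T z = z"
proof -
  define S where "S z = (1/2) *\<^sub>R (z + T z)" for z
  have S: "dist p (S z) \<le> s" if "z \<in> cball p r" for z
  proof -
    have "S z - p = (1/2) *\<^sub>R (T z - (2 * p - z))" by (simp add: S_def scaleR_conv_of_real algebra_simps)
    then have "norm (S z - p) = (1/2) * norm (T z - (2 * p - z))" by simp
    then show ?thesis using near[OF that] by (simp add: dist_norm norm_minus_commute)
  qed
  have "continuous_on (cball p r) S" unfolding S_def using T by (intro continuous_intros)
  moreover have "S \<in> cball p r \<rightarrow> cball p r" using S s by force
  ultimately obtain z where z: "z \<in> cball p r" "S z = z" by (rule brouwer_ball[OF r])
  have "z + T z = 2 *\<^sub>R S z" by (simp add: S_def)
  then have "T z = z" using z(2) by (simp add: scaleR_2)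
  then show thesis using S[OF z(1)] z(2) by (intro that[of z]) auto
qed

context swap_on_surface begin

text \<open>The area coordinates are uniformly continuous near the compact disc, so closeness in the chart \<open>c\<close> passes
on to them.\<close>

lemma riemannian_dist_model_coordinates:
  assumes \<rho>: "riemannian_metric A \<rho>" and \<delta>: "0 < \<delta>"
  obtains \<epsilon> :: real where "0 < \<epsilon>"
    "\<And>x y. x \<in> D \<Longrightarrow> riemannian_dist A \<rho> x y < ereal \<epsilon> \<Longrightarrow> y \<in> U \<and> dist (\<psi> x) (\<psi> y) < \<delta>"
proof -
  define K where "K = \<Psi>' ` cball 0 4"
  have K: "compact K" unfolding K_def
    by (intro compact_continuous_image continuous_on_subset[OF cont\<Psi>' ball_image]) auto
  have KV: "K \<subseteq> V" unfolding K_def using \<Psi>'_in ballD by auto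
  obtain e where e: "e > 0" "(\<Union>z\<in>K. cball z e) \<subseteq> V"
    by (rule compact_subset_open_imp_cball_epsilon_subset[OF K openV KV])
  have "uniformly_continuous_on (\<Union>z\<in>K. cball z e) \<Psi>"
    by (intro compact_uniformly_continuous continuous_on_subset[OF cont\<Psi> e(2)] compact_minkowski_sum_cball K)
  then obtain d where d: "d > 0" "\<And>z y. z \<in> (\<Union>z\<in>K. cball z e) \<Longrightarrow> y \<in> (\<Union>z\<in>K. cball z e) \<Longrightarrow> dist y z < d \<Longrightarrow> dist (\<Psi> y) (\<Psi> z) < \<delta>"
    unfolding uniformly_continuous_on_def using \<delta> by metis
  have "0 < min d e" using d e by simp
  then obtain \<epsilon> where \<epsilon>: "0 < \<epsilon>" "\<And>x y. x \<in> chart_dom c \<Longrightarrow> coord c x \<in> K \<Longrightarrow> riemannian_dist A \<rho> x y < ereal \<epsilon> \<Longrightarrow>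
        y \<in> chart_dom c \<and> coord c y \<in> V \<and> dist (coord c x) (coord c y) < min d e"
    by (rule riemannian_dist_coordinates[OF \<rho> cA openV V_img K KV]) (rule that)
  show thesis
  proof (rule that[OF \<epsilon>(1)])
    fix x y assume x: "x \<in> D" and xy: "riemannian_dist A \<rho> x y < ereal \<epsilon>"
    obtain w where w: "norm w \<le> 4" "x = \<psi>' w" using x by (auto simp: D_def)
    then have xK: "coord c x \<in> K" using coord_\<psi>'[OF ballD[OF w(1)]] by (auto simp: K_def)
    have "x \<in> chart_dom c" using x by (simp add: D_iff U_def)
    from \<epsilon>(2)[OF this xK xy]
    have y: "y \<in> chart_dom c" "coord c y \<in> V" "dist (coord c x) (coord c y) < min d e" by auto
    have "coord c x \<in> (\<Union>z\<in>K. cball z e)" "coord c y \<in> (\<Union>z\<in>K. cball z e)"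
      using xK e(1) y(3) by (auto intro!: bexI[of _ "coord c x"])
    then have "dist (\<Psi> (coord c x)) (\<Psi> (coord c y)) < \<delta>" using y(3) by (intro d(2)) auto
    then show "y \<in> U \<and> dist (\<psi> x) (\<psi> y) < \<delta>" using y by (simp add: U_def \<psi>_def)
  qed
qed

text \<open>The flow line through a point \<open>q\<close> of period two would have to leave a disc through its boundary circle
while consisting of fixed points of \<open>h\<^sup>2\<close>; but on the circle \<open>h\<^sup>2\<close> is too close to the half turn to have
any.\<close>

lemma swap_not_approximable:
  assumes \<rho>: "riemannian_metric A \<rho>"
  shows "swap_flow 1 \<notin> C0_closure A \<rho> {h. autonomous A h}"
proof
  assume cl: "swap_flow 1 \<in> C0_closure A \<rho> {h. autonomous A h}"
  define C where "C = (1 + 72 * L) ^ 3"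
  \<comment> \<open>If \<open>h\<close> is \<open>\<delta>\<close>-close to \<open>G\<close>, then \<open>h\<^sup>2\<close> is \<open>(C + 1) \<delta>\<close>-close to \<open>G\<^sup>2\<close>: the error of the
    first step is enlarged by the Lipschitz constant \<open>C\<close> of \<open>G\<close>, the second step adds \<open>\<delta>\<close>. The total
    of \<open>1/4\<close> must stay below \<open>1\<close>, the displacement of the half turn on the circle of radius \<open>1/2\<close>.\<close>
  define \<delta> where "\<delta> = 1 / (4 * (C + 1))"
  have C: "1 \<le> C" unfolding C_def using L(1) by (intro one_le_power) simp
  have \<delta>: "0 < \<delta>" "\<delta> \<le> 1/8" "(C + 1) * \<delta> = 1/4" using C by (auto simp: \<delta>_def field_simps)
  have Glip: "dist (G z) (G y) \<le> C * dist z y" if "norm z \<le> 4" "norm y \<le> 4" for z y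
    using G_iterate_lipschitz[OF that, of 1] by (simp add: dist_norm C_def)
  obtain \<epsilon> where \<epsilon>: "0 < \<epsilon>"
    "\<And>x y. x \<in> D \<Longrightarrow> riemannian_dist A \<rho> x y < ereal \<epsilon> \<Longrightarrow> y \<in> U \<and> dist (\<psi> x) (\<psi> y) < \<delta>"
    by (rule riemannian_dist_model_coordinates[OF \<rho> \<delta>(1)]) (rule that)
  obtain h where aut: "autonomous A h" and near: "C0_dist A \<rho> (swap_flow 1) h < ereal \<epsilon>"
    using cl \<epsilon>(1) unfolding C0_closure_def by blast
  have close: "h x \<in> U \<and> dist (G (\<psi> x)) (\<psi> (h x)) < \<delta>" if x: "x \<in> D" for x
  proof -
    have "riemannian_dist A \<rho> (swap_flow 1 x) (h x) \<le> C0_dist A \<rho> (swap_flow 1) h"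
      unfolding C0_dist_def by (rule SUP_upper) simp
    then have "riemannian_dist A \<rho> (swap_flow 1 x) (h x) < ereal \<epsilon>" using near by (rule le_less_trans)
    then show ?thesis using \<epsilon>(2)[of "swap_flow 1 x" "h x"] swap_in_D[OF x] by auto
  qed
  obtain X \<phi> t where X: "smooth_vector_field A X" and \<phi>: "flow_on A UNIV (\<lambda>_. X) \<phi>" and h: "h = \<phi> t"
    using aut unfolding autonomous_def by blast
  have cont_h: "continuous_on UNIV h" using aut by (simp add: autonomous_def diffeomorphism_def smooth_map_def)
  have disc: "x \<in> D \<and> dist (\<psi> (h x)) (- 2) < 1 \<and> h (h x) \<in> U \<and> dist (\<psi> (h (h x))) (4 - \<psi> x) \<le> 1/4"
    if x: "x \<in> U" "\<psi> x \<in> cball 2 (1/2)" for x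
  proof -
    have n: "norm (\<psi> x - 2) \<le> 1/2" using x(2) by (simp add: dist_norm norm_minus_commute)
    have xD: "x \<in> D" using x n norm_triangle_ineq[of "\<psi> x - 2" 2] by (simp add: D_iff)
    note c1 = close[OF xD]
    have "norm (G (\<psi> x) + 2) = norm (- (\<i> * (\<psi> x - 2)))" using G_right(1)[OF n] by simp
    then have g1: "norm (G (\<psi> x) + 2) \<le> 1/2" using n by (simp add: norm_mult)
    then have h1: "dist (\<psi> (h x)) (- 2) < 1"
      using c1 \<delta>(2) norm_triangle_ineq[of "\<psi> (h x) - G (\<psi> x)" "G (\<psi> x) + 2"]
      by (simp add: dist_norm norm_minus_commute)
    have n4: "norm (G (\<psi> x)) \<le> 4" using xD by (intro norm_flow_le) (simp add: D_iff)
    have "norm (\<psi> (h x)) \<le> 4" using h1 norm_triangle_ineq4[of "\<psi> (h x) + 2" 2] by (simp add: dist_norm)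
    then have hD: "h x \<in> D" using c1 by (simp add: D_iff)
    note c2 = close[OF hD]
    have "dist (\<psi> (h (h x))) (4 - \<psi> x) \<le> dist (\<psi> (h (h x))) (G (\<psi> (h x))) + dist (G (\<psi> (h x))) (G (G (\<psi> x)))"
      using dist_triangle[of "\<psi> (h (h x))" "4 - \<psi> x" "G (\<psi> (h x))"] G_right(2)[OF n] by simp
    also have "\<dots> \<le> \<delta> + C * \<delta>"
    proof (rule add_mono)
      show "dist (\<psi> (h (h x))) (G (\<psi> (h x))) \<le> \<delta>" using c2 by (simp add: dist_commute)
      have "dist (G (\<psi> (h x))) (G (G (\<psi> x))) \<le> C * dist (\<psi> (h x)) (G (\<psi> x))"
        using hD n4 by (intro Glip) (simp_all add: D_iff)
      also have "\<dots> \<le> C * \<delta>" using c1 C by (intro mult_left_mono) (auto simp: dist_commute)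
      finally show "dist (G (\<psi> (h x))) (G (G (\<psi> x))) \<le> C * \<delta>" .
    qed
    also have "\<dots> = 1/4" using \<delta>(3) by (simp add: algebra_simps)
    finally show ?thesis using xD h1 c2 by simp
  qed
  have ball4: "z \<in> \<Psi> ` V" if "z \<in> cball 2 (1/2)" for z
    using that norm_triangle_ineq[of "z - 2" 2] by (intro ballD) (simp add: dist_norm norm_minus_commute)
  define T where "T z = \<psi> (h (h (\<psi>' z)))" for z
  have "continuous_on (cball 2 (1/2)) \<psi>'" by (rule continuous_on_subset[OF cont\<psi>']) (use ball4 in auto)
  then have "continuous_on (cball 2 (1/2)) (\<lambda>z. h (h (\<psi>' z)))"
    by (intro continuous_on_compose2[OF cont_h]) auto
  then have "continuous_on (cball 2 (1/2)) T" unfolding T_def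
    by (rule continuous_on_compose2[OF cont\<psi>]) (use disc ball4 \<psi>'_in \<psi>\<psi>' in auto)
  moreover have "dist (T z) (2 * 2 - z) \<le> 2 * (1/8)" if "z \<in> cball 2 (1/2)" for z
    using disc[of "\<psi>' z"] that \<psi>'_in[OF ball4[OF that]] \<psi>\<psi>'[OF ball4[OF that]] by (simp add: T_def)
  ultimately obtain z where z: "z \<in> cball 2 (1/8)" "T z = z"
    using fixed_point_near_rotation[of "1/2" 2 T "1/8"] by auto
  have z2: "z \<in> cball 2 (1/2)" using z(1) by auto
  define q where "q = \<psi>' z"
  have q: "q \<in> U" "\<psi> q = z" using \<psi>'_in[OF ball4[OF z2]] \<psi>\<psi>'[OF ball4[OF z2]] by (simp_all add: q_def)
  have dq: "dist (\<psi> (h q)) (- 2) < 1" "h (h q) \<in> U" using disc[OF q(1)] q(2) z2 by auto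
  have fixq: "h (h q) = q"
    using z(2) \<psi>'\<psi>[OF dq(2)] by (simp add: T_def q_def)
  \<comment> \<open>the whole flow line of \<open>q\<close> consists of fixed points of \<open>h\<^sup>2\<close>\<close>
  have stays: "h (h (\<phi> s q)) = \<phi> s q" for s
  proof -
    have "h (h (\<phi> s q)) = \<phi> s (h (h q))"
      unfolding h using flow_group_law[OF X \<phi>] by (simp add: algebra_simps)
    then show ?thesis using fixq by simp
  qed
  define P where "P = (\<lambda>s. \<phi> s q) ` UNIV"
  have "continuous_on UNIV (\<lambda>s. \<phi> s q)" using \<phi> by (simp add: flow_on_def integral_curve_def)
  then have conn: "connected P" unfolding P_def by (intro connected_continuous_image) auto
  define Q where "Q = U \<inter> \<psi> -` ball 2 (1/2)"
  define D1 where "D1 = \<psi>' ` cball 2 (1/2)"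
  have oQ: "open Q" unfolding Q_def using cont\<psi> openU by (intro continuous_open_preimage) auto
  have "compact D1" unfolding D1_def
    by (intro compact_continuous_image continuous_on_subset[OF cont\<psi>']) (use ball4 in auto)
  then have cD1: "closed D1" by (rule compact_imp_closed)
  have D1: "x \<in> D1 \<longleftrightarrow> x \<in> U \<and> \<psi> x \<in> cball 2 (1/2)" for x
  proof
    assume "x \<in> D1"
    then show "x \<in> U \<and> \<psi> x \<in> cball 2 (1/2)" unfolding D1_def using \<psi>'_in \<psi>\<psi>' ball4 by auto
  next
    assume "x \<in> U \<and> \<psi> x \<in> cball 2 (1/2)"
    then show "x \<in> D1" unfolding D1_def using \<psi>'\<psi> by (intro image_eqI[of _ _ "\<psi> x"]) auto
  qed
  \<comment> \<open>The flow line avoids the circle and is thus split by the two open sets \<open>Q\<close> and \<open>- D1\<close>.\<close>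
  have "P \<subseteq> Q \<union> (- D1)"
  proof
    fix x assume "x \<in> P"
    then have fx: "h (h x) = x" using stays by (auto simp: P_def)
    show "x \<in> Q \<union> (- D1)"
    proof (rule ccontr)
      assume "x \<notin> Q \<union> (- D1)"
      then have x: "x \<in> U" "\<psi> x \<in> cball 2 (1/2)" "dist 2 (\<psi> x) = 1/2" by (auto simp: Q_def D1)
      have "dist (\<psi> x) (4 - \<psi> x) \<le> 1/4" using disc[OF x(1,2)] fx by simp
      moreover have "dist (\<psi> x) (4 - \<psi> x) = 2 * dist 2 (\<psi> x)"
      proof -
        have "\<psi> x - (4 - \<psi> x) = - 2 * (2 - \<psi> x)" by simp
        then show ?thesis unfolding dist_norm by (simp only: norm_mult) simp
      qed
      ultimately show False using x(3) by simp
    qed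
  qed
  moreover have "q \<in> P" unfolding P_def using \<phi> by (intro image_eqI[of _ _ 0]) (auto simp: flow_on_def)
  moreover have "q \<in> Q" unfolding Q_def using q z(1) by auto
  moreover have "h q \<in> P" unfolding P_def h by auto
  moreover have "h q \<in> - D1"
  proof -
    have "dist (2::complex) (- 2) = 4" by (simp add: dist_norm)
    then have "dist (\<psi> (h q)) 2 > 1/2"
      using dq(1) dist_triangle[of "2::complex" "- 2" "\<psi> (h q)"] by (simp add: dist_commute)
    then show ?thesis unfolding Compl_iff D1 by (simp add: dist_commute)
  qed
  moreover have "Q \<inter> (- D1) = {}"
  proof -
    have "x \<in> D1" if "x \<in> Q" for x unfolding D1 using that by (auto simp: Q_def)
    then show ?thesis by blast
  qed
  ultimately show False
    using conn oQ cD1 unfolding connected_def open_closed[of "- D1"] by (simp, blast)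
qed

end

section \<open>Hamiltonian diffeomorphisms away from autonomous ones\<close>

theorem theorem1:
  fixes A :: "'a::{t2_space, second_countable_topology} chart set"
    and \<omega> :: "'a tensor2"
  assumes "smooth_atlas A"
    and "area_form A \<omega>"
  shows "\<exists>g\<in>Ham A \<omega>. topological_entropy g = 0 \<and>
           (\<forall>\<rho>. riemannian_metric A \<rho> \<longrightarrow> g \<notin> C0_closure A \<rho> {h. autonomous A h})"
proof -
  interpret smooth_surface A by unfold_locales (rule assms(1))
  obtain c where c: "c \<in> A" "undefined \<in> chart_dom c" by (rule ex_chart)
  obtain O' where O': "open O'" "chart_img c = half_plane \<inter> O'"
    using chart_openin_img[OF is_chart_atlas[OF c(1)]] by (auto simp: openin_open)
  have z1: "coord c undefined \<in> half_plane \<inter> O'" using O'(2) c by (metis chart_simps(1))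
  then obtain r where r: "r > 0" "ball (coord c undefined) r \<subseteq> O'" using O'(1) open_contains_ball by blast
  \<comment> \<open>The arbitrary point \<open>undefined\<close> may lie on the boundary; a shift upwards leads into the interior.\<close>
  define z0 where "z0 = coord c undefined + (0, r/2)"
  define N where "N = O' \<inter> {z. 0 < snd z}"
  have z0N: "z0 \<in> N"
  proof -
    have "dist (coord c undefined) z0 < r" using r(1) by (simp add: z0_def dist_norm norm_Pair)
    then show ?thesis using r z1 by (auto simp: N_def z0_def half_plane_def)
  qed
  have "open {z::plane. 0 < snd z}" by (intro open_Collect_less continuous_intros)
  then have oN: "open N" unfolding N_def by (rule open_Int[OF O'(1)])
  have "N \<subseteq> half_plane \<inter> O'" by (auto simp: N_def half_plane_def)
  then have NI: "N \<subseteq> chart_img c" by (simp only: O'(2))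
  have ck: "Ck_on k N (density \<omega> c)" for k
    using smooth_on_subset[OF NI smooth_density[OF assms(2) c(1)]] smooth_on_open_iff[OF oN] by blast
  have nz: "density \<omega> c z \<noteq> 0" if "z \<in> N" for z
    using density_nonzero[OF assms(2) c(1)] that NI by blast
  obtain V \<Psi> \<Psi>' \<kappa> where V: 
    "open V" "V \<subseteq> N" "\<And>k. Ck_on k V \<Psi>" "homeomorphism V (\<Psi> ` V) \<Psi> \<Psi>'" "open (\<Psi> ` V)" "cball 0 4 \<subseteq> \<Psi> ` V"
    "\<And>z p q. z \<in> V \<Longrightarrow> density \<omega> c z * det2 p q =
       \<kappa> * Im (cnj (frechet_derivative \<Psi> (at z) p) * frechet_derivative \<Psi> (at z) q)"
    by (rule darboux_chart[OF oN z0N ck nz]) (assumption, rule that)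
  obtain u \<theta> w \<eta> L where "swap_model u \<theta> w \<eta> L" by (rule swap_model_exists)
  then interpret swap_model u \<theta> w \<eta> L .
  interpret swap_on_surface A u \<theta> w \<eta> L \<omega> c V \<Psi> \<Psi>' \<kappa>
    by unfold_locales (use assms(2) c(1) V NI in \<open>auto simp: N_def\<close>)
  show ?thesis
    by (intro bexI[of _ "swap_flow 1"] conjI allI impI swap_entropy swap_not_approximable swap_in_Ham)
qed

end
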